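(* Let $X$ and $U$ be Hilbert spaces, let $\mathcal A$ be the infinitesimal generator of a $C_0$-semigroup $(e^{\mathcal A t})_{t\ge0}$ on $X$, and let $\mathcal B$ be an admissible input operator for $e^{\mathcal A t}$. Suppose that the system $\dot x=\mathcal A x+\mathcal B u$ is completely stabilizable by admissible $\mathcal A$-bounded feedbacks: for every $\omega>0$ there are an admissible output operator $\mathcal F_\omega: X_1\to U$ for $e^{\mathcal A t}$ and a constant $M_\omega\ge1$ such that $\Vert e^{(\mathcal A+\mathcal B\mathcal F_\omega)t}\Vert\le M_\omega e^{-\omega t}$ for all $t\ge0$. Then the system is completely stabilizable by bounded linear feedback: for every $\omega>0$ there are a bounded linear operator $\mathcal F\in\mathcal L(X,U)$ and a constant $M\ge1$ such that $\Vert e^{(\mathcal A+\mathcal B\mathcal F)t}\Vert\le M e^{-\omega t}$ for all $t\ge 0$.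
   Context: $X_1$ denotes $D(\mathcal A)$ endowed with the graph norm. Admissible input operator: a bounded linear operator $\mathcal B:U\to X$ is an admissible input operator for $e^{\mathcal A t}$ if there exist $t_1>0$ and $\beta>0$ such that for all $u\in L_2(0,t_1;U)$, $$\int_0^{t_1}e^{\mathcal A(t_1-\tau)}\mathcal B u(\tau)\,d\tau\in X_1,\qquad \left\Vert\int_0^{t_1}e^{\mathcal A(t_1-\tau)}\mathcal B u(\tau)\,d\tau\right\Vert_{X_1}\le\beta\Vert u\Vert_{L_2(0,t_1)} .$$ Admissible output operator: a linear operator $\mathcal F$, bounded from $X_1$ to a Hilbert space $Y$ (i.e. $\mathcal A$-bounded), is an admissible output operator for $e^{\mathcal A t}$ if there exist $t_1>0$ and $\alpha>0$ such that $\Vert \mathcal F e^{\mathcal A(t_1-\cdot)}x\Vert_{L_2(0,t_1;Y)}\le\alpha\Vert x\Vert_X$ for all $x\in X_1$. An admissible feedback is an admissible output operator with $Y=U$. For an admissible input operator $\mathcal B$ and an admissible feedback $\mathcal F$, $e^{(\mathcal A+\mathcal B\mathcal F)t}$ denotes the perturbed semigroup, characterized by $$e^{(\mathcal A+\mathcal B\mathcal F)t}x=e^{\mathcal A t}x+\int_0^t e^{\mathcal A(t-\tau)}\mathcal B\mathcal F e^{(\mathcal A+\mathcal B\mathcal F)\tau}x\,d\tau,\qquad x\in X_1,$$ which extends to a $C_0$-semigroup on $X$ (a known fact for the Pritchard–Salamon class). The norms of the semigroups in the claim are operator norms on $X$. *)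

theory Defs
  imports "HOL-Analysis.Analysis"
begin

text \<open>
  Hilbert spaces over the reals and over the complex numbers are treated uniformly.  The scalar
  field is a type of class \<^class>\<open>real_normed_field\<close> (by Gelfand--Mazur such a field is a copy
  of the reals or of the complex numbers).  In the complex case the library inner product is the
  real part of the complex one, which is recovered from it by polarization; the norm is the same.
\<close>

definition hilbert_space_over ::
  "('k::real_normed_field \<Rightarrow> 'x::{real_inner, complete_space} \<Rightarrow> 'x) \<Rightarrow> bool" where
  "hilbert_space_over scX \<longleftrightarrow>
     vector_space scX \<and>
     (\<forall>r x. scX (of_real r) x = r *\<^sub>R x) \<and>
     (\<forall>c x. norm (scX c x) = norm c * norm x)"

lemma hilbert_space_over_real:
  "hilbert_space_over ((*\<^sub>R) :: real \<Rightarrow> 'x::{real_inner, complete_space} \<Rightarrow> 'x)"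
  unfolding hilbert_space_over_def by (simp add: real_vector.vector_space_axioms)

lemma hilbert_space_over_complex: "hilbert_space_over ((*) :: complex \<Rightarrow> complex \<Rightarrow> complex)"
  unfolding hilbert_space_over_def
  by (auto simp: norm_mult scaleR_conv_of_real vector_space_def algebra_simps)

definition bounded_operator ::
  "('k::real_normed_field \<Rightarrow> 'x::{real_inner, complete_space} \<Rightarrow> 'x) \<Rightarrow>
   ('k \<Rightarrow> 'y::{real_inner, complete_space} \<Rightarrow> 'y) \<Rightarrow> ('x \<Rightarrow> 'y) \<Rightarrow> bool" where
  "bounded_operator scX scY L \<longleftrightarrow>
     Vector_Spaces.linear scX scY L \<and> (\<exists>C. \<forall>x. norm (L x) \<le> C * norm x)"

text \<open>The values of a semigroup at negative times are irrelevant.\<close>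

definition C0_semigroup ::
  "('k::real_normed_field \<Rightarrow> 'x::{real_inner, complete_space} \<Rightarrow> 'x) \<Rightarrow>
   (real \<Rightarrow> 'x \<Rightarrow> 'x) \<Rightarrow> bool" where
  "C0_semigroup scX T \<longleftrightarrow>
     (\<forall>t\<ge>0. bounded_operator scX scX (T t)) \<and>
     (\<forall>x. T 0 x = x) \<and>
     (\<forall>s\<ge>0. \<forall>t\<ge>0. \<forall>x. T (s + t) x = T s (T t x)) \<and>
     (\<forall>x. ((\<lambda>t. T t x) \<longlongrightarrow> x) (at_right 0))"

definition generator_domain ::
  "(real \<Rightarrow> 'x \<Rightarrow> 'x::{real_inner, complete_space}) \<Rightarrow> 'x set" where
  "generator_domain T = {x. \<exists>y. ((\<lambda>h. (T h x - x) /\<^sub>R h) \<longlongrightarrow> y) (at_right 0)}"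

text \<open>Only meaningful on \<open>generator_domain T\<close>.\<close>

definition generator ::
  "(real \<Rightarrow> 'x \<Rightarrow> 'x::{real_inner, complete_space}) \<Rightarrow> 'x \<Rightarrow> 'x" where
  "generator T x = Lim (at_right 0) (\<lambda>h. (T h x - x) /\<^sub>R h)"

definition graph_norm ::
  "(real \<Rightarrow> 'x \<Rightarrow> 'x::{real_inner, complete_space}) \<Rightarrow> 'x \<Rightarrow> real" where
  "graph_norm T x = sqrt ((norm x)\<^sup>2 + (norm (generator T x))\<^sup>2)"

text \<open>
  The Bochner integral of the library requires a second countable range.  To allow nonseparable
  Hilbert spaces, strong measurability is spelled out here and vector-valued integrals are
  written with the Henstock--Kurzweil \<^const>\<open>integral\<close>; for strongly measurable functions with
  integrable norm it exists and equals the Bochner integral.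
\<close>

definition strongly_measurable :: "real \<Rightarrow> (real \<Rightarrow> 'y::real_normed_vector) \<Rightarrow> bool" where
  "strongly_measurable t f \<longleftrightarrow>
     (\<exists>s. (\<forall>n::nat. simple_function (lebesgue_on {0..t}) (s n)) \<and>
          (AE \<tau> in lebesgue_on {0..t}. (\<lambda>n. s n \<tau>) \<longlonglongrightarrow> f \<tau>))"

definition L2_space :: "real \<Rightarrow> (real \<Rightarrow> 'y::real_normed_vector) set" where
  "L2_space t = {f. strongly_measurable t f \<and>
                    integrable (lebesgue_on {0..t}) (\<lambda>\<tau>. (norm (f \<tau>))\<^sup>2)}"

definition L2_norm :: "real \<Rightarrow> (real \<Rightarrow> 'y::real_normed_vector) \<Rightarrow> real" where
  "L2_norm t f = sqrt (integral\<^sup>L (lebesgue_on {0..t}) (\<lambda>\<tau>. (norm (f \<tau>))\<^sup>2))"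

definition admissible_input ::
  "('k::real_normed_field \<Rightarrow> 'u::{real_inner, complete_space} \<Rightarrow> 'u) \<Rightarrow>
   ('k \<Rightarrow> 'x::{real_inner, complete_space} \<Rightarrow> 'x) \<Rightarrow>
   (real \<Rightarrow> 'x \<Rightarrow> 'x) \<Rightarrow> ('u \<Rightarrow> 'x) \<Rightarrow> bool" where
  "admissible_input scU scX T B \<longleftrightarrow>
     bounded_operator scU scX B \<and>
     (\<exists>t1>0. \<exists>\<beta>>0. \<forall>u \<in> L2_space t1.
        integral {0..t1} (\<lambda>\<tau>. T (t1 - \<tau>) (B (u \<tau>))) \<in> generator_domain T \<and>
        graph_norm T (integral {0..t1} (\<lambda>\<tau>. T (t1 - \<tau>) (B (u \<tau>)))) \<le> \<beta> * L2_norm t1 u)"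

text \<open>
  An operator defined on the domain of the generator is encoded as a total function whose values
  off that domain are irrelevant.
\<close>

definition bounded_on_X1 ::
  "('k::real_normed_field \<Rightarrow> 'x::{real_inner, complete_space} \<Rightarrow> 'x) \<Rightarrow>
   ('k \<Rightarrow> 'y::{real_inner, complete_space} \<Rightarrow> 'y) \<Rightarrow>
   (real \<Rightarrow> 'x \<Rightarrow> 'x) \<Rightarrow> ('x \<Rightarrow> 'y) \<Rightarrow> bool" where
  "bounded_on_X1 scX scY T F \<longleftrightarrow>
     (\<forall>x \<in> generator_domain T. \<forall>y \<in> generator_domain T. F (x + y) = F x + F y) \<and>
     (\<forall>c. \<forall>x \<in> generator_domain T. F (scX c x) = scY c (F x)) \<and>
     (\<exists>C. \<forall>x \<in> generator_domain T. norm (F x) \<le> C * graph_norm T x)"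

definition admissible_output ::
  "('k::real_normed_field \<Rightarrow> 'x::{real_inner, complete_space} \<Rightarrow> 'x) \<Rightarrow>
   ('k \<Rightarrow> 'y::{real_inner, complete_space} \<Rightarrow> 'y) \<Rightarrow>
   (real \<Rightarrow> 'x \<Rightarrow> 'x) \<Rightarrow> ('x \<Rightarrow> 'y) \<Rightarrow> bool" where
  "admissible_output scX scY T F \<longleftrightarrow>
     bounded_on_X1 scX scY T F \<and>
     (\<exists>t1>0. \<exists>\<alpha>>0. \<forall>x \<in> generator_domain T.
        (\<lambda>\<tau>. F (T (t1 - \<tau>) x)) \<in> L2_space t1 \<and>
        L2_norm t1 (\<lambda>\<tau>. F (T (t1 - \<tau>) x)) \<le> \<alpha> * norm x)"

text \<open>
  \<open>perturbed_semigroup scX T B F S\<close>: the family \<open>S\<close> is the semigroup generated by the feedback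
  perturbation.  The first two conditions on the orbits starting in the domain of the generator
  make the integral meaningful; the local square integrability also makes \<open>S\<close> unique on
  nonnegative times, by Gronwall's inequality, when \<open>B\<close> is an admissible input operator.
\<close>

definition perturbed_semigroup ::
  "('k::real_normed_field \<Rightarrow> 'x::{real_inner, complete_space} \<Rightarrow> 'x) \<Rightarrow>
   (real \<Rightarrow> 'x \<Rightarrow> 'x) \<Rightarrow> ('u::{real_inner, complete_space} \<Rightarrow> 'x) \<Rightarrow> ('x \<Rightarrow> 'u) \<Rightarrow>
   (real \<Rightarrow> 'x \<Rightarrow> 'x) \<Rightarrow> bool" where
  "perturbed_semigroup scX T B F S \<longleftrightarrow>
     C0_semigroup scX S \<and>
     (\<forall>x \<in> generator_domain T. \<forall>t\<ge>0.
        S t x \<in> generator_domain T \<and>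
        (\<lambda>\<tau>. F (S \<tau> x)) \<in> L2_space t \<and>
        S t x = T t x + integral {0..t} (\<lambda>\<tau>. T (t - \<tau>) (B (F (S \<tau> x)))))"

end

theory Submission
  imports Defs
begin

text \<open>
  Let \<open>S\<close> be the closed-loop semigroup of an admissible feedback \<open>F\<close> with decay rate \<open>\<omega> + 1\<close>.  The
  averages \<open>G x = (1/h) \<integral>\<^sub>0\<^sup>h F S(s) x ds\<close> extend to bounded operators on \<open>X\<close>.  Put \<open>y = F S(\<cdot>) x\<close>, let
  \<open>P\<close> be the semigroup of the bounded perturbation \<open>\<A> + \<B> G\<close> and let
  \<open>V(t) = \<integral>\<^sub>0\<^sup>t P(t - \<tau>) \<B> y(\<tau>) d\<tau>\<close>.  As \<open>G S(\<cdot>) x\<close> is a moving average of \<open>y\<close>, Duhamel's formula becomes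
  \<open>P(t) x - S(t) x = (1/h) \<integral>\<^sub>0\<^sup>h (V(t + s) - V(t) - P(t) V(s)) ds\<close>.  Admissibility of \<open>\<B>\<close> bounds \<open>V(t)\<close>
  in the graph norm by \<open>\<parallel>y\<parallel>\<^sub>L\<^sub>2\<close>, hence by \<open>\<parallel>x\<parallel>\<close>, uniformly in \<open>h\<close>; so the difference is \<open>O(\<surd>h) \<parallel>x\<parallel>\<close> on a
  short time interval.  Taking powers, \<open>P(t0)\<close> is close to \<open>S(t0)\<close> in operator norm at any fixed large
  \<open>t0\<close>, so \<open>P\<close> decays with rate \<open>\<omega>\<close> once \<open>h\<close> is small.
\<close>

section \<open>Banach-space integration over complete real normed spaces\<close>

text \<open>As a map on X, \<open>G\<close> is only bounded by a multiple of h^(-1/2), so no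
  quantitative estimate may rely on that bound. Two facts do not depend on \<open>h\<close>:
  \<open>G\<close> is bounded from the domain with the graph norm to U, being a mean of the maps
  \<open>F (S s x)\<close>, and an admissible \<open>B\<close> sends inputs into that domain. Every
  feedback loop is therefore estimated from U through the domain back to U. Its L2 gain over an
  interval of length \<open>a\<close> is at most a multiple of \<open>sqrt a\<close>, and the locale
  condition \<open>small\<close> makes it small enough to be absorbed, for the loop with
  \<open>F\<close> and for the loop with \<open>G\<close> alike. The correction P(t) V(s) appears
  because V(t + s), seen from time s, starts in the state V(s), whereas the averaged input has to
  act from state zero. It carries the operator norm of P(t), for which no bound uniform in
  \<open>h\<close> is known in advance; comparison with S(t) absorbs it once \<open>h\<close> is
  small. The surplus in the decay rate of \<open>S\<close> pays for the constant in front of its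
  exponential and for the factor 1/2 that leaves room for the error.\<close>

text \<open>
  The integration library assumes class \<^class>\<open>banach\<close>, which a type of sort
  \<open>{real_normed_vector, complete_space}\<close> satisfies mathematically but not syntactically.  Its facts are
  transported along an isometric copy of the type.
\<close>

typedef (overloaded) 'a banach_copy = "UNIV :: 'a::real_normed_vector set"
  morphisms of_copy to_copy by simp

setup_lifting type_definition_banach_copy

instantiation banach_copy :: (real_normed_vector) real_normed_vector
begin

lift_definition zero_banach_copy :: "'a banach_copy" is 0 .
lift_definition plus_banach_copy :: "'a banach_copy \<Rightarrow> 'a banach_copy \<Rightarrow> 'a banach_copy" is "(+)" .
lift_definition minus_banach_copy :: "'a banach_copy \<Rightarrow> 'a banach_copy \<Rightarrow> 'a banach_copy" is "(-)" .
lift_definition uminus_banach_copy :: "'a banach_copy \<Rightarrow> 'a banach_copy" is uminus .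
lift_definition scaleR_banach_copy :: "real \<Rightarrow> 'a banach_copy \<Rightarrow> 'a banach_copy" is scaleR .
lift_definition norm_banach_copy :: "'a banach_copy \<Rightarrow> real" is norm .
lift_definition dist_banach_copy :: "'a banach_copy \<Rightarrow> 'a banach_copy \<Rightarrow> real" is dist .
lift_definition sgn_banach_copy :: "'a banach_copy \<Rightarrow> 'a banach_copy" is sgn .
definition uniformity_banach_copy :: "('a banach_copy \<times> 'a banach_copy) filter" where
  "uniformity_banach_copy = (INF e\<in>{0 <..}. principal {(x, y). dist x y < e})"
definition open_banach_copy :: "'a banach_copy set \<Rightarrow> bool" where
  "open_banach_copy U \<longleftrightarrow> (\<forall>x\<in>U. eventually (\<lambda>(x', y). x' = x \<longrightarrow> y \<in> U) uniformity)"

instance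
proof
  fix x y z :: "'a banach_copy" and a b :: real and U :: "'a banach_copy set"
  show "x + y + z = x + (y + z)" "x + y = y + x" "0 + x = x" "- x + x = 0" "x - y = x + - y"
    by (transfer; simp)+
  show "a *\<^sub>R (x + y) = a *\<^sub>R x + a *\<^sub>R y" "(a + b) *\<^sub>R x = a *\<^sub>R x + b *\<^sub>R x"
    "a *\<^sub>R b *\<^sub>R x = (a * b) *\<^sub>R x" "1 *\<^sub>R x = x"
    by (transfer; simp add: algebra_simps)+
  show "sgn x = inverse (norm x) *\<^sub>R x" by transfer (rule sgn_div_norm)
  show "dist x y = norm (x - y)" by transfer (rule dist_norm)
  show "norm x = 0 \<longleftrightarrow> x = 0" "norm (a *\<^sub>R x) = \<bar>a\<bar> * norm x" by (transfer; simp)+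
  show "norm (x + y) \<le> norm x + norm y" by transfer (rule norm_triangle_ineq)
qed (simp_all add: uniformity_banach_copy_def open_banach_copy_def)

end

lemma norm_to_copy [simp]: "norm (to_copy x) = norm x"
  by (simp add: norm_banach_copy.rep_eq to_copy_inverse)

lemma to_of_copy [simp]: "to_copy (of_copy y) = y" "of_copy (to_copy x) = x"
  by (simp_all add: of_copy_inverse to_copy_inverse)

lemma to_copy_eq_iff [simp]: "to_copy x = to_copy y \<longleftrightarrow> x = y"
  by (simp add: to_copy_inject)

lemma bounded_linear_to_copy: "bounded_linear to_copy"
  by (rule bounded_linear_intro[of _ 1])
    (simp_all add: plus_banach_copy.abs_eq scaleR_banach_copy.abs_eq eq_onp_same_args)

lemma bounded_linear_of_copy: "bounded_linear of_copy"
  by (rule bounded_linear_intro[of _ 1])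
    (simp_all add: plus_banach_copy.rep_eq scaleR_banach_copy.rep_eq norm_banach_copy.rep_eq)

instance banach_copy :: ("{real_normed_vector, complete_space}") banach
proof
  fix X :: "nat \<Rightarrow> 'a banach_copy"
  assume "Cauchy X"
  then have "convergent (\<lambda>n. of_copy (X n))"
    by (intro Cauchy_convergent bounded_linear.Cauchy[OF bounded_linear_of_copy])
  then obtain l where "(\<lambda>n. of_copy (X n)) \<longlonglongrightarrow> l"
    by (auto simp: convergent_def)
  from bounded_linear.tendsto[OF bounded_linear_to_copy this] show "convergent X"
    by (auto simp: convergent_def)
qed

lemmas to_copy_add = linear_add[OF bounded_linear.linear[OF bounded_linear_to_copy]]
lemmas to_copy_0 = linear_0[OF bounded_linear.linear[OF bounded_linear_to_copy]]

text \<open>Both directions move a bounded linear map through the integral, \<open>to_copy\<close>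
  one way and its inverse the other; the transport of integrability and of integrals rests on this
  equivalence.\<close>

lemma has_integral_to_copy:
  "((\<lambda>x. to_copy (f x)) has_integral to_copy I) S \<longleftrightarrow> (f has_integral I) S"
  using has_integral_linear[OF _ bounded_linear_to_copy, of f I S]
    has_integral_linear[OF _ bounded_linear_of_copy, of "\<lambda>x. to_copy (f x)" "to_copy I" S]
  by (auto simp: o_def)

lemma integrable_to_copy: "(\<lambda>x. to_copy (f x)) integrable_on S \<longleftrightarrow> f integrable_on S"
  unfolding integrable_on_def by (metis has_integral_to_copy to_of_copy(1))

lemma integral_to_copy: "integral S (\<lambda>x. to_copy (f x)) = to_copy (integral S f)"
proof (cases "f integrable_on S")
  case True
  then show ?thesis by (simp add: has_integral_to_copy integral_unique integrable_integral)
next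
  \<comment> \<open>Both integrals have the default value 0 here, and \<open>to_copy\<close>
    preserves it.\<close>
  case False
  then show ?thesis
    using integrable_to_copy[of f S] to_copy_0
    by (simp add: not_integrable_integral)
qed

lemmas continuous_on_to_copy = bounded_linear.continuous_on[OF bounded_linear_to_copy]

lemma integrable_continuous_complete:
  fixes f :: "real \<Rightarrow> 'a::{real_normed_vector, complete_space}"
  shows "continuous_on {a..b} f \<Longrightarrow> f integrable_on {a..b}"
  using integrable_continuous_real[OF continuous_on_to_copy] by (simp add: integrable_to_copy)

lemma integral_combine_complete:
  fixes f :: "real \<Rightarrow> 'a::{real_normed_vector, complete_space}"
  assumes "a \<le> c" "c \<le> b" "f integrable_on {a..b}"
  shows "integral {a..c} f + integral {c..b} f = integral {a..b} f"
  using Henstock_Kurzweil_Integration.integral_combine[of a c b "\<lambda>x. to_copy (f x)"] assms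
  by (simp add: integrable_to_copy integral_to_copy flip: to_copy_add)

lemma integral_norm_bound_integral_complete:
  fixes f :: "real \<Rightarrow> 'a::{real_normed_vector, complete_space}"
  assumes "f integrable_on S" "g integrable_on S" "\<And>x. x \<in> S \<Longrightarrow> norm (f x) \<le> g x"
  shows "norm (integral S f) \<le> integral S g"
  using Henstock_Kurzweil_Integration.integral_norm_bound_integral[of "\<lambda>x. to_copy (f x)" S g] assms
  by (simp add: integrable_to_copy integral_to_copy)

lemma integral_swap_continuous_complete:
  fixes f :: "real \<Rightarrow> real \<Rightarrow> 'a::{real_normed_vector, complete_space}"
  assumes "continuous_on ({a..b} \<times> {c..d}) (\<lambda>(x, y). f x y)"
  shows "integral {a..b} (\<lambda>x. integral {c..d} (f x)) = integral {c..d} (\<lambda>y. integral {a..b} (\<lambda>x. f x y))"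
  using integral_swap_continuous[of a c b d "\<lambda>x y. to_copy (f x y)"] continuous_on_to_copy[OF assms]
  by (simp add: integral_to_copy cbox_Pair_eq case_prod_unfold)

lemma integral_restrict_Int_complete:
  fixes f :: "real \<Rightarrow> 'a::{real_normed_vector, complete_space}"
  shows "integral T (\<lambda>x. if x \<in> S then f x else 0) = integral (S \<inter> T) f"
proof -
  have "(\<lambda>x. to_copy (if x \<in> S then f x else 0)) = (\<lambda>x. if x \<in> S then to_copy (f x) else 0)"
    using to_copy_0 by auto
  then have "to_copy (integral T (\<lambda>x. if x \<in> S then f x else 0)) = to_copy (integral (S \<inter> T) f)"
    using integral_restrict_Int[of T S "\<lambda>x. to_copy (f x)"] by (simp flip: integral_to_copy)
  then show ?thesis by simp
qed

lemma integral_continuous_on_param_complete: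
  fixes f :: "'b::topological_space \<Rightarrow> real \<Rightarrow> 'a::{real_normed_vector, complete_space}"
  assumes "continuous_on (U \<times> {a..b}) (\<lambda>(x, t). f x t)"
  shows "continuous_on U (\<lambda>x. integral {a..b} (f x))"
proof -
  have "continuous_on U (\<lambda>x. integral (cbox a b) (\<lambda>t. to_copy (f x t)))"
    using continuous_on_to_copy[OF assms]
    by (intro integral_continuous_on_param) (simp add: case_prod_unfold)
  from bounded_linear.continuous_on[OF bounded_linear_of_copy this] show ?thesis
    by (simp add: integral_to_copy)
qed

lemma indefinite_integral_continuous_complete:
  fixes f :: "real \<Rightarrow> 'a::{real_normed_vector, complete_space}"
  assumes "continuous_on {a..b} f"
  shows "continuous_on {a..b} (\<lambda>x. integral {a..x} f)"
proof -
  have "continuous_on {a..b} (\<lambda>x. integral {a..x} (\<lambda>t. to_copy (f t)))"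
    using integrable_continuous_complete[OF assms]
    by (intro indefinite_integral_continuous_1) (simp add: integrable_to_copy)
  from bounded_linear.continuous_on[OF bounded_linear_of_copy this] show ?thesis
    by (simp add: integral_to_copy)
qed

lemma summable_norm_cancel_complete:
  fixes f :: "nat \<Rightarrow> 'a::{real_normed_vector, complete_space}"
  assumes "summable (\<lambda>n. norm (f n))"
  shows "summable f"
proof -
  have "summable (\<lambda>n. to_copy (f n))" by (rule summable_norm_cancel) (simp add: assms)
  from bounded_linear.summable[OF bounded_linear_of_copy this] show ?thesis by simp
qed

text \<open>Baire category for the closed sets \<open>A n\<close>: one of them contains a ball, and
  the difference of two points of that ball controls every \<open>f i\<close> near the
  origin.\<close>

lemma uniform_boundedness:
  fixes f :: "'i \<Rightarrow> 'a::{real_normed_vector, complete_space} \<Rightarrow> 'b::real_normed_vector"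
  assumes lin: "\<And>i. i \<in> I \<Longrightarrow> bounded_linear (f i)"
    and pw: "\<And>x. \<exists>C. \<forall>i\<in>I. norm (f i x) \<le> C"
  shows "\<exists>C. \<forall>i\<in>I. \<forall>x. norm (f i x) \<le> C * norm x"
proof -
  define A where "A n = {x. \<forall>i\<in>I. norm (f i x) \<le> real n}" for n :: nat
  have clA: "closed (A n)" for n
  proof -
    have "A n = (\<Inter>i\<in>I. {x. norm (f i x) \<le> real n})" by (auto simp: A_def)
    moreover have "closed {x. norm (f i x) \<le> real n}" if "i \<in> I" for i
      by (intro closed_Collect_le continuous_intros bounded_linear.continuous_on[OF lin[OF that]])
    ultimately show ?thesis by auto
  qed
  have UA: "\<Union> (range A) = UNIV"
  proof -
    have "\<exists>n. x \<in> A n" for x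
    proof -
      obtain C where "\<forall>i\<in>I. norm (f i x) \<le> C" using pw by blast
      moreover obtain n where "C \<le> real n" using real_arch_simple by blast
      ultimately have "x \<in> A n" by (auto simp: A_def intro: order_trans)
      then show ?thesis ..
    qed
    then show ?thesis by auto
  qed
  have "\<exists>n. interior (A n) \<noteq> {}"
  proof (rule ccontr)
    assume none: "\<not> ?thesis"
    have "euclidean interior_of \<Union> (range A) = {}"
    proof (intro Baire_category_alt disjI1 completely_metrizable_space_euclidean)
      show "closedin euclidean U \<and> euclidean interior_of U = {}" if "U \<in> range A" for U
        using that clA none by auto
    qed simp
    then show False using UA by simp
  qed
  then obtain n x0 e where e: "e > 0" "ball x0 e \<subseteq> A n"
    by (metis all_not_in_conv mem_interior)
  \<comment> \<open>A vector \<open>z\<close> of norm e/2 is the difference of two points of the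
    ball, so \<open>f i z\<close> has norm at most 2n; rescaling gives 2n / (e/2).\<close>
  have "norm (f i x) \<le> (4 * real n / e) * norm x" if i: "i \<in> I" for i x
  proof (cases "x = 0")
    case True
    then show ?thesis using lin[OF i] by (simp add: linear_simps(3))
  next
    case False
    interpret bounded_linear "f i" by (rule lin[OF i])
    define z where "z = (e / (2 * norm x)) *\<^sub>R x"
    have "norm z = e / 2" using False e by (simp add: z_def)
    then have "x0 + z \<in> ball x0 e" "x0 \<in> ball x0 e" using e(1) by (simp_all add: dist_norm)
    then have "x0 + z \<in> A n" "x0 \<in> A n" using e(2) by blast+
    then have "norm (f i (x0 + z)) \<le> n" "norm (f i x0) \<le> n" using i by (auto simp: A_def)
    then have "norm (f i z) \<le> 2 * n"
      using norm_triangle_ineq4[of "f i (x0 + z)" "f i x0"] by (simp add: add)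
    then show ?thesis using False e by (simp add: z_def scaleR field_simps)
  qed
  then show ?thesis by blast
qed

section \<open>Strongly continuous semigroups\<close>

locale strongly_continuous =
  fixes T :: "real \<Rightarrow> 'x::{real_inner, complete_space} \<Rightarrow> 'x"
  assumes bounded_linear: "t \<ge> 0 \<Longrightarrow> bounded_linear (T t)"
    and zero [simp]: "T 0 x = x"
    and semigroup: "s \<ge> 0 \<Longrightarrow> t \<ge> 0 \<Longrightarrow> T (s + t) x = T s (T t x)"
    and right_continuous: "((\<lambda>t. T t x) \<longlongrightarrow> x) (at_right 0)"
begin

lemmas T_linear = bounded_linear.linear[OF bounded_linear]
lemmas T_add = linear_add[OF T_linear]
lemmas T_diff = linear_diff[OF T_linear]
lemmas T_scaleR = linear_scale[OF T_linear]
lemmas T_0 = linear_0[OF T_linear]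

lemma right_continuousE:
  assumes "e > 0"
  obtains d where "d > 0" "\<And>t. 0 \<le> t \<Longrightarrow> t \<le> d \<Longrightarrow> norm (T t x - x) < e"
proof -
  obtain b where b: "b > 0" "\<forall>t>0. t < b \<longrightarrow> dist (T t x) x < e"
    using tendstoD[OF right_continuous[of x] assms] unfolding eventually_at_right_field by auto
  have "norm (T t x - x) < e" if "0 \<le> t" "t \<le> b / 2" for t
    using that b assms by (cases "t = 0") (auto simp: dist_norm)
  then show ?thesis using that[of "b / 2"] b by auto
qed

text \<open>Otherwise there are times \<open>t n\<close> tending to 0 at which the operator norm
  exceeds \<open>n\<close>. Each sequence \<open>T (t n) z\<close> converges to \<open>z\<close> and
  is bounded, which contradicts uniform boundedness.\<close>

lemma bounded_near_zero: "\<exists>d>0. \<exists>C. \<forall>t\<in>{0..d}. \<forall>x. norm (T t x) \<le> C * norm x"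
proof (rule ccontr)
  assume neg: "\<not> ?thesis"
  have "\<exists>t x. t \<in> {0..inverse (real (Suc n))} \<and> norm (T t x) > real n * norm x" for n
    using neg[simplified] by (metis inverse_positive_iff_positive not_le of_nat_0_less_iff zero_less_Suc)
  then obtain t x where t: "\<And>n. t n \<in> {0..inverse (real (Suc n))}"
    and x: "\<And>n. norm (T (t n) (x n)) > real n * norm (x n)" by metis
  have t0: "t \<longlonglongrightarrow> 0"
    by (rule real_tendsto_sandwich[OF _ _ tendsto_const LIMSEQ_inverse_real_of_nat])
      (use t in auto)
  have "\<exists>C. \<forall>i\<in>UNIV. norm (T (t i) z) \<le> C" for z
  proof -
    have "(\<lambda>n. T (t n) z) \<longlonglongrightarrow> z"
    proof (rule tendstoI)
      fix e :: real assume "e > 0"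
      from right_continuousE[OF this, of z] obtain d where d: "d > 0"
        "\<And>t. 0 \<le> t \<Longrightarrow> t \<le> d \<Longrightarrow> norm (T t z - z) < e" by auto
      have "eventually (\<lambda>n. t n < d) sequentially"
        using order_tendstoD(2)[OF t0 d(1)] .
      then show "eventually (\<lambda>n. dist (T (t n) z) z < e) sequentially"
        by eventually_elim (use d t in \<open>auto simp: dist_norm\<close>)
    qed
    from convergent_imp_Bseq[OF convergentI[OF this]] show ?thesis
      by (auto simp: Bseq_def)
  qed
  then have "\<exists>C. \<forall>i\<in>UNIV. \<forall>z. norm (T (t i) z) \<le> C * norm z"
    by (intro uniform_boundedness bounded_linear) (use t in auto)
  then obtain C where C: "\<And>i z. norm (T (t i) z) \<le> C * norm z" by auto
  obtain n where n: "C \<le> real n" using real_arch_simple by blast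
  have "C * norm (x n) \<le> n * norm (x n)" by (rule mult_right_mono) (use n in auto)
  with x[of n] C[of n "x n"] show False by linarith
qed

text \<open>The semigroup law propagates the bound near zero: each further step of length
  \<open>d\<close> costs one factor \<open>K\<close>.\<close>

lemma boundedE:
  obtains M where "M \<ge> 1" "\<And>t x. 0 \<le> t \<Longrightarrow> t \<le> a \<Longrightarrow> norm (T t x) \<le> M * norm x"
proof -
  obtain d C where d: "d > 0" and C: "\<And>t x. 0 \<le> t \<Longrightarrow> t \<le> d \<Longrightarrow> norm (T t x) \<le> C * norm x"
    using bounded_near_zero by (metis atLeastAtMost_iff)
  define K where "K = max 1 C"
  have K: "norm (T t x) \<le> K * norm x" if "0 \<le> t" "t \<le> d" for t x
    using C[OF that, of x] mult_right_mono[of C K "norm x"] by (auto simp: K_def)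
  have Kn: "norm (T t x) \<le> K ^ Suc n * norm x" if "0 \<le> t" "t \<le> real (Suc n) * d" for t x n
    using that
  proof (induction n arbitrary: t x)
    case 0
    then show ?case using K by simp
  next
    case (Suc n)
    show ?case
    proof (cases "t \<le> d")
      case True
      have "1 * K \<le> K ^ Suc n * K"
        by (intro mult_right_mono one_le_power) (auto simp: K_def)
      then have "K * norm x \<le> K ^ Suc (Suc n) * norm x"
        by (intro mult_right_mono) (auto simp: mult_ac)
      then show ?thesis using K[OF Suc.prems(1) True, of x] by linarith
    next
      case False
      then have "T t x = T (t - d) (T d x)" using semigroup[of "t - d" d x] d by simp
      also have "norm \<dots> \<le> K ^ Suc n * norm (T d x)"
        by (rule Suc.IH) (use False Suc.prems in \<open>auto simp: algebra_simps\<close>)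
      also have "\<dots> \<le> K ^ Suc n * (K * norm x)"
        by (rule mult_left_mono[OF K]) (use d in \<open>auto simp: K_def\<close>)
      finally show ?thesis by (simp add: mult_ac)
    qed
  qed
  obtain n where "a / d \<le> real n" using real_arch_simple by blast
  then have n: "a \<le> real (Suc n) * d" using d by (simp add: field_simps)
  have "1 \<le> K ^ Suc n" by (rule one_le_power) (simp add: K_def)
  then show ?thesis using that[of "K ^ Suc n"] Kn[of _ n] n by force
qed

text \<open>Factoring out \<open>T\<close> at the earlier of two times leaves
  \<open>T (r - s) x - x\<close>, so right continuity at zero and a local bound give continuity from
  both sides.\<close>

lemma continuous_orbit: "continuous_on {0..} (\<lambda>t. T t x)"
  unfolding continuous_on_iff
proof (intro ballI allI impI)
  fix t e :: real assume t: "t \<in> {0..}" and e: "e > 0"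
  obtain M where M: "M \<ge> 1" "\<And>s x. 0 \<le> s \<Longrightarrow> s \<le> t + 1 \<Longrightarrow> norm (T s x) \<le> M * norm x"
    by (rule boundedE[of "t + 1"]) blast
  have "e / M > 0" using e M by simp
  from right_continuousE[OF this, of x] obtain d where d: "d > 0"
    "\<And>t. 0 \<le> t \<Longrightarrow> t \<le> d \<Longrightarrow> norm (T t x - x) < e / M" by auto
  have step: "norm (T r x - T s x) < e" if "0 \<le> s" "s \<le> t + 1" "s \<le> r" "r \<le> s + d" for r s
  proof -
    have "T r x - T s x = T s (T (r - s) x - x)"
      using semigroup[of s "r - s" x] that by (simp add: T_diff)
    also have "norm \<dots> \<le> M * norm (T (r - s) x - x)" by (rule M) (use that in auto)
    also have "\<dots> < M * (e / M)" by (rule mult_strict_left_mono[OF d(2)]) (use that M in auto)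
    finally show ?thesis using M by simp
  qed
  show "\<exists>d>0. \<forall>s\<in>{0..}. dist s t < d \<longrightarrow> dist (T s x) (T t x) < e"
  proof (intro exI conjI ballI impI)
    fix s assume s: "s \<in> {0..}" "dist s t < min 1 d"
    show "dist (T s x) (T t x) < e"
    proof (cases "s \<le> t")
      case True
      then show ?thesis using step[of s t] s t by (simp add: dist_norm norm_minus_commute)
    next
      case False
      then show ?thesis using step[of t s] s t by (simp add: dist_norm)
    qed
  qed (use d in auto)
qed

text \<open>Joint continuity: in \<open>T (g p) (f p - f q) + T (g p) (f q)\<close> the first term
  is controlled by the local operator bound and the second by continuity of a single orbit.\<close>

lemma continuous_on_apply:
  fixes g :: "'p::topological_space \<Rightarrow> real"
  assumes g: "continuous_on A g" "\<And>p. p \<in> A \<Longrightarrow> g p \<ge> 0" and f: "continuous_on A f"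
  shows "continuous_on A (\<lambda>p. T (g p) (f p))"
  unfolding continuous_on_def
proof
  fix q assume q: "q \<in> A"
  obtain M where M: "M \<ge> 1" "\<And>s x. 0 \<le> s \<Longrightarrow> s \<le> g q + 1 \<Longrightarrow> norm (T s x) \<le> M * norm x"
    by (rule boundedE[of "g q + 1"]) blast
  have fq: "(f \<longlongrightarrow> f q) (at q within A)" and gq: "(g \<longlongrightarrow> g q) (at q within A)"
    using f g(1) q by (auto simp: continuous_on_def)
  have ev: "eventually (\<lambda>p. p \<in> A \<and> g p < g q + 1) (at q within A)"
    using order_tendstoD(2)[OF gq, of "g q + 1"]
    by (auto simp: eventually_at_topological elim: eventually_mono)
  have "((\<lambda>p. T (g p) (f p - f q)) \<longlongrightarrow> 0) (at q within A)"
  proof (rule Lim_null_comparison)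
    show "eventually (\<lambda>p. norm (T (g p) (f p - f q)) \<le> M * norm (f p - f q)) (at q within A)"
      using ev by eventually_elim (use g(2) in \<open>auto intro!: M\<close>)
    have "((\<lambda>p. M * norm (f p - f q)) \<longlongrightarrow> M * norm (f q - f q)) (at q within A)"
      by (intro tendsto_intros fq)
    then show "((\<lambda>p. M * norm (f p - f q)) \<longlongrightarrow> 0) (at q within A)" by simp
  qed
  moreover have "((\<lambda>p. T (g p) (f q)) \<longlongrightarrow> T (g q) (f q)) (at q within A)"
    using continuous_on_compose2[OF continuous_orbit g(1), of "f q"] g(2) q
    by (auto simp: continuous_on_def)
  ultimately have "((\<lambda>p. T (g p) (f p - f q) + T (g p) (f q)) \<longlongrightarrow> 0 + T (g q) (f q)) (at q within A)"
    by (rule tendsto_add)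
  moreover have "eventually (\<lambda>p. T (g p) (f p - f q) + T (g p) (f q) = T (g p) (f p)) (at q within A)"
    using ev by eventually_elim (use g(2) in \<open>auto simp: T_diff\<close>)
  ultimately show "((\<lambda>p. T (g p) (f p)) \<longlongrightarrow> T (g q) (f q)) (at q within A)"
    by (simp add: filterlim_cong)
qed

section \<open>The generator, its domain and the graph norm\<close>

abbreviation "\<D> \<equiv> generator_domain T"
abbreviation "gen \<equiv> generator T"

lemma generator_eqI:
  assumes "((\<lambda>h. (T h x - x) /\<^sub>R h) \<longlongrightarrow> y) (at_right 0)"
  shows "x \<in> \<D>" "gen x = y"
  using assms tendsto_Lim[OF _ assms] by (auto simp: generator_domain_def generator_def)

lemma generator_tendsto:
  assumes "x \<in> \<D>"
  shows "((\<lambda>h. (T h x - x) /\<^sub>R h) \<longlongrightarrow> gen x) (at_right 0)"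
  using assms generator_eqI(2) by (auto simp: generator_domain_def)

lemma dom_add:
  assumes "x \<in> \<D>" "y \<in> \<D>"
  shows "x + y \<in> \<D>" "gen (x + y) = gen x + gen y"
proof -
  have "((\<lambda>h. (T h x - x) /\<^sub>R h + (T h y - y) /\<^sub>R h) \<longlongrightarrow> gen x + gen y) (at_right 0)"
    by (intro tendsto_add generator_tendsto assms)
  moreover have "eventually (\<lambda>h. (T h x - x) /\<^sub>R h + (T h y - y) /\<^sub>R h = (T h (x + y) - (x + y)) /\<^sub>R h) (at_right 0)"
    by (auto simp: eventually_at_right_field T_add scaleR_add_right scaleR_diff_right intro!: exI[of _ 1])
  ultimately have "((\<lambda>h. (T h (x + y) - (x + y)) /\<^sub>R h) \<longlongrightarrow> gen x + gen y) (at_right 0)"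
    by (rule Lim_transform_eventually)
  from generator_eqI[OF this] show "x + y \<in> \<D>" "gen (x + y) = gen x + gen y" by auto
qed

text \<open>One source for several invariances of the domain: under real scalars, under
  \<open>T t\<close>, and, in the last part, under scalars of the base field.\<close>

lemma dom_bounded_linear:
  assumes x: "x \<in> \<D>" and L: "bounded_linear L"
    and comm: "\<And>h. h > 0 \<Longrightarrow> T h (L x) = L (T h x)"
  shows "L x \<in> \<D>" "gen (L x) = L (gen x)"
proof -
  interpret L: bounded_linear L by fact
  have "((\<lambda>h. L ((T h x - x) /\<^sub>R h)) \<longlongrightarrow> L (gen x)) (at_right 0)"
    by (intro L.tendsto generator_tendsto x)
  moreover have "eventually (\<lambda>h. L ((T h x - x) /\<^sub>R h) = (T h (L x) - L x) /\<^sub>R h) (at_right 0)"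
    by (auto simp: eventually_at_right_field comm L.diff L.scaleR intro!: exI[of _ 1])
  ultimately have "((\<lambda>h. (T h (L x) - L x) /\<^sub>R h) \<longlongrightarrow> L (gen x)) (at_right 0)"
    by (rule Lim_transform_eventually)
  from generator_eqI[OF this] show "L x \<in> \<D>" "gen (L x) = L (gen x)" by auto
qed

lemma dom_scaleR:
  assumes "x \<in> \<D>"
  shows "r *\<^sub>R x \<in> \<D>" "gen (r *\<^sub>R x) = r *\<^sub>R gen x"
  using dom_bounded_linear[OF assms bounded_linear_scaleR_right, of r] by (auto simp: T_scaleR)

lemma dom_diff:
  assumes "x \<in> \<D>" "y \<in> \<D>"
  shows "x - y \<in> \<D>" "gen (x - y) = gen x - gen y"
  using dom_add[OF assms(1) dom_scaleR(1)[OF assms(2), of "-1"]] dom_scaleR(2)[OF assms(2), of "-1"]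
  by auto

lemma dom_T:
  assumes "x \<in> \<D>" "t \<ge> 0"
  shows "T t x \<in> \<D>" "gen (T t x) = T t (gen x)"
  using dom_bounded_linear[OF assms(1) bounded_linear[OF assms(2)]] assms(2)
  by (auto simp: add.commute simp flip: semigroup)

lemma graph_norm_eq_norm_Pair: "graph_norm T x = norm (x, gen x)"
  by (simp add: graph_norm_def norm_Pair)

lemma graph_norm_triangle:
  assumes "x \<in> \<D>" "y \<in> \<D>"
  shows "graph_norm T (x + y) \<le> graph_norm T x + graph_norm T y"
  using norm_triangle_ineq[of "(x, gen x)" "(y, gen y)"] dom_add[OF assms]
  by (simp add: graph_norm_eq_norm_Pair)

lemma norm_le_graph_norm: "norm x \<le> graph_norm T x"
  and norm_gen_le_graph_norm: "norm (gen x) \<le> graph_norm T x"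
  by (simp_all add: graph_norm_def real_le_rsqrt)

lemma graph_norm_nonneg: "graph_norm T x \<ge> 0"
  by (simp add: graph_norm_def)

lemma graph_norm_T:
  assumes "x \<in> \<D>" "t \<ge> 0" "M \<ge> 0" "\<And>z. norm (T t z) \<le> M * norm z"
  shows "graph_norm T (T t x) \<le> M * graph_norm T x"
proof -
  have "(norm (T t x))\<^sup>2 + (norm (T t (gen x)))\<^sup>2 \<le> (M * norm x)\<^sup>2 + (M * norm (gen x))\<^sup>2"
    by (intro add_mono power_mono assms) auto
  also have "\<dots> = M\<^sup>2 * ((norm x)\<^sup>2 + (norm (gen x))\<^sup>2)"
    by (simp add: power_mult_distrib algebra_simps)
  finally have "graph_norm T (T t x) \<le> sqrt (M\<^sup>2 * ((norm x)\<^sup>2 + (norm (gen x))\<^sup>2))"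
    unfolding graph_norm_def dom_T[OF assms(1,2)] by (rule real_sqrt_le_mono)
  then show ?thesis using assms(3) by (simp add: real_sqrt_mult graph_norm_def)
qed

text \<open>Telescoping over \<open>n\<close> steps of length \<open>t / n\<close> replaces the fundamental theorem of calculus.\<close>

lemma norm_T_minus_id_le:
  assumes x: "x \<in> \<D>" and t: "t \<ge> 0"
    and M: "M \<ge> 0" "\<And>s z. 0 \<le> s \<Longrightarrow> s \<le> t \<Longrightarrow> norm (T s z) \<le> M * norm z"
  shows "norm (T t x - x) \<le> M * t * norm (gen x)"
proof (cases "t = 0")
  case True
  then show ?thesis by simp
next
  case False
  define h where "h n = t / real (Suc n)" for n
  have h: "h n > 0" for n using False t by (simp add: h_def)
  have le: "norm (T (real k * h n) x - x) \<le> M * real k * norm (T (h n) x - x)"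
    if "k \<le> Suc n" for k n using that
  proof (induction k)
    case 0
    then show ?case by simp
  next
    case (Suc k)
    have "real k * h n \<ge> 0" "h n \<ge> 0" using h[of n] by simp_all
    moreover have "real (Suc k) * h n = real k * h n + h n" by (simp add: algebra_simps)
    ultimately have "T (real (Suc k) * h n) x - x
        = T (real k * h n) (T (h n) x - x) + (T (real k * h n) x - x)"
      using semigroup[of "real k * h n" "h n" x] by (simp add: T_diff)
    also have "norm \<dots> \<le> M * norm (T (h n) x - x) + M * real k * norm (T (h n) x - x)"
    proof (rule norm_triangle_mono)
      have "real k * h n \<le> real (Suc n) * h n" using Suc.prems h[of n] by (intro mult_right_mono) auto
      also have "\<dots> = t" by (simp add: h_def)
      finally show "norm (T (real k * h n) (T (h n) x - x)) \<le> M * norm (T (h n) x - x)"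
        using h[of n] by (intro M(2)) auto
    qed (use Suc in auto)
    also have "\<dots> = M * real (Suc k) * norm (T (h n) x - x)" by (simp add: algebra_simps)
    finally show ?case .
  qed
  have "norm (T t x - x) \<le> M * t * norm ((T (h n) x - x) /\<^sub>R h n)" for n
  proof -
    have "norm (T t x - x) \<le> M * real (Suc n) * norm (T (h n) x - x)"
      using le[of "Suc n" n] by (simp add: h_def)
    also have "\<dots> = M * t * norm ((T (h n) x - x) /\<^sub>R h n)"
    proof -
      have "real (Suc n) = t * inverse (h n)" using False by (simp add: h_def)
      then show ?thesis using h[of n] by (simp add: norm_scaleR less_imp_le)
    qed
    finally show ?thesis .
  qed
  moreover have "(\<lambda>n. M * t * norm ((T (h n) x - x) /\<^sub>R h n)) \<longlonglongrightarrow> M * t * norm (gen x)"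
  proof (intro tendsto_intros filterlim_compose[OF generator_tendsto[OF x]])
    have "h \<longlonglongrightarrow> t * 0"
      unfolding h_def divide_inverse by (intro tendsto_intros LIMSEQ_inverse_real_of_nat)
    then show "filterlim h (at_right 0) sequentially"
      using h by (simp add: filterlim_at less_imp_neq[OF h, symmetric])
  qed
  ultimately show ?thesis by (intro Lim_bounded2[of _ _ 0]) auto
qed

end

section \<open>Convolution with a semigroup\<close>

lemma Weierstrass_m_test_complete:
  fixes f :: "nat \<Rightarrow> 'b \<Rightarrow> 'a::{real_normed_vector, complete_space}"
  assumes le: "\<And>n x. x \<in> A \<Longrightarrow> norm (f n x) \<le> m n" and m: "summable m"
  shows "uniform_limit A (\<lambda>n x. \<Sum>i<n. f i x) (\<lambda>x. suminf (\<lambda>i. f i x)) sequentially"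
proof -
  have sum: "summable (\<lambda>i. f i x)" if "x \<in> A" for x
    by (rule summable_norm_cancel_complete) (rule summable_comparison_test[OF _ m], use le that in auto)
  have "uniform_limit A (\<lambda>n x. \<Sum>i<n. to_copy (f i x)) (\<lambda>x. suminf (\<lambda>i. to_copy (f i x))) sequentially"
    by (rule Weierstrass_m_test) (use le m in auto)
  from bounded_linear.uniform_limit[OF bounded_linear_of_copy this]
  have "uniform_limit A (\<lambda>n x. \<Sum>i<n. f i x) (\<lambda>x. of_copy (suminf (\<lambda>i. to_copy (f i x)))) sequentially"
    by (simp add: linear_sum[OF bounded_linear.linear[OF bounded_linear_of_copy]])
  moreover have "of_copy (suminf (\<lambda>i. to_copy (f i x))) = suminf (\<lambda>i. f i x)" if "x \<in> A" for x
    using bounded_linear.suminf[OF bounded_linear_to_copy sum[OF that]] by (metis to_of_copy(2))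
  ultimately show ?thesis by (simp cong: uniform_limit_cong')
qed

text \<open>Cauchy-Schwarz against the constant 1, read off from the nonnegative integral of
  \<open>(f x - c)\<close> squared, where \<open>c\<close> is the mean value of
  \<open>f\<close>.\<close>

lemma integral_power2_le:
  fixes f :: "real \<Rightarrow> real"
  assumes f: "continuous_on {0..s} f" and s: "s \<ge> 0"
  shows "(integral {0..s} f)\<^sup>2 \<le> s * integral {0..s} (\<lambda>x. (f x)\<^sup>2)"
proof (cases "s = 0")
  case False
  define c where "c = integral {0..s} f / s"
  have i: "f integrable_on {0..s}" "(\<lambda>x. (f x)\<^sup>2) integrable_on {0..s}"
    by (intro integrable_continuous_real continuous_intros f)+
  have "0 \<le> integral {0..s} (\<lambda>x. (f x - c)\<^sup>2)"
    by (intro integral_nonneg integrable_continuous_real continuous_intros f) auto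
  also have "(\<lambda>x. (f x - c)\<^sup>2) = (\<lambda>x. (f x)\<^sup>2 - 2 * c * f x + c\<^sup>2)"
    by (simp add: power2_eq_square algebra_simps)
  also have "integral {0..s} \<dots> = integral {0..s} (\<lambda>x. (f x)\<^sup>2) - 2 * c * integral {0..s} f + s * c\<^sup>2"
    using has_integral_const_real[of "c\<^sup>2" 0 s] s
    by (intro integral_unique has_integral_add has_integral_diff has_integral_mult_right
        integrable_integral i) simp
  also have "\<dots> = integral {0..s} (\<lambda>x. (f x)\<^sup>2) - (integral {0..s} f)\<^sup>2 / s"
    using False by (simp add: c_def power2_eq_square field_simps)
  finally show ?thesis using False s by (simp add: field_simps)
qed simp

lemma integral_le_sqrt_integral_power2:
  fixes f :: "real \<Rightarrow> real"
  assumes "continuous_on {0..s} f" "s \<ge> 0" "integral {0..s} (\<lambda>x. (f x)\<^sup>2) \<le> N\<^sup>2" "N \<ge> 0"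
  shows "integral {0..s} f \<le> sqrt s * N"
proof (rule power2_le_imp_le)
  have "(integral {0..s} f)\<^sup>2 \<le> s * N\<^sup>2"
    using integral_power2_le[OF assms(1,2)] mult_left_mono[OF assms(3,2)] by linarith
  then show "(integral {0..s} f)\<^sup>2 \<le> (sqrt s * N)\<^sup>2"
    using assms(2) by (simp add: power_mult_distrib)
qed (use assms in simp)

context strongly_continuous
begin

text \<open>The mild solution of the equation driven by the input \<open>g\<close>, with initial
  state zero.\<close>

definition conv :: "(real \<Rightarrow> 'x) \<Rightarrow> real \<Rightarrow> 'x" where
  "conv g t = integral {0..t} (\<lambda>\<tau>. T (t - \<tau>) (g \<tau>))"

lemma conv_0 [simp]: "conv g 0 = 0"
  by (simp add: conv_def)

lemma conv_zero: "conv (\<lambda>_. 0) t = 0"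
  unfolding conv_def by (subst integral_cong[of _ _ "\<lambda>_. 0"]) (auto simp: T_0)

lemma conv_cong: "(\<And>\<tau>. 0 \<le> \<tau> \<Longrightarrow> \<tau> \<le> t \<Longrightarrow> g \<tau> = k \<tau>) \<Longrightarrow> conv g t = conv k t"
  unfolding conv_def by (rule integral_cong) auto

lemma continuous_on_conv_integrand:
  assumes "continuous_on {0..t} g"
  shows "continuous_on {0..t} (\<lambda>\<tau>. T (t - \<tau>) (g \<tau>))"
  by (rule continuous_on_apply) (use assms in \<open>auto intro!: continuous_intros\<close>)

lemmas integrable_conv = integrable_continuous_complete[OF continuous_on_conv_integrand]

lemma conv_add:
  assumes "continuous_on {0..t} g" "continuous_on {0..t} k"
  shows "conv (\<lambda>\<tau>. g \<tau> + k \<tau>) t = conv g t + conv k t"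
  unfolding conv_def
  by (subst integral_add[symmetric])
    (use assms in \<open>auto intro!: integrable_conv integral_cong simp: T_add\<close>)

lemma conv_diff:
  assumes "continuous_on {0..t} g" "continuous_on {0..t} k"
  shows "conv (\<lambda>\<tau>. g \<tau> - k \<tau>) t = conv g t - conv k t"
  unfolding conv_def
  by (subst integral_diff[symmetric])
    (use assms in \<open>auto intro!: integrable_conv integral_cong simp: T_diff\<close>)

lemma conv_bounded_linear:
  assumes "continuous_on {0..t} g" and L: "bounded_linear L"
    and comm: "\<And>h x. h \<ge> 0 \<Longrightarrow> T h (L x) = L (T h x)"
  shows "conv (\<lambda>\<tau>. L (g \<tau>)) t = L (conv g t)"
  unfolding conv_def integral_linear[OF integrable_conv[OF assms(1)] L, symmetric]
  by (rule integral_cong) (simp add: comm)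

lemma norm_conv_le:
  assumes g: "continuous_on {0..t} g" and t: "t \<ge> 0"
    and M: "\<And>s x. 0 \<le> s \<Longrightarrow> s \<le> t \<Longrightarrow> norm (T s x) \<le> M * norm x"
  shows "norm (conv g t) \<le> M * integral {0..t} (\<lambda>\<tau>. norm (g \<tau>))"
proof -
  have "norm (conv g t) \<le> integral {0..t} (\<lambda>\<tau>. M * norm (g \<tau>))"
    unfolding conv_def
    by (intro integral_norm_bound_integral_complete integrable_conv g integrable_continuous_real
        continuous_intros) (use t in \<open>auto intro!: M\<close>)
  then show ?thesis by simp
qed

lemma norm_conv_le_sqrt:
  assumes g: "continuous_on {0..t} g" and t: "t \<ge> 0"
    and M: "M \<ge> 0" "\<And>s x. 0 \<le> s \<Longrightarrow> s \<le> t \<Longrightarrow> norm (T s x) \<le> M * norm x"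
    and N: "integral {0..t} (\<lambda>\<tau>. (norm (g \<tau>))\<^sup>2) \<le> N\<^sup>2" "N \<ge> 0"
  shows "norm (conv g t) \<le> M * (sqrt t * N)"
proof -
  have "integral {0..t} (\<lambda>\<tau>. norm (g \<tau>)) \<le> sqrt t * N"
    by (rule integral_le_sqrt_integral_power2) (auto intro!: continuous_intros g t N)
  from mult_left_mono[OF this M(1)] norm_conv_le[OF g t M(2)] show ?thesis by linarith
qed

text \<open>Restart at time \<open>t\<close>: the state reached by then evolves freely, and the
  remaining input acts from state zero. This is the form in which the semigroup law enters nearly
  all later computations with convolutions.\<close>

lemma conv_shift:
  assumes g: "continuous_on {0..t + s} g" and t: "t \<ge> 0" and s: "s \<ge> 0"
  shows "conv g (t + s) = T s (conv g t) + conv (\<lambda>\<tau>. g (t + \<tau>)) s"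
proof -
  have "conv g (t + s) = integral {0..t} (\<lambda>\<tau>. T (t + s - \<tau>) (g \<tau>)) + integral {t..t + s} (\<lambda>\<tau>. T (t + s - \<tau>) (g \<tau>))"
    unfolding conv_def by (subst integral_combine_complete) (use t s in \<open>auto intro!: integrable_conv g\<close>)
  also have "integral {0..t} (\<lambda>\<tau>. T (t + s - \<tau>) (g \<tau>)) = integral {0..t} (T s \<circ> (\<lambda>\<tau>. T (t - \<tau>) (g \<tau>)))"
    using s by (intro integral_cong) (simp add: algebra_simps flip: semigroup)
  also have "\<dots> = T s (conv g t)"
    unfolding conv_def
    by (intro integral_linear bounded_linear s integrable_conv continuous_on_subset[OF g]) (use s in auto)
  also have "integral {t..t + s} (\<lambda>\<tau>. T (t + s - \<tau>) (g \<tau>)) = conv (\<lambda>\<tau>. g (t + \<tau>)) s"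
    using integral_shift_real_ivl[of t t "t + s" "\<lambda>\<tau>. T (t + s - \<tau>) (g \<tau>)"]
    by (simp add: conv_def algebra_simps)
  finally show ?thesis .
qed

lemma continuous_on_conv:
  assumes g: "continuous_on {0..a} g"
  shows "continuous_on {0..a} (conv g)"
proof -
  \<comment> \<open>Clipping the time at 0 makes the interval of integration independent of
    \<open>t\<close>. Beyond \<open>t\<close> the clipped integrand is just \<open>g\<close>, and
    its integral is subtracted afterwards.\<close>
  have "continuous_on {0..a} (\<lambda>t. integral {0..a} (\<lambda>\<tau>. T (max 0 (t - \<tau>)) (g \<tau>)))"
    by (intro integral_continuous_on_param_complete, unfold case_prod_unfold, intro continuous_on_apply)
      (auto intro!: continuous_intros continuous_on_compose2[OF g])
  moreover have "continuous_on {0..a} (\<lambda>t. integral {0..a} g - integral {0..t} g)"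
    by (intro continuous_intros indefinite_integral_continuous_complete g)
  ultimately have "continuous_on {0..a} (\<lambda>t. integral {0..a} (\<lambda>\<tau>. T (max 0 (t - \<tau>)) (g \<tau>))
      - (integral {0..a} g - integral {0..t} g))"
    by (rule continuous_on_diff)
  moreover have "integral {0..a} (\<lambda>\<tau>. T (max 0 (t - \<tau>)) (g \<tau>)) - (integral {0..a} g - integral {0..t} g) = conv g t"
    if t: "t \<in> {0..a}" for t
  proof -
    have "continuous_on {0..a} (\<lambda>\<tau>. T (max 0 (t - \<tau>)) (g \<tau>))"
      by (intro continuous_on_apply) (auto intro!: continuous_intros g)
    from integral_combine_complete[OF _ _ integrable_continuous_complete[OF this], of t]
    have "integral {0..a} (\<lambda>\<tau>. T (max 0 (t - \<tau>)) (g \<tau>))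
        = integral {0..t} (\<lambda>\<tau>. T (max 0 (t - \<tau>)) (g \<tau>)) + integral {t..a} (\<lambda>\<tau>. T (max 0 (t - \<tau>)) (g \<tau>))"
      using t by simp
    also have "integral {0..t} (\<lambda>\<tau>. T (max 0 (t - \<tau>)) (g \<tau>)) = conv g t"
      unfolding conv_def by (intro integral_cong) (simp add: max_def)
    also have "integral {t..a} (\<lambda>\<tau>. T (max 0 (t - \<tau>)) (g \<tau>)) = integral {t..a} g"
      by (intro integral_cong) (simp add: max.absorb1)
    also have "integral {t..a} g = integral {0..a} g - integral {0..t} g"
      using integral_combine_complete[OF _ _ integrable_continuous_complete[OF g], of t] t
      by (simp add: algebra_simps)
    finally show ?thesis by simp
  qed
  ultimately show ?thesis by (rule continuous_on_eq)
qed

text \<open>Joint continuity of \<open>T s (g \<tau>)\<close> at the origin makes the integrand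
  nearly constant for small \<open>h\<close>. The limit yields both the density of the domain and
  the effect of a bounded perturbation on the generator.\<close>

lemma conv_div_tendsto:
  assumes g: "continuous_on {0..a} g" and a: "a > 0"
  shows "((\<lambda>h. conv g h /\<^sub>R h) \<longlongrightarrow> g 0) (at_right 0)"
proof (rule tendstoI)
  fix e :: real assume e: "e > 0"
  have cont: "continuous_on ({0..} \<times> {0..a}) (\<lambda>p. T (fst p) (g (snd p)))"
    by (intro continuous_on_apply) (auto intro!: continuous_intros continuous_on_compose2[OF g])
  obtain d where d: "d > 0" "\<And>s \<tau>. s \<ge> 0 \<Longrightarrow> \<tau> \<in> {0..a} \<Longrightarrow> dist (s, \<tau>) (0, 0) < d \<Longrightarrow>
      dist (T s (g \<tau>)) (g 0) < e / 2"
  proof -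
    assume *: "\<And>d. d > 0 \<Longrightarrow> (\<And>s \<tau>. s \<ge> 0 \<Longrightarrow> \<tau> \<in> {0..a} \<Longrightarrow> dist (s, \<tau>) (0, 0) < d \<Longrightarrow>
      dist (T s (g \<tau>)) (g 0) < e / 2) \<Longrightarrow> thesis"
    have "(0, 0) \<in> {0::real..} \<times> {0..a}" "e / 2 > 0" using e a by auto
    from cont[unfolded continuous_on_iff, rule_format, OF this] obtain d where "d > 0"
      "\<forall>p\<in>{0..} \<times> {0..a}. dist p (0, 0) < d \<longrightarrow> dist (T (fst p) (g (snd p))) (g 0) < e / 2"
      by auto
    then show thesis by (intro *[of d]) auto
  qed
  have "dist (conv g h /\<^sub>R h) (g 0) < e" if h: "h > 0" "h < min a (d / 2)" for h
  proof -
    have le: "norm (T (h - \<tau>) (g \<tau>) - g 0) \<le> e / 2" if "\<tau> \<in> {0..h}" for \<tau>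
    proof -
      have "dist (h - \<tau>, \<tau>) (0, 0) \<le> \<bar>h - \<tau>\<bar> + \<bar>\<tau>\<bar>"
        unfolding dist_prod_def by (simp add: sqrt_sum_squares_le_sum_abs)
      also have "\<dots> < d" using h that by auto
      finally show ?thesis using d(2)[of "h - \<tau>" \<tau>] h that by (simp add: dist_norm less_imp_le)
    qed
    have gh: "continuous_on {0..h} g" by (rule continuous_on_subset[OF g]) (use h in auto)
    have "conv g h - h *\<^sub>R g 0 = integral {0..h} (\<lambda>\<tau>. T (h - \<tau>) (g \<tau>) - g 0)"
      unfolding conv_def using h by (subst integral_diff) (auto intro!: integrable_conv gh)
    also have "norm \<dots> \<le> integral {0..h} (\<lambda>\<tau>. e / 2)"
      by (intro integral_norm_bound_integral_complete integrable_continuous_complete continuous_on_diff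
          continuous_on_conv_integrand gh continuous_intros le)
    also have "\<dots> = h * (e / 2)" using h by simp
    finally have *: "norm (conv g h - h *\<^sub>R g 0) \<le> h * (e / 2)" .
    have "conv g h /\<^sub>R h - g 0 = (conv g h - h *\<^sub>R g 0) /\<^sub>R h"
      using h by (simp add: scaleR_diff_right)
    also have "norm \<dots> = norm (conv g h - h *\<^sub>R g 0) / h"
      by (subst norm_scaleR) (use h in \<open>simp add: field_simps\<close>)
    also have "\<dots> \<le> e / 2" using * h by (simp add: field_simps)
    finally show ?thesis using e by (simp add: dist_norm)
  qed
  then show "eventually (\<lambda>h. dist (conv g h /\<^sub>R h) (g 0) < e) (at_right 0)"
    using a d by (auto simp: eventually_at_right_field intro!: exI[of _ "min a (d / 2)"])
qed

section \<open>Density of the domain of the generator\<close>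

lemma conv_const_in_dom:
  assumes h: "h \<ge> 0"
  shows "conv (\<lambda>_. x) h \<in> \<D>" "gen (conv (\<lambda>_. x) h) = T h x - x"
proof -
  let ?c = "conv (\<lambda>_. x)"
  have "((\<lambda>r. T h (?c r /\<^sub>R r) - ?c r /\<^sub>R r) \<longlongrightarrow> T h x - x) (at_right 0)"
    by (intro tendsto_diff bounded_linear.tendsto[OF bounded_linear[OF h]]
        conv_div_tendsto[where a = 1]) auto
  moreover have "eventually (\<lambda>r. T h (?c r /\<^sub>R r) - ?c r /\<^sub>R r = (T r (?c h) - ?c h) /\<^sub>R r) (at_right 0)"
  proof -
    \<comment> \<open>Restarting \<open>?c (h + r)\<close> once after \<open>h\<close> and once
      after \<open>r\<close> gives two expressions for the same state; the difference quotient of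
      \<open>?c h\<close> thus becomes one of \<open>?c\<close> at zero.\<close>
    have "T h (?c r) - ?c r = T r (?c h) - ?c h" if "r > 0" for r
      using conv_shift[of h r "\<lambda>_. x"] conv_shift[of r h "\<lambda>_. x"] that h
      by (simp add: add.commute algebra_simps)
    then show ?thesis
      using h by (auto simp: eventually_at_right_field T_scaleR simp flip: scaleR_diff_right intro!: exI[of _ 1])
  qed
  ultimately have "((\<lambda>r. (T r (?c h) - ?c h) /\<^sub>R r) \<longlongrightarrow> T h x - x) (at_right 0)"
    by (rule Lim_transform_eventually)
  from generator_eqI[OF this] show "?c h \<in> \<D>" "gen (?c h) = T h x - x" by auto
qed

lemma dense_dom: "\<exists>u. (\<forall>n. u n \<in> \<D>) \<and> u \<longlonglongrightarrow> x"
proof -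
  define u where "u n = conv (\<lambda>_. x) (inverse (real (Suc n))) /\<^sub>R inverse (real (Suc n))" for n
  have "filterlim (\<lambda>n. inverse (real (Suc n))) (at_right 0) sequentially"
    unfolding filterlim_at using LIMSEQ_inverse_real_of_nat by (auto intro!: always_eventually)
  from filterlim_compose[OF conv_div_tendsto[of 1 "\<lambda>_. x", OF continuous_on_const zero_less_one] this] have "u \<longlonglongrightarrow> x"
    unfolding u_def[abs_def] .
  moreover have "u n \<in> \<D>" for n
    unfolding u_def by (intro dom_scaleR conv_const_in_dom) simp
  ultimately show ?thesis by blast
qed

end

section \<open>Bounded perturbations\<close>

locale bounded_perturbation = strongly_continuous T
  for T :: "real \<Rightarrow> 'x::{real_inner, complete_space} \<Rightarrow> 'x" +
  fixes C :: "'x \<Rightarrow> 'x"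
  assumes bounded_linear_C: "bounded_linear C"
begin

interpretation C: bounded_linear C by (rule bounded_linear_C)

lemma continuous_on_C: "continuous_on A g \<Longrightarrow> continuous_on A (\<lambda>\<tau>. C (g \<tau>))"
  by (rule C.continuous_on)

text \<open>In the norm weighted with \<open>exp (- l t)\<close> the Volterra operator is a contraction.\<close>

lemma volterra_contraction:
  obtains l where "l > 0"
    "\<And>g t w. continuous_on {0..t} g \<Longrightarrow> 0 \<le> t \<Longrightarrow> t \<le> a \<Longrightarrow>
      (\<And>\<tau>. 0 \<le> \<tau> \<Longrightarrow> \<tau> \<le> t \<Longrightarrow> norm (g \<tau>) \<le> w * exp (l * \<tau>)) \<Longrightarrow>
      norm (conv (\<lambda>\<tau>. C (g \<tau>)) t) \<le> w / 2 * exp (l * t)"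
proof -
  obtain M where M: "M \<ge> 1" "\<And>s x. 0 \<le> s \<Longrightarrow> s \<le> a \<Longrightarrow> norm (T s x) \<le> M * norm x"
    by (rule boundedE[of a]) blast
  obtain c where c: "c > 0" "\<And>x. norm (C x) \<le> norm x * c"
    using C.pos_bounded by blast
  \<comment> \<open>The integral of the weight contributes 1 / \<open>l\<close>, so this choice
    makes the contraction factor \<open>M * c / l\<close> equal to 1/2.\<close>
  define l where "l = 2 * (M * c)"
  have l: "l > 0" using M c by (simp add: l_def)
  show ?thesis
  proof (rule that[OF l])
    fix g :: "real \<Rightarrow> 'x" and t w :: real
    assume g: "continuous_on {0..t} g" and t: "0 \<le> t" "t \<le> a"
      and le: "\<And>\<tau>. 0 \<le> \<tau> \<Longrightarrow> \<tau> \<le> t \<Longrightarrow> norm (g \<tau>) \<le> w * exp (l * \<tau>)"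
    have "norm (g 0) \<le> w" using le[of 0] t by simp
    then have w: "w \<ge> 0" using norm_ge_zero order_trans by blast
    have int: "((\<lambda>\<tau>. exp (l * \<tau>)) has_integral exp (l * t) / l - exp (l * 0) / l) {0..t}"
      using l t by (intro fundamental_theorem_of_calculus)
        (auto intro!: derivative_eq_intros simp flip: has_real_derivative_iff_has_vector_derivative)
    have "norm (conv (\<lambda>\<tau>. C (g \<tau>)) t) \<le> M * integral {0..t} (\<lambda>\<tau>. norm (C (g \<tau>)))"
      by (intro norm_conv_le continuous_on_C g t M) (use t in auto)
    also have "integral {0..t} (\<lambda>\<tau>. norm (C (g \<tau>))) \<le> integral {0..t} (\<lambda>\<tau>. (w * c) * exp (l * \<tau>))"
    proof (intro integral_le integrable_continuous_real continuous_intros continuous_on_C g)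
      fix \<tau> assume "\<tau> \<in> {0..t}"
      then have "norm (g \<tau>) * c \<le> w * exp (l * \<tau>) * c"
        using c le by (intro mult_right_mono) auto
      then show "norm (C (g \<tau>)) \<le> w * c * exp (l * \<tau>)"
        using c(2)[of "g \<tau>"] by (simp add: mult_ac)
    qed
    also have "\<dots> = w * c * (exp (l * t) / l - 1 / l)"
      using integral_unique[OF int] by simp
    also have "\<dots> \<le> w * c * (exp (l * t) / l)"
      using w c l by (intro mult_left_mono) auto
    finally have "norm (conv (\<lambda>\<tau>. C (g \<tau>)) t) \<le> M * (w * c * (exp (l * t) / l))"
      using M by simp
    also have "\<dots> = w / 2 * exp (l * t)" using M c by (simp add: l_def)
    finally show "norm (conv (\<lambda>\<tau>. C (g \<tau>)) t) \<le> w / 2 * exp (l * t)" .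
  qed
qed

text \<open>Gronwall's estimate, with \<open>K\<close> chosen before the data \<open>W\<close>,
  \<open>f\<close> and \<open>F\<close>. At a maximum point \<open>t0\<close> of the weighted norm
  of \<open>W\<close> the contraction yields \<open>w\<close> at most F + w/2, so \<open>w\<close>
  is at most 2 F.\<close>

lemma volterra_bound:
  "\<exists>K. \<forall>W f F. continuous_on {0..a} W \<longrightarrow>
      (\<forall>t\<in>{0..a}. W t = f t + conv (\<lambda>\<tau>. C (W \<tau>)) t) \<longrightarrow>
      (\<forall>t\<in>{0..a}. norm (f t) \<le> F) \<longrightarrow> (\<forall>t\<in>{0..a}. norm (W t) \<le> K * F)"
proof -
  obtain l where l: "l > 0" and contr: "\<And>g t w. continuous_on {0..t} g \<Longrightarrow> 0 \<le> t \<Longrightarrow> t \<le> a \<Longrightarrow>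
      (\<And>\<tau>. 0 \<le> \<tau> \<Longrightarrow> \<tau> \<le> t \<Longrightarrow> norm (g \<tau>) \<le> w * exp (l * \<tau>)) \<Longrightarrow>
      norm (conv (\<lambda>\<tau>. C (g \<tau>)) t) \<le> w / 2 * exp (l * t)"
    by (rule volterra_contraction[of a]) blast
  show ?thesis
  proof (intro exI[of _ "2 * exp (l * a)"] allI impI ballI)
    fix W f F t
    assume W: "continuous_on {0..a} W"
      and eq': "\<forall>t\<in>{0..a}. W t = f t + conv (\<lambda>\<tau>. C (W \<tau>)) t"
      and F': "\<forall>t\<in>{0..a}. norm (f t) \<le> F" and t': "t \<in> {0..a}"
    have t: "0 \<le> t" "t \<le> a" using t' by auto
    have eq: "W t = f t + conv (\<lambda>\<tau>. C (W \<tau>)) t" and F: "norm (f t) \<le> F" if "0 \<le> t" "t \<le> a" for t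
      using eq' F' that by auto
    have F0: "F \<ge> 0" using F[OF t] norm_ge_zero order_trans by blast
    have "continuous_on {0..a} (\<lambda>t. exp (- (l * t)) * norm (W t))"
      by (intro continuous_intros W)
    from continuous_attains_sup[OF compact_Icc _ this] t obtain t0 where t0: "0 \<le> t0" "t0 \<le> a"
      and max: "\<And>t. 0 \<le> t \<Longrightarrow> t \<le> a \<Longrightarrow> exp (- (l * t)) * norm (W t) \<le> exp (- (l * t0)) * norm (W t0)"
      by fastforce
    define w where "w = exp (- (l * t0)) * norm (W t0)"
    have le: "norm (W t) \<le> w * exp (l * t)" if "0 \<le> t" "t \<le> a" for t
      using max[OF that] by (simp add: w_def exp_minus field_simps)
    have "norm (W t0) \<le> F + w / 2 * exp (l * t0)"
      unfolding eq[OF t0]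
      by (intro norm_triangle_mono F t0 contr continuous_on_subset[OF W] le) (use t0 in auto)
    then have "w \<le> exp (- (l * t0)) * (F + w / 2 * exp (l * t0))"
      unfolding w_def by (intro mult_left_mono) auto
    also have "\<dots> = exp (- (l * t0)) * F + w / 2" by (simp add: exp_minus field_simps)
    also have "exp (- (l * t0)) * F \<le> 1 * F" using F0 l t0 by (intro mult_right_mono) auto
    finally have w: "w \<le> 2 * F" by simp
    have "norm (W t) \<le> w * exp (l * t)" by (rule le[OF t])
    also have "\<dots> \<le> (2 * F) * exp (l * a)"
      using w F0 l t by (intro mult_mono) auto
    finally show "norm (W t) \<le> 2 * exp (l * a) * F" by (simp add: mult_ac)
  qed
qed

lemma volterra_unique:
  assumes "continuous_on {0..a} W" "continuous_on {0..a} V"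
    and W: "\<And>t. 0 \<le> t \<Longrightarrow> t \<le> a \<Longrightarrow> W t = f t + conv (\<lambda>\<tau>. C (W \<tau>)) t"
    and V: "\<And>t. 0 \<le> t \<Longrightarrow> t \<le> a \<Longrightarrow> V t = f t + conv (\<lambda>\<tau>. C (V \<tau>)) t"
    and t: "0 \<le> t" "t \<le> a"
  shows "W t = V t"
proof -
  obtain K where K: "continuous_on {0..a} W \<Longrightarrow>
      (\<forall>t\<in>{0..a}. W t = f t + conv (\<lambda>\<tau>. C (W \<tau>)) t) \<Longrightarrow>
      (\<forall>t\<in>{0..a}. norm (f t) \<le> F) \<Longrightarrow> \<forall>t\<in>{0..a}. norm (W t) \<le> K * F" for W f F
    using volterra_bound[of a] by blast
  have "W t - V t = 0 + conv (\<lambda>\<tau>. C (W \<tau> - V \<tau>)) t" if t: "0 \<le> t" "t \<le> a" for t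
  proof -
    have "continuous_on {0..t} (\<lambda>\<tau>. C (W \<tau>))" "continuous_on {0..t} (\<lambda>\<tau>. C (V \<tau>))"
      by (intro continuous_on_C continuous_on_subset[OF assms(1)] continuous_on_subset[OF assms(2)];
          use t in auto)+
    from conv_diff[OF this] show ?thesis using W[OF t] V[OF t] by (simp add: C.diff)
  qed
  then have "\<forall>t\<in>{0..a}. norm (W t - V t) \<le> K * 0"
    by (intro K[of _ "\<lambda>_. 0"] continuous_on_diff assms) auto
  with t show ?thesis by simp
qed

text \<open>Neumann series: \<open>q n\<close> are the iterates of the Volterra operator on
  \<open>f\<close>, and in the weighted norm on a bounded interval they decay like 2^(-n). The
  forcing is left general because it is an orbit of \<open>T\<close> in one use and
  \<open>S t x - T t x\<close> in another.\<close>

lemma volterra_exists: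
  assumes f: "continuous_on {0..} f"
  shows "\<exists>W. continuous_on {0..} W \<and> (\<forall>t\<ge>0. W t = f t + conv (\<lambda>\<tau>. C (W \<tau>)) t)"
proof -
  define q where "q = rec_nat f (\<lambda>_ g. conv (\<lambda>\<tau>. C (g \<tau>)))"
  have q_0: "q 0 = f" and q_Suc: "q (Suc n) = conv (\<lambda>\<tau>. C (q n \<tau>))" for n
    by (simp_all add: q_def)
  have cont_q: "continuous_on {0..a} (q n)" for a n
    by (induction n) (auto simp: q_0 q_Suc intro!: continuous_on_conv continuous_on_C
        continuous_on_subset[OF f])
  define P where "P n t = (\<Sum>i<n. q i t)" for n t
  define W where "W t = suminf (\<lambda>i. q i t)" for t
  have cont_P: "continuous_on {0..a} (P n)" for a n
    unfolding P_def[abs_def] by (intro continuous_intros cont_q)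
  have P_Suc: "P (Suc n) t = f t + conv (\<lambda>\<tau>. C (P n \<tau>)) t" for n t
  proof (induction n)
    case 0
    then show ?case by (simp add: P_def q_0 C.zero conv_zero)
  next
    case (Suc n)
    have "P (Suc (Suc n)) t = f t + conv (\<lambda>\<tau>. C (P n \<tau>)) t + conv (\<lambda>\<tau>. C (q n \<tau>)) t"
      using Suc by (simp add: P_def q_Suc)
    then show ?case
      by (simp add: P_def C.add conv_add[symmetric] continuous_on_C cont_q cont_P[unfolded P_def[abs_def]])
  qed
  have lim: "uniform_limit {0..a} P W sequentially" for a
  proof (cases "a \<ge> 0")
    case True
    obtain l where l: "l > 0" and contr: "\<And>g t w. continuous_on {0..t} g \<Longrightarrow> 0 \<le> t \<Longrightarrow> t \<le> a \<Longrightarrow>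
      (\<And>\<tau>. 0 \<le> \<tau> \<Longrightarrow> \<tau> \<le> t \<Longrightarrow> norm (g \<tau>) \<le> w * exp (l * \<tau>)) \<Longrightarrow>
      norm (conv (\<lambda>\<tau>. C (g \<tau>)) t) \<le> w / 2 * exp (l * t)"
      by (rule volterra_contraction[of a]) blast
    have "continuous_on {0..a} f" by (rule continuous_on_subset[OF f]) auto
    then have "bounded (f ` {0..a})" by (intro compact_imp_bounded compact_continuous_image) auto
    then obtain F where F: "\<And>t. t \<in> {0..a} \<Longrightarrow> norm (f t) \<le> F" unfolding bounded_iff by blast
    have F0: "F \<ge> 0" by (rule order_trans[OF norm_ge_zero F[of 0]]) (use True in simp)
    have le: "norm (q n t) \<le> F / 2 ^ n * exp (l * t)" if "0 \<le> t" "t \<le> a" for n t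
      using that
    proof (induction n arbitrary: t)
      case 0
      have "F * 1 \<le> F * exp (l * t)" using F0 l 0 by (intro mult_left_mono) auto
      then show ?case using F[of t] 0 by (simp add: q_0)
    next
      case (Suc n)
      have "norm (q (Suc n) t) \<le> F / 2 ^ n / 2 * exp (l * t)"
        unfolding q_Suc by (intro contr cont_q Suc.IH Suc.prems) (use Suc.prems in auto)
      then show ?case by simp
    qed
    have "norm (q n t) \<le> F * exp (l * a) * (1 / 2) ^ n" if "t \<in> {0..a}" for n t
    proof -
      have "F / 2 ^ n * exp (l * t) \<le> F / 2 ^ n * exp (l * a)"
        using F0 l that by (intro mult_left_mono) auto
      then show ?thesis using le[of t n] that by (simp add: power_one_over field_simps)
    qed
    then show ?thesis
      unfolding P_def[abs_def] W_def[abs_def]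
      by (rule Weierstrass_m_test_complete) (assumption, intro summable_mult summable_geometric, simp)
  qed (auto simp: uniform_limit_iff)
  have cont_W: "continuous_on {0..a} W" for a
    by (rule uniform_limit_theorem[OF _ lim]) (auto intro!: always_eventually cont_P)
  have "W t = f t + conv (\<lambda>\<tau>. C (W \<tau>)) t" if t: "t \<ge> 0" for t
  proof -
    obtain M where M: "M \<ge> 1" "\<And>s x. 0 \<le> s \<Longrightarrow> s \<le> t \<Longrightarrow> norm (T s x) \<le> M * norm x"
      by (rule boundedE[of t]) blast
    obtain c where c: "c > 0" "\<And>x. norm (C x) \<le> norm x * c"
      using C.pos_bounded by blast
    have "(\<lambda>n. conv (\<lambda>\<tau>. C (P n \<tau>)) t) \<longlonglongrightarrow> conv (\<lambda>\<tau>. C (W \<tau>)) t"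
    proof (rule tendstoI)
      fix e :: real assume e: "e > 0"
      \<comment> \<open>The summand 1 keeps the denominator positive at \<open>t = 0\<close> and
        makes the final estimate strict.\<close>
      define d where "d = e / (M * c * (t + 1))"
      have d: "d > 0" using e M c t by (simp add: d_def)
      have "eventually (\<lambda>n. \<forall>\<tau>\<in>{0..t}. dist (P n \<tau>) (W \<tau>) < d) sequentially"
        using uniform_limitD[OF lim d] .
      then show "eventually (\<lambda>n. dist (conv (\<lambda>\<tau>. C (P n \<tau>)) t) (conv (\<lambda>\<tau>. C (W \<tau>)) t) < e) sequentially"
      proof eventually_elim
        case (elim n)
        have "conv (\<lambda>\<tau>. C (P n \<tau>)) t - conv (\<lambda>\<tau>. C (W \<tau>)) t = conv (\<lambda>\<tau>. C (P n \<tau>) - C (W \<tau>)) t"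
          by (intro conv_diff[symmetric] continuous_on_C cont_P cont_W)
        also have "norm \<dots> \<le> M * integral {0..t} (\<lambda>\<tau>. norm (C (P n \<tau>) - C (W \<tau>)))"
          by (intro norm_conv_le continuous_on_diff continuous_on_C cont_P cont_W t M)
        also have "integral {0..t} (\<lambda>\<tau>. norm (C (P n \<tau>) - C (W \<tau>))) \<le> integral {0..t} (\<lambda>\<tau>. d * c)"
        proof (intro integral_le integrable_continuous_real continuous_intros continuous_on_C cont_P cont_W)
          fix \<tau> assume "\<tau> \<in> {0..t}"
          then have "norm (P n \<tau> - W \<tau>) * c \<le> d * c"
            using elim c by (intro mult_right_mono) (auto simp: dist_norm less_imp_le)
          then show "norm (C (P n \<tau>) - C (W \<tau>)) \<le> d * c"
            using c(2)[of "P n \<tau> - W \<tau>"] by (simp add: C.diff)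
        qed
        also have "M * integral {0..t} (\<lambda>\<tau>. d * c) = d * (M * c * t)" using t by simp
        also have "\<dots> < d * (M * c * (t + 1))" using d M c t by simp
        also have "\<dots> = e" using M c t by (simp add: d_def)
        finally show ?case using M by (simp add: dist_norm)
      qed
    qed
    then have "(\<lambda>n. P (Suc n) t) \<longlonglongrightarrow> f t + conv (\<lambda>\<tau>. C (W \<tau>)) t"
      unfolding P_Suc by (intro tendsto_intros)
    moreover have "(\<lambda>n. P (Suc n) t) \<longlonglongrightarrow> W t"
      by (intro LIMSEQ_Suc tendsto_uniform_limitI[OF lim[of t]]) (use t in auto)
    ultimately show ?thesis by (rule LIMSEQ_unique[symmetric])
  qed
  moreover have "continuous_on {0..} W"
  proof -
    have "continuous (at t within {0..}) W" if t: "t \<in> {0..}" for t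
    proof -
      have "continuous (at t within {0..t + 1}) W"
        using cont_W[of "t + 1"] t by (simp add: continuous_on_eq_continuous_within)
      moreover have "at t within {0..t + 1} = at t within {0..}"
        by (rule at_within_nhd[of _ "{..<t + 1}"]) auto
      ultimately show ?thesis by (simp add: continuous_within)
    qed
    then show ?thesis by (simp add: continuous_on_eq_continuous_within)
  qed
  ultimately show ?thesis by blast
qed

text \<open>The semigroup generated by the perturbed operator. The choice is made once per
  \<open>x\<close>, for a solution on the whole half-line; uniqueness on bounded intervals fixes its
  values at nonnegative times.\<close>

definition pert :: "real \<Rightarrow> 'x \<Rightarrow> 'x" where
  "pert t x = (SOME W. continuous_on {0..} W \<and> (\<forall>t\<ge>0. W t = T t x + conv (\<lambda>\<tau>. C (W \<tau>)) t)) t"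

lemma continuous_on_pert: "continuous_on {0..} (\<lambda>t. pert t x)"
  and pert_eq: "t \<ge> 0 \<Longrightarrow> pert t x = T t x + conv (\<lambda>\<tau>. C (pert \<tau> x)) t"
  using someI_ex[OF volterra_exists[OF continuous_orbit[of x]]] by (auto simp: pert_def)

lemma continuous_on_pert': "continuous_on {0..a} (\<lambda>t. pert t x)"
  by (rule continuous_on_subset[OF continuous_on_pert]) auto

lemma pert_eqI:
  assumes "continuous_on {0..t} W" "t \<ge> 0"
    and "\<And>s. 0 \<le> s \<Longrightarrow> s \<le> t \<Longrightarrow> W s = T s x + conv (\<lambda>\<tau>. C (W \<tau>)) s"
  shows "pert t x = W t"
  using assms
  by (intro volterra_unique[of t "\<lambda>t. pert t x" W "\<lambda>t. T t x"] continuous_on_pert' pert_eq) auto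

text \<open>Applying \<open>L\<close> to the orbit of \<open>x\<close> gives a solution with datum
  \<open>L x\<close>. Real scalars use this for linearity, scalars of the base field for the final
  semigroup.\<close>

lemma pert_commute:
  assumes L: "bounded_linear L" and t: "t \<ge> 0"
    and comm: "\<And>h x. h \<ge> 0 \<Longrightarrow> T h (L x) = L (T h x)" "\<And>x. C (L x) = L (C x)"
  shows "pert t (L x) = L (pert t x)"
proof (rule pert_eqI)
  fix s :: real assume s: "0 \<le> s" "s \<le> t"
  have "conv (\<lambda>\<tau>. L (C (pert \<tau> x))) s = L (conv (\<lambda>\<tau>. C (pert \<tau> x)) s)"
    by (intro conv_bounded_linear continuous_on_C continuous_on_pert' L comm)
  then show "L (pert s x) = T s (L x) + conv (\<lambda>\<tau>. C (L (pert \<tau> x))) s"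
    using pert_eq[of s x] s by (simp add: comm linear_add[OF bounded_linear.linear[OF L]])
qed (intro bounded_linear.continuous_on[OF L] continuous_on_pert' t)+

lemma pert_add:
  assumes t: "t \<ge> 0"
  shows "pert t (x + y) = pert t x + pert t y"
proof (rule pert_eqI)
  fix s :: real assume s: "0 \<le> s" "s \<le> t"
  have "conv (\<lambda>\<tau>. C (pert \<tau> x + pert \<tau> y)) s
      = conv (\<lambda>\<tau>. C (pert \<tau> x)) s + conv (\<lambda>\<tau>. C (pert \<tau> y)) s"
    by (simp add: C.add conv_add continuous_on_C continuous_on_pert')
  then show "pert s x + pert s y = T s (x + y) + conv (\<lambda>\<tau>. C (pert \<tau> x + pert \<tau> y)) s"
    using pert_eq[of s x] pert_eq[of s y] s by (simp add: T_add)
qed (intro continuous_intros continuous_on_pert' t)+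

lemma bounded_linear_pert:
  assumes t: "t \<ge> 0"
  shows "bounded_linear (pert t)"
proof -
  obtain M where M: "M \<ge> 1" "\<And>s x. 0 \<le> s \<Longrightarrow> s \<le> t \<Longrightarrow> norm (T s x) \<le> M * norm x"
    by (rule boundedE[of t]) blast
  obtain K where K: "continuous_on {0..t} W \<Longrightarrow>
      (\<forall>s\<in>{0..t}. W s = f s + conv (\<lambda>\<tau>. C (W \<tau>)) s) \<Longrightarrow>
      (\<forall>s\<in>{0..t}. norm (f s) \<le> F) \<Longrightarrow> \<forall>s\<in>{0..t}. norm (W s) \<le> K * F" for W f F
    using volterra_bound[of t] by blast
  show ?thesis
  proof (rule bounded_linear_intro)
    show "pert t (x + y) = pert t x + pert t y" for x y by (rule pert_add[OF t])
    show "pert t (r *\<^sub>R x) = r *\<^sub>R pert t x" for r x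
      by (intro pert_commute bounded_linear_scaleR_right t C.scaleR) (auto simp: T_scaleR)
    show "norm (pert t x) \<le> norm x * (K * M)" for x
      using K[OF continuous_on_pert'[of t x], of "\<lambda>s. T s x" "M * norm x"] pert_eq M(2) t
      by (simp add: mult_ac)
  qed
qed

text \<open>By \<open>conv_shift\<close> the shifted orbit solves the Volterra equation with datum
  \<open>pert t x\<close>; uniqueness identifies it with the orbit of that datum.\<close>

lemma pert_semigroup:
  assumes s: "s \<ge> 0" and t: "t \<ge> 0"
  shows "pert (s + t) x = pert s (pert t x)"
proof -
  have cont: "continuous_on {0..a} (\<lambda>r. pert (t + r) x)" for a
    by (rule continuous_on_compose2[OF continuous_on_pert]) (use t in \<open>auto intro!: continuous_intros\<close>)
  have "pert s (pert t x) = pert (t + s) x"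
  proof (rule pert_eqI[of s "\<lambda>r. pert (t + r) x"])
    fix r assume r: "0 \<le> r" "r \<le> s"
    have "conv (\<lambda>\<tau>. C (pert \<tau> x)) (t + r)
        = T r (conv (\<lambda>\<tau>. C (pert \<tau> x)) t) + conv (\<lambda>\<tau>. C (pert (t + \<tau>) x)) r"
      by (intro conv_shift continuous_on_C continuous_on_pert' t r)
    moreover have "T (t + r) x = T r (T t x)"
      using semigroup[of r t x] r t by (simp add: add.commute)
    ultimately show "pert (t + r) x = T r (pert t x) + conv (\<lambda>\<tau>. C (pert (t + \<tau>) x)) r"
      using pert_eq[of t x] pert_eq[of "t + r" x] r t by (simp add: T_add)
  qed (intro cont s)+
  then show ?thesis by (simp add: add.commute)
qed

sublocale pert: strongly_continuous pert
proof (rule strongly_continuous.intro)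
  show "pert 0 x = x" for x using pert_eq[of 0 x] by simp
  show "((\<lambda>t. pert t x) \<longlongrightarrow> x) (at_right 0)" for x
  proof -
    have "((\<lambda>t. pert t x) \<longlongrightarrow> pert 0 x) (at 0 within {0..})"
      using continuous_on_pert[of x] by (auto simp: continuous_on_def)
    then show ?thesis
      using pert_eq[of 0 x] by (auto intro: tendsto_within_subset)
  qed
qed (auto intro: bounded_linear_pert pert_semigroup)

text \<open>The difference quotients of \<open>pert\<close> and of \<open>T\<close> at zero differ
  by a term that tends to \<open>C x\<close>, so both converge or neither does.\<close>

lemma generator_domain_pert: "generator_domain pert = \<D>"
proof -
  have *: "((\<lambda>h. (pert h x - x) /\<^sub>R h - (T h x - x) /\<^sub>R h) \<longlongrightarrow> C x) (at_right 0)" for x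
  proof -
    have "((\<lambda>h. conv (\<lambda>\<tau>. C (pert \<tau> x)) h /\<^sub>R h) \<longlongrightarrow> C (pert 0 x)) (at_right 0)"
      by (rule conv_div_tendsto[where a = 1]) (auto intro!: continuous_on_C continuous_on_pert')
    moreover have "eventually (\<lambda>h. conv (\<lambda>\<tau>. C (pert \<tau> x)) h /\<^sub>R h
        = (pert h x - x) /\<^sub>R h - (T h x - x) /\<^sub>R h) (at_right 0)"
      using pert_eq[of _ x]
      by (auto simp: eventually_at_right_field simp flip: scaleR_diff_right intro!: exI[of _ 1])
    ultimately show ?thesis using Lim_transform_eventually by fastforce
  qed
  show ?thesis
  proof safe
    fix x assume "x \<in> generator_domain pert"
    from tendsto_diff[OF pert.generator_tendsto[OF this] *[of x]] show "x \<in> \<D>"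
      by (auto simp: generator_domain_def)
  next
    fix x assume "x \<in> \<D>"
    from tendsto_add[OF generator_tendsto[OF this] *[of x]] show "x \<in> generator_domain pert"
      by (auto simp: generator_domain_def)
  qed
qed

lemma pert_in_dom: "x \<in> \<D> \<Longrightarrow> t \<ge> 0 \<Longrightarrow> pert t x \<in> \<D>"
  using pert.dom_T(1) generator_domain_pert by auto

end

section \<open>Square-integrable inputs and admissibility on subintervals\<close>

lemma simple_function_floor:
  assumes c: "c > 0"
  shows "simple_function (lebesgue_on {0..t}) (\<lambda>x::real. \<lfloor>x * c\<rfloor>)"
  unfolding simple_function_def
proof
  have "(\<lambda>x. \<lfloor>x * c\<rfloor>) ` {0..t} \<subseteq> {0..\<lfloor>t * c\<rfloor>}"
    using c by (auto intro!: floor_mono mult_right_mono)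
  then show "finite ((\<lambda>x. \<lfloor>x * c\<rfloor>) ` space (lebesgue_on {0..t}))"
    by (simp add: finite_subset[OF _ finite_atLeastAtMost_int])
  show "\<forall>k\<in>(\<lambda>x. \<lfloor>x * c\<rfloor>) ` space (lebesgue_on {0..t}).
      (\<lambda>x. \<lfloor>x * c\<rfloor>) -` {k} \<inter> space (lebesgue_on {0..t}) \<in> sets (lebesgue_on {0..t})"
  proof
    fix k
    have "(\<lambda>x. \<lfloor>x * c\<rfloor>) -` {k} \<inter> space (lebesgue_on {0..t}) = {of_int k / c..<(of_int k + 1) / c} \<inter> {0..t}"
      using c by (auto simp: floor_eq_iff field_simps; linarith)
    then show "(\<lambda>x. \<lfloor>x * c\<rfloor>) -` {k} \<inter> space (lebesgue_on {0..t}) \<in> sets (lebesgue_on {0..t})"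
      by (simp add: sets_restrict_space_iff)
  qed
qed

text \<open>The step functions sample \<open>f\<close> at the grid point \<open>r n x\<close> to the
  left of \<open>x\<close>; rounding down keeps the sample inside \<open>{0..t}\<close>.
  Admissibility of \<open>B\<close> thereby applies to continuous inputs.\<close>

lemma L2_space_continuous:
  fixes f :: "real \<Rightarrow> 'y::real_normed_vector"
  assumes f: "continuous_on {0..t} f"
  shows "f \<in> L2_space t"
proof -
  define r where "r n x = of_int \<lfloor>x * real (Suc n)\<rfloor> / real (Suc n)" for n and x :: real
  have r: "r n x \<le> x" "x - r n x \<le> inverse (real (Suc n))" for n x
  proof -
    have a: "of_int \<lfloor>x * real (Suc n)\<rfloor> \<le> x * real (Suc n)" "x * real (Suc n) < of_int \<lfloor>x * real (Suc n)\<rfloor> + 1"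
      by linarith+
    have "x - r n x = (x * real (Suc n) - of_int \<lfloor>x * real (Suc n)\<rfloor>) / real (Suc n)"
      unfolding r_def by (simp add: field_simps)
    moreover have "(x * real (Suc n) - of_int \<lfloor>x * real (Suc n)\<rfloor>) / real (Suc n) \<le> 1 / real (Suc n)"
      using a(2) by (intro divide_right_mono) linarith+
    ultimately show "r n x \<le> x" "x - r n x \<le> inverse (real (Suc n))"
      unfolding inverse_eq_divide using a(1) by (simp_all add: r_def pos_divide_le_eq del: of_nat_Suc)
  qed
  have lim: "(\<lambda>n. r n x) \<longlonglongrightarrow> x" for x
  proof -
    have "(\<lambda>n. x - r n x) \<longlonglongrightarrow> 0"
      by (rule real_tendsto_sandwich[OF _ _ tendsto_const LIMSEQ_inverse_real_of_nat]) (use r in auto)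
    from tendsto_diff[OF tendsto_const[of x] this] show ?thesis by simp
  qed
  have "strongly_measurable t f"
    unfolding strongly_measurable_def
  proof (intro exI[of _ "\<lambda>n x. f (r n x)"] conjI allI AE_I2)
    show "simple_function (lebesgue_on {0..t}) (\<lambda>x. f (r n x))" for n
      unfolding r_def
      by (intro simple_function_compose1[of _ _ "\<lambda>k. f (of_int k / real (Suc n))"] simple_function_floor) simp
    fix x assume "x \<in> space (lebesgue_on {0..t})"
    then have x: "x \<in> {0..t}" by simp
    have "r n x \<in> {0..t}" for n
      using r(1)[of n x] x by (auto simp: r_def intro!: divide_nonneg_nonneg)
    then show "(\<lambda>n. f (r n x)) \<longlonglongrightarrow> f x"
      using continuous_on_tendsto_compose[OF f lim[of x] x] by (simp add: always_eventually)
  qed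
  moreover have "integrable (lebesgue_on {0..t}) (\<lambda>\<tau>. (norm (f \<tau>))\<^sup>2)"
    by (intro continuous_imp_integrable_real continuous_intros f)
  ultimately show ?thesis by (simp add: L2_space_def)
qed

lemma L2_space_integrable_on:
  "f \<in> L2_space t \<Longrightarrow> (\<lambda>\<tau>. (norm (f \<tau>))\<^sup>2) integrable_on {0..t}"
  by (auto simp: L2_space_def intro: integrable_on_lebesgue_on)

lemma L2_norm_eq:
  "f \<in> L2_space t \<Longrightarrow> L2_norm t f = sqrt (integral {0..t} (\<lambda>\<tau>. (norm (f \<tau>))\<^sup>2))"
  by (auto simp: L2_space_def L2_norm_def lebesgue_integral_eq_integral)

section \<open>Delayed inputs\<close>

lemma AE_lebesgue_shift:
  assumes "AE x in lebesgue. P (x::real)"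
  shows "AE x in lebesgue. P (x - d)"
proof -
  obtain N where N: "N \<in> null_sets lebesgue" "{x. \<not> P x} \<subseteq> N"
    using assms by (auto simp: eventually_ae_filter)
  have "negligible N" using N(1) by (simp add: negligible_iff_null_sets)
  then have "negligible ((+) d ` N)" by (rule negligible_translation)
  moreover have "{x. \<not> P (x - d)} \<subseteq> (+) d ` N"
  proof
    fix x assume "x \<in> {x. \<not> P (x - d)}"
    then have "x - d \<in> N" using N by auto
    then show "x \<in> (+) d ` N" by (intro image_eqI[of _ _ "x - d"]) auto
  qed
  ultimately show ?thesis
    by (auto simp: eventually_ae_filter negligible_iff_null_sets)
qed

lemma strongly_measurable_shift:
  fixes u :: "real \<Rightarrow> 'y::real_normed_vector"
  assumes u: "strongly_measurable t u" and d: "d \<ge> 0"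
  shows "strongly_measurable (d + t) (\<lambda>\<tau>. if \<tau> \<in> {d..d + t} then u (\<tau> - d) else 0)"
proof -
  obtain s where s: "\<And>n. simple_function (lebesgue_on {0..t}) (s n)"
    and lim: "AE \<tau> in lebesgue_on {0..t}. (\<lambda>n. s n \<tau>) \<longlonglongrightarrow> u \<tau>"
    using u by (auto simp: strongly_measurable_def)
  show ?thesis
    unfolding strongly_measurable_def
  proof (intro exI[of _ "\<lambda>n \<tau>. if \<tau> \<in> {d..d + t} then s n (\<tau> - d) else 0"] conjI allI)
    fix n
    let ?r = "\<lambda>\<tau>. if \<tau> \<in> {d..d + t} then s n (\<tau> - d) else 0"
    show "simple_function (lebesgue_on {0..d + t}) ?r"
      unfolding simple_function_def
    proof
      have "?r ` {0..d + t} \<subseteq> insert 0 (s n ` {0..t})" by auto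
      moreover have "finite (s n ` {0..t})" using s[of n] by (simp add: simple_function_def)
      ultimately have "finite (?r ` {0..d + t})" by (meson finite_insert finite_subset)
      then show "finite (?r ` space (lebesgue_on {0..d + t}))" by (simp only: space_lebesgue_on)
      show "\<forall>y\<in>?r ` space (lebesgue_on {0..d + t}).
          ?r -` {y} \<inter> space (lebesgue_on {0..d + t}) \<in> sets (lebesgue_on {0..d + t})"
      proof
        fix y
        have img: "(+) d ` S = {x. x - d \<in> S}" for S
          by (auto simp: image_iff) (metis add.commute diff_add_cancel)
        have "s n -` {y} \<inter> {0..t} \<in> sets lebesgue"
          using simple_functionD(2)[OF s[of n], of "{y}"] by (simp add: sets_restrict_space_iff)
        then have "(+) d ` (s n -` {y} \<inter> {0..t}) \<in> sets lebesgue"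
          by (rule lebesgue_sets_translation)
        moreover have "?r -` {y} \<inter> {0..d + t}
            = (+) d ` (s n -` {y} \<inter> {0..t}) \<union> (if y = 0 then {0..d + t} - {d..d + t} else {})"
          using d unfolding img by (auto split: if_splits)
        moreover have "(+) d ` (s n -` {y} \<inter> {0..t}) \<subseteq> {0..d + t}" using d by auto
        ultimately show "?r -` {y} \<inter> space (lebesgue_on {0..d + t}) \<in> sets (lebesgue_on {0..d + t})"
          by (auto simp: sets_restrict_space_iff intro!: sets.Un sets.Diff)
      qed
    qed
  next
    have "AE \<tau> in lebesgue. \<tau> \<in> {0..t} \<longrightarrow> (\<lambda>n. s n \<tau>) \<longlonglongrightarrow> u \<tau>"
      using lim by (simp add: AE_restrict_space_iff)
    from AE_lebesgue_shift[OF this, of d]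
    have "AE \<tau> in lebesgue. \<tau> \<in> {0..d + t} \<longrightarrow>
        (\<lambda>n. if \<tau> \<in> {d..d + t} then s n (\<tau> - d) else 0) \<longlonglongrightarrow> (if \<tau> \<in> {d..d + t} then u (\<tau> - d) else 0)"
      by eventually_elim (auto simp: algebra_simps)
    then show "AE \<tau> in lebesgue_on {0..d + t}.
        (\<lambda>n. if \<tau> \<in> {d..d + t} then s n (\<tau> - d) else 0) \<longlonglongrightarrow> (if \<tau> \<in> {d..d + t} then u (\<tau> - d) else 0)"
      by (simp add: AE_restrict_space_iff)
  qed
qed

text \<open>Prepares the passage of input admissibility to shorter intervals: the input waits for a
  time \<open>d\<close> and then acts until the end of the longer interval.\<close>

lemma L2_space_shift:
  fixes u :: "real \<Rightarrow> 'y::real_normed_vector"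
  assumes u: "u \<in> L2_space t" and d: "d \<ge> 0"
  defines "v \<equiv> \<lambda>\<tau>. if \<tau> \<in> {d..d + t} then u (\<tau> - d) else 0"
  shows "v \<in> L2_space (d + t)" "L2_norm (d + t) v = L2_norm t u"
proof -
  have v: "(\<lambda>\<tau>. (norm (v \<tau>))\<^sup>2) = (\<lambda>\<tau>. if \<tau> \<in> {d..d + t} then (norm (u (\<tau> - d)))\<^sup>2 else 0)"
    by (auto simp: v_def)
  have "(\<lambda>\<tau>. (norm (u (\<tau> + - d)))\<^sup>2) integrable_on {0 - - d..t - - d}"
    using integrable_shift_real_ivl[OF L2_space_integrable_on[OF u], of "- d"] .
  then have "(\<lambda>\<tau>. (norm (v \<tau>))\<^sup>2) integrable_on {0..d + t}"
    unfolding v using d by (subst integrable_restrict_Int) (simp add: Int_absorb2 add.commute)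
  then have "integrable (lebesgue_on {0..d + t}) (\<lambda>\<tau>. (norm (v \<tau>))\<^sup>2)"
    by (intro absolutely_integrable_imp_integrable nonnegative_absolutely_integrable_1) auto
  moreover have "strongly_measurable (d + t) v"
    unfolding v_def using u d by (intro strongly_measurable_shift) (auto simp: L2_space_def)
  ultimately show v2: "v \<in> L2_space (d + t)" by (simp add: L2_space_def)
  have "integral {0..d + t} (\<lambda>\<tau>. (norm (v \<tau>))\<^sup>2) = integral {d..d + t} (\<lambda>\<tau>. (norm (u (\<tau> - d)))\<^sup>2)"
    unfolding v using d by (subst integral_restrict_Int) (simp add: Int_absorb2)
  also have "\<dots> = integral {0..t} (\<lambda>\<tau>. (norm (u \<tau>))\<^sup>2)"
    using integral_shift_real_ivl[of 0 "- d" t "\<lambda>\<tau>. (norm (u \<tau>))\<^sup>2"] by (simp add: add.commute)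
  finally show "L2_norm (d + t) v = L2_norm t u"
    by (simp add: L2_norm_eq[OF u] L2_norm_eq[OF v2])
qed

section \<open>Real linearity and linearity over the base field\<close>

lemma bounded_linear_of_bounded_operator:
  assumes X: "hilbert_space_over scX" and Y: "hilbert_space_over scY"
    and L: "bounded_operator scX scY L"
  shows "bounded_linear L"
proof -
  from L have lin: "Vector_Spaces.linear scX scY L" by (simp add: bounded_operator_def)
  obtain K where K: "\<And>x. norm (L x) \<le> K * norm x" using L by (auto simp: bounded_operator_def)
  show ?thesis
  proof (rule bounded_linear_intro)
    show "L (x + y) = L x + L y" for x y
      using lin by (simp add: Vector_Spaces.linear_iff)
    show "L (r *\<^sub>R x) = r *\<^sub>R L x" for r x
      using lin X Y unfolding hilbert_space_over_def Vector_Spaces.linear_iff by metis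
    show "norm (L x) \<le> norm x * K" for x using K[of x] by (simp add: mult.commute)
  qed
qed

lemma bounded_operatorI:
  assumes X: "hilbert_space_over scX" and Y: "hilbert_space_over scY"
    and L: "bounded_linear L" and sc: "\<And>c x. L (scX c x) = scY c (L x)"
  shows "bounded_operator scX scY L"
proof -
  obtain K where "\<And>x. norm (L x) \<le> norm x * K" using bounded_linear.bounded[OF L] by blast
  then have "\<exists>K. \<forall>x. norm (L x) \<le> K * norm x" by (auto simp: mult.commute)
  then show ?thesis
    using X Y sc linear_add[OF bounded_linear.linear[OF L]]
    by (auto simp: bounded_operator_def Vector_Spaces.linear_iff hilbert_space_over_def)
qed

lemma bounded_linear_scalar:
  assumes X: "hilbert_space_over scX"
  shows "bounded_linear (scX c)"
proof (rule bounded_linear_intro)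
  have vs: "vector_space scX" using X by (simp add: hilbert_space_over_def)
  show "scX c (x + y) = scX c x + scX c y" for x y
    using vs by (simp add: vector_space_def)
  show "scX c (r *\<^sub>R x) = r *\<^sub>R scX c x" for r x
  proof -
    have "scX c (scX (of_real r) x) = scX (of_real r) (scX c x)"
      using vs by (simp add: vector_space_def mult.commute)
    then show ?thesis using X by (simp add: hilbert_space_over_def)
  qed
  show "norm (scX c x) \<le> norm x * norm c" for x
    using X by (simp add: hilbert_space_over_def mult.commute)
qed

lemma C0_semigroup_commute_scalar:
  "C0_semigroup scX T \<Longrightarrow> t \<ge> 0 \<Longrightarrow> T t (scX c x) = scX c (T t x)"
  by (auto simp: C0_semigroup_def bounded_operator_def Vector_Spaces.linear_iff)

lemma C0_semigroup_imp_strongly_continuous: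
  assumes "hilbert_space_over scX" "C0_semigroup scX T"
  shows "strongly_continuous T"
  by (rule strongly_continuous.intro)
    (use assms bounded_linear_of_bounded_operator[OF assms(1,1)] in \<open>auto simp: C0_semigroup_def\<close>)

context strongly_continuous
begin

lemma C0_semigroupI:
  assumes "hilbert_space_over scX" "\<And>t c x. t \<ge> 0 \<Longrightarrow> T t (scX c x) = scX c (T t x)"
  shows "C0_semigroup scX T"
  using assms bounded_linear right_continuous semigroup
  by (auto simp: C0_semigroup_def intro!: bounded_operatorI)

text \<open>An input on \<open>{0..t}\<close> is delayed by \<open>a - t\<close>. At time
  \<open>a\<close> the delayed input has produced the state that the original one produces at time
  \<open>t\<close>, with the same L2 norm, so a single \<open>\<beta>\<close> serves all intervals
  up to \<open>a\<close>.\<close>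

lemma admissible_input_on_intervals:
  assumes B0: "B 0 = 0" and adm: "admissible_input scU scX T B"
  obtains a \<beta> where "a > 0" "\<beta> > 0"
    "\<And>t u. 0 \<le> t \<Longrightarrow> t \<le> a \<Longrightarrow> u \<in> L2_space t \<Longrightarrow> conv (\<lambda>\<tau>. B (u \<tau>)) t \<in> \<D>"
    "\<And>t u. 0 \<le> t \<Longrightarrow> t \<le> a \<Longrightarrow> u \<in> L2_space t \<Longrightarrow>
      graph_norm T (conv (\<lambda>\<tau>. B (u \<tau>)) t) \<le> \<beta> * sqrt (integral {0..t} (\<lambda>\<tau>. (norm (u \<tau>))\<^sup>2))"
proof -
  obtain a \<beta> where a: "a > 0" "\<beta> > 0" and H: "\<And>u. u \<in> L2_space a \<Longrightarrow>
      integral {0..a} (\<lambda>\<tau>. T (a - \<tau>) (B (u \<tau>))) \<in> \<D> \<and>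
      graph_norm T (integral {0..a} (\<lambda>\<tau>. T (a - \<tau>) (B (u \<tau>)))) \<le> \<beta> * L2_norm a u"
    using adm by (auto simp: admissible_input_def)
  have *: "conv (\<lambda>\<tau>. B (u \<tau>)) t \<in> \<D> \<and>
      graph_norm T (conv (\<lambda>\<tau>. B (u \<tau>)) t) \<le> \<beta> * sqrt (integral {0..t} (\<lambda>\<tau>. (norm (u \<tau>))\<^sup>2))"
    if t: "0 \<le> t" "t \<le> a" and u: "u \<in> L2_space t" for t u
  proof -
    define d where "d = a - t"
    have d: "d \<ge> 0" "a = d + t" using t by (auto simp: d_def)
    define v where "v \<tau> = (if \<tau> \<in> {d..d + t} then u (\<tau> - d) else 0)" for \<tau>
    have v: "v \<in> L2_space a" "L2_norm a v = L2_norm t u"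
      using L2_space_shift[OF u d(1)] unfolding d(2) v_def[abs_def] by auto
    \<comment> \<open>During the waiting time the input is zero and contributes nothing, by
      \<open>B 0 = 0\<close>.\<close>
    have "integral {0..a} (\<lambda>\<tau>. T (a - \<tau>) (B (v \<tau>)))
        = integral {0..a} (\<lambda>\<tau>. if \<tau> \<in> {d..a} then T (a - \<tau>) (B (u (\<tau> - d))) else 0)"
      by (intro integral_cong) (auto simp: v_def d(2) B0 T_0)
    also have "\<dots> = integral {d..a} (\<lambda>\<tau>. T (a - \<tau>) (B (u (\<tau> - d))))"
      using d by (subst integral_restrict_Int_complete) (simp add: Int_absorb2)
    also have "\<dots> = conv (\<lambda>\<tau>. B (u \<tau>)) t"
      using integral_shift_real_ivl[of d d a "\<lambda>\<tau>. T (a - \<tau>) (B (u (\<tau> - d)))"]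
      by (simp add: d conv_def)
    finally show ?thesis using H[OF v(1)] v(2) L2_norm_eq[OF u] by simp
  qed
  show ?thesis by (rule that[OF a]) (use * in blast)+
qed

section \<open>Passing from the dense domain to the whole space\<close>

lemma eq_on_dom_imp_eq:
  assumes "bounded_linear f" "bounded_linear g" "\<And>x. x \<in> \<D> \<Longrightarrow> f x = g x"
  shows "f x = g x"
proof -
  obtain u where u: "\<And>n. u n \<in> \<D>" "u \<longlonglongrightarrow> x" using dense_dom[of x] by blast
  have "(\<lambda>n. f (u n)) \<longlonglongrightarrow> f x" "(\<lambda>n. g (u n)) \<longlonglongrightarrow> g x"
    by (intro bounded_linear.tendsto[OF assms(1)] bounded_linear.tendsto[OF assms(2)] u)+
  then show ?thesis using assms(3)[OF u(1)] LIMSEQ_unique by simp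
qed

lemma norm_le_on_dom_imp_norm_le:
  assumes f: "bounded_linear f" and le: "\<And>x. x \<in> \<D> \<Longrightarrow> norm (f x) \<le> c * norm x"
  shows "norm (f x) \<le> c * norm x"
proof -
  obtain u where u: "\<And>n. u n \<in> \<D>" "u \<longlonglongrightarrow> x" using dense_dom[of x] by blast
  have "(\<lambda>n. norm (f (u n))) \<longlonglongrightarrow> norm (f x)" "(\<lambda>n. c * norm (u n)) \<longlonglongrightarrow> c * norm x"
    by (intro tendsto_intros bounded_linear.tendsto[OF f] u)+
  then show ?thesis by (rule LIMSEQ_le) (use le u in blast)
qed

lemma bounded_linear_extension:
  fixes f :: "'x \<Rightarrow> 'u::{real_normed_vector, complete_space}"
  assumes add: "\<And>x y. x \<in> \<D> \<Longrightarrow> y \<in> \<D> \<Longrightarrow> f (x + y) = f x + f y"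
    and scale: "\<And>r x. x \<in> \<D> \<Longrightarrow> f (r *\<^sub>R x) = r *\<^sub>R f x"
    and bound: "\<And>x. x \<in> \<D> \<Longrightarrow> norm (f x) \<le> norm x * c"
  shows "\<exists>g. bounded_linear g \<and> (\<forall>x\<in>\<D>. g x = f x)"
proof -
  obtain u where u: "\<And>x n. u x n \<in> \<D>" "\<And>x. u x \<longlonglongrightarrow> x" using dense_dom by metis
  have diff: "f x - f y = f (x - y)" if "x \<in> \<D>" "y \<in> \<D>" for x y
    using add[OF that(1) dom_scaleR(1)[OF that(2), of "-1"]] scale[OF that(2), of "-1"] by simp
  have null: "(\<lambda>n. f (z n)) \<longlonglongrightarrow> 0" if "\<And>n. z n \<in> \<D>" "z \<longlonglongrightarrow> 0" for z
    by (rule Lim_null_comparison[of _ "\<lambda>n. norm (z n) * c"])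
      (use that bound in \<open>auto intro!: always_eventually tendsto_mult_left_zero tendsto_norm_zero\<close>)
  define g where "g x = lim (\<lambda>n. f (u x n))" for x
  have "convergent (\<lambda>n. f (u x n))" for x
  proof (rule Cauchy_convergent, rule metric_CauchyI)
    fix e :: real assume e: "e > 0"
    \<comment> \<open>The constant \<open>c\<close> may be zero or negative;
      \<open>\<bar>c\<bar> + 1\<close> is a positive number above it.\<close>
    have e': "e / (\<bar>c\<bar> + 1) > 0" using e by simp
    obtain n0 where n0: "\<And>m n. m \<ge> n0 \<Longrightarrow> n \<ge> n0 \<Longrightarrow> dist (u x m) (u x n) < e / (\<bar>c\<bar> + 1)"
      using metric_CauchyD[OF LIMSEQ_imp_Cauchy[OF u(2)[of x]] e'] by blast
    have "dist (f (u x m)) (f (u x n)) < e" if mn: "m \<ge> n0" "n \<ge> n0" for m n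
    proof -
      have "dist (f (u x m)) (f (u x n)) \<le> norm (u x m - u x n) * c"
        unfolding dist_norm diff[OF u(1) u(1)] by (intro bound dom_diff u)
      also have "\<dots> \<le> norm (u x m - u x n) * (\<bar>c\<bar> + 1)" by (intro mult_left_mono) auto
      also have "\<dots> < e / (\<bar>c\<bar> + 1) * (\<bar>c\<bar> + 1)"
        using n0[OF mn] by (intro mult_strict_right_mono) (auto simp: dist_norm)
      finally show ?thesis by simp
    qed
    then show "\<exists>n0. \<forall>m\<ge>n0. \<forall>n\<ge>n0. dist (f (u x m)) (f (u x n)) < e" by blast
  qed
  then have lim_u: "(\<lambda>n. f (u x n)) \<longlonglongrightarrow> g x" for x
    by (simp add: g_def convergent_LIMSEQ_iff)
  \<comment> \<open>The limit does not depend on the approximating sequence, so sums and multiples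
    of chosen sequences can replace the sequences chosen for sums and multiples.\<close>
  have lim: "(\<lambda>n. f (v n)) \<longlonglongrightarrow> g x" if v: "\<And>n. v n \<in> \<D>" "v \<longlonglongrightarrow> x" for v x
  proof -
    have "(\<lambda>n. v n - u x n) \<longlonglongrightarrow> 0" using tendsto_diff[OF v(2) u(2)[of x]] by simp
    then have "(\<lambda>n. f (v n - u x n)) \<longlonglongrightarrow> 0" by (intro null dom_diff v u)
    from tendsto_add[OF this lim_u[of x]] show ?thesis by (simp add: diff[symmetric] v(1) u(1))
  qed
  have "bounded_linear g"
  proof (rule bounded_linear_intro)
    fix x y :: 'x and r :: real
    have "(\<lambda>n. f (u x n + u y n)) \<longlonglongrightarrow> g (x + y)" by (intro lim dom_add tendsto_add u)
    moreover have "(\<lambda>n. f (u x n) + f (u y n)) \<longlonglongrightarrow> g x + g y" by (intro tendsto_add lim_u)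
    ultimately show "g (x + y) = g x + g y" by (simp add: add u LIMSEQ_unique)
    have "(\<lambda>n. f (r *\<^sub>R u x n)) \<longlonglongrightarrow> g (r *\<^sub>R x)" by (intro lim dom_scaleR tendsto_intros u)
    moreover have "(\<lambda>n. r *\<^sub>R f (u x n)) \<longlonglongrightarrow> r *\<^sub>R g x" by (intro tendsto_intros lim_u)
    ultimately show "g (r *\<^sub>R x) = r *\<^sub>R g x" by (simp add: scale u LIMSEQ_unique)
    have "(\<lambda>n. norm (f (u x n))) \<longlonglongrightarrow> norm (g x)" "(\<lambda>n. norm (u x n) * c) \<longlonglongrightarrow> norm x * c"
      by (intro tendsto_intros lim_u u)+
    then show "norm (g x) \<le> norm x * c" by (rule LIMSEQ_le) (use bound u in blast)
  qed
  moreover have "g x = f x" if "x \<in> \<D>" for x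
    using LIMSEQ_unique[OF lim[of "\<lambda>_. x" x] tendsto_const] that by simp
  ultimately show ?thesis by blast
qed

text \<open>\<open>F\<close> is continuous for the graph norm, so it suffices that \<open>z\<close>
  and \<open>gen\<close> along \<open>z\<close> are both continuous in X.\<close>

lemma continuous_on_bounded_on_X1:
  fixes F :: "'x \<Rightarrow> 'u::{real_inner, complete_space}"
  assumes F: "\<And>x y. x \<in> \<D> \<Longrightarrow> y \<in> \<D> \<Longrightarrow> F (x - y) = F x - F y"
    and K: "\<And>x. x \<in> \<D> \<Longrightarrow> norm (F x) \<le> K * graph_norm T x"
    and z: "\<And>p. p \<in> A \<Longrightarrow> z p \<in> \<D>" "continuous_on A z" "continuous_on A (\<lambda>p. gen (z p))"
  shows "continuous_on A (\<lambda>p. F (z p))"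
  unfolding continuous_on_def
proof
  fix q assume q: "q \<in> A"
  have ev: "eventually (\<lambda>p. p \<in> A) (at q within A)"
    by (simp add: eventually_at_topological) blast
  have "((\<lambda>p. F (z p) - F (z q)) \<longlongrightarrow> 0) (at q within A)"
  proof (rule Lim_null_comparison)
    show "eventually (\<lambda>p. norm (F (z p) - F (z q))
        \<le> K * sqrt ((norm (z p - z q))\<^sup>2 + (norm (gen (z p) - gen (z q)))\<^sup>2)) (at q within A)"
      using ev
    proof eventually_elim
      case (elim p)
      then show ?case
        using K[OF dom_diff(1)[OF z(1) z(1)], of p q] q z(1)
        by (simp add: F dom_diff graph_norm_def)
    qed
    have "((\<lambda>p. K * sqrt ((norm (z p - z q))\<^sup>2 + (norm (gen (z p) - gen (z q)))\<^sup>2))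
        \<longlongrightarrow> K * sqrt ((norm (z q - z q))\<^sup>2 + (norm (gen (z q) - gen (z q)))\<^sup>2)) (at q within A)"
      using z(2,3) q by (intro tendsto_intros) (auto simp: continuous_on_def)
    then show "((\<lambda>p. K * sqrt ((norm (z p - z q))\<^sup>2 + (norm (gen (z p) - gen (z q)))\<^sup>2)) \<longlongrightarrow> 0) (at q within A)"
      by simp
  qed
  then show "((\<lambda>p. F (z p)) \<longlongrightarrow> F (z q)) (at q within A)" by (rule LIM_zero_cancel)
qed

end

section \<open>The closed loop of an admissible feedback\<close>

text \<open>All constants refer to one short interval \<open>{0..a}\<close>. The factor
  \<open>M + 2 * \<alpha> * \<beta>\<close> in \<open>small\<close> will bound the growth of the
  graph norm along \<open>S\<close>, and its product with \<open>K\<close> bounds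
  \<open>F (S t x)\<close> and the averages by the graph norm of \<open>x\<close>. The condition
  \<open>a \<le> 1\<close> allows times to be replaced by their square roots.\<close>

locale pritchard_salamon_feedback = strongly_continuous T + S: strongly_continuous S
  for T S :: "real \<Rightarrow> 'x::{real_inner, complete_space} \<Rightarrow> 'x" +
  fixes B :: "'u::{real_inner, complete_space} \<Rightarrow> 'x" and F :: "'x \<Rightarrow> 'u" and a \<alpha> \<beta> K M :: real
  assumes bounded_linear_B: "bounded_linear B"
    and F_add: "x \<in> \<D> \<Longrightarrow> y \<in> \<D> \<Longrightarrow> F (x + y) = F x + F y"
    and F_scaleR: "x \<in> \<D> \<Longrightarrow> F (r *\<^sub>R x) = r *\<^sub>R F x"
    and F_bound: "x \<in> \<D> \<Longrightarrow> norm (F x) \<le> K * graph_norm T x"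
    and input_dom: "0 \<le> t \<Longrightarrow> t \<le> a \<Longrightarrow> u \<in> L2_space t \<Longrightarrow> conv (\<lambda>\<tau>. B (u \<tau>)) t \<in> \<D>"
    and input_bound: "0 \<le> t \<Longrightarrow> t \<le> a \<Longrightarrow> u \<in> L2_space t \<Longrightarrow>
      graph_norm T (conv (\<lambda>\<tau>. B (u \<tau>)) t) \<le> \<beta> * sqrt (integral {0..t} (\<lambda>\<tau>. (norm (u \<tau>))\<^sup>2))"
    and output_bound: "x \<in> \<D> \<Longrightarrow> integral {0..a} (\<lambda>\<tau>. (norm (F (T \<tau> x)))\<^sup>2) \<le> (\<alpha> * norm x)\<^sup>2"
    and S_dom: "x \<in> \<D> \<Longrightarrow> 0 \<le> t \<Longrightarrow> S t x \<in> \<D>"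
    and S_L2: "x \<in> \<D> \<Longrightarrow> 0 \<le> t \<Longrightarrow> (\<lambda>\<tau>. F (S \<tau> x)) \<in> L2_space t"
    and S_eq: "x \<in> \<D> \<Longrightarrow> 0 \<le> t \<Longrightarrow> S t x = T t x + conv (\<lambda>\<tau>. B (F (S \<tau> x))) t"
    and T_bound: "0 \<le> t \<Longrightarrow> t \<le> a \<Longrightarrow> norm (T t x) \<le> M * norm x"
    and pos: "K > 0" "\<alpha> > 0" "\<beta> > 0" "M \<ge> 1" "a > 0" "a \<le> 1"
    and small: "4 * (K * (M + 2 * \<alpha> * \<beta>) * \<beta>)\<^sup>2 * a \<le> 1"
begin

interpretation B: bounded_linear B by (rule bounded_linear_B)

abbreviation "C1 \<equiv> K * (M + 2 * \<alpha> * \<beta>)"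

lemma C1: "K \<le> C1" "C1 > 0"
proof -
  have "M + 2 * \<alpha> * \<beta> \<ge> 1" using pos by (simp add: add_increasing2)
  then show "K \<le> C1" using pos by simp
  then show "C1 > 0" using pos by linarith
qed

lemma F_diff: "x \<in> \<D> \<Longrightarrow> y \<in> \<D> \<Longrightarrow> F (x - y) = F x - F y"
  using F_add[of x "(-1) *\<^sub>R y"] F_scaleR[of y "-1"] dom_scaleR(1)[of y "-1"] by simp

lemma continuous_on_F_T:
  assumes "x \<in> \<D>"
  shows "continuous_on {0..} (\<lambda>t. F (T t x))"
proof (rule continuous_on_bounded_on_X1[where F = F])
  show "continuous_on {0..} (\<lambda>t. gen (T t x))"
    using continuous_orbit[of "gen x"] by (rule continuous_on_eq) (simp add: dom_T assms)
qed (auto intro: F_diff F_bound dom_T assms continuous_orbit)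

text \<open>Absorption: the output \<open>y\<close> is \<open>F (T s x)\<close> plus
  \<open>F\<close> of a convolution driven by \<open>y\<close> itself, and the latter is at most
  \<open>K * \<beta>\<close> times the L2 norm of \<open>y\<close> at every time. Squaring and
  integrating over \<open>{0..a}\<close> gives \<open>I\<close> at most 2
  (\<open>\<alpha> * norm x\<close>)^2 + I/2. Subtracting I/2 is legitimate because
  \<open>S_L2\<close> makes the integral \<open>I\<close> exist as a finite number.\<close>

lemma integral_output_S:
  assumes x: "x \<in> \<D>" and t: "0 \<le> t" "t \<le> a"
  shows "integral {0..t} (\<lambda>\<tau>. (norm (F (S \<tau> x)))\<^sup>2) \<le> (2 * \<alpha> * norm x)\<^sup>2"
proof -
  define y where "y \<tau> = F (S \<tau> x)" for \<tau>
  have int: "(\<lambda>\<tau>. (norm (y \<tau>))\<^sup>2) integrable_on {0..s}" if "s \<ge> 0" for s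
    using L2_space_integrable_on[OF S_L2[OF x that]] by (simp add: y_def)
  have mono: "integral {0..s} (\<lambda>\<tau>. (norm (y \<tau>))\<^sup>2) \<le> integral {0..a} (\<lambda>\<tau>. (norm (y \<tau>))\<^sup>2)"
    if "0 \<le> s" "s \<le> a" for s
    by (rule integral_subset_le) (use that int in auto)
  define I where "I = integral {0..a} (\<lambda>\<tau>. (norm (y \<tau>))\<^sup>2)"
  have I0: "I \<ge> 0" unfolding I_def by (rule integral_nonneg) (use int pos in auto)
  have le: "(norm (y s))\<^sup>2 \<le> 2 * (norm (F (T s x)))\<^sup>2 + 2 * (K * \<beta>)\<^sup>2 * I" if s: "s \<in> {0..a}" for s
  proof -
    have s': "0 \<le> s" "s \<le> a" using s by auto
    have d: "conv (\<lambda>\<tau>. B (y \<tau>)) s \<in> \<D>"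
      unfolding y_def by (intro input_dom S_L2 x s')
    have "y s = F (T s x) + F (conv (\<lambda>\<tau>. B (y \<tau>)) s)"
      unfolding y_def S_eq[OF x s'(1)] by (rule F_add) (use x s' d in \<open>auto intro: dom_T simp: y_def\<close>)
    moreover have "norm (F (conv (\<lambda>\<tau>. B (y \<tau>)) s)) \<le> K * \<beta> * sqrt I"
    proof -
      have "norm (F (conv (\<lambda>\<tau>. B (y \<tau>)) s)) \<le> K * graph_norm T (conv (\<lambda>\<tau>. B (y \<tau>)) s)"
        by (rule F_bound[OF d])
      also have "\<dots> \<le> K * (\<beta> * sqrt (integral {0..s} (\<lambda>\<tau>. (norm (y \<tau>))\<^sup>2)))"
        unfolding y_def by (intro mult_left_mono input_bound s' S_L2 x) (use pos in auto)
      also have "\<dots> \<le> K * (\<beta> * sqrt I)"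
        unfolding I_def by (intro mult_left_mono real_sqrt_le_mono mono s') (use pos in auto)
      finally show ?thesis by simp
    qed
    ultimately have "norm (y s) \<le> norm (F (T s x)) + K * \<beta> * sqrt I"
      using norm_triangle_ineq[of "F (T s x)" "F (conv (\<lambda>\<tau>. B (y \<tau>)) s)"] by simp
    then have "(norm (y s))\<^sup>2 \<le> (norm (F (T s x)) + K * \<beta> * sqrt I)\<^sup>2" by (intro power_mono) auto
    also have "\<dots> \<le> 2 * (norm (F (T s x)))\<^sup>2 + 2 * (K * \<beta> * sqrt I)\<^sup>2"
      using sum_squares_bound[of "norm (F (T s x))" "K * \<beta> * sqrt I"] by (simp add: power2_sum)
    finally show ?thesis using I0 by (simp add: power_mult_distrib)
  qed
  have intT: "(\<lambda>s. (norm (F (T s x)))\<^sup>2) integrable_on {0..a}"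
    by (intro integrable_continuous_real continuous_intros continuous_on_subset[OF continuous_on_F_T[OF x]]) auto
  have "I \<le> integral {0..a} (\<lambda>s. 2 * (norm (F (T s x)))\<^sup>2 + 2 * (K * \<beta>)\<^sup>2 * I)"
    unfolding I_def by (rule integral_le) (use int pos intT le[unfolded I_def] in \<open>auto intro!: integrable_add\<close>)
  also have "\<dots> = 2 * integral {0..a} (\<lambda>s. (norm (F (T s x)))\<^sup>2) + 2 * (K * \<beta>)\<^sup>2 * I * a"
    using pos intT by (subst integral_add) auto
  also have "\<dots> \<le> 2 * (\<alpha> * norm x)\<^sup>2 + I / 2"
  proof (intro add_mono mult_left_mono output_bound x)
    have "(K * \<beta>)\<^sup>2 \<le> (C1 * \<beta>)\<^sup>2" using C1 pos by (intro power_mono mult_right_mono) auto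
    then have "4 * (K * \<beta>)\<^sup>2 * a \<le> 4 * (C1 * \<beta>)\<^sup>2 * a"
      using pos by (intro mult_right_mono mult_left_mono) auto
    then have "4 * (K * \<beta>)\<^sup>2 * a \<le> 1" using small by linarith
    from mult_right_mono[OF this I0] show "2 * (K * \<beta>)\<^sup>2 * I * a \<le> I / 2" by (simp add: mult_ac)
  qed simp
  finally have "I \<le> (2 * \<alpha> * norm x)\<^sup>2" by (simp add: power_mult_distrib)
  with mono[OF t] show ?thesis by (simp add: I_def y_def)
qed

text \<open>The graph norm is that of \<open>T\<close>, not of \<open>S\<close>: the free part
  contributes \<open>M\<close>, and the input part contributes \<open>\<beta>\<close> times the
  output bound \<open>2 * \<alpha> * norm x\<close>.\<close>

lemma graph_norm_S:
  assumes x: "x \<in> \<D>" and t: "0 \<le> t" "t \<le> a"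
  shows "graph_norm T (S t x) \<le> (M + 2 * \<alpha> * \<beta>) * graph_norm T x"
proof -
  have d: "conv (\<lambda>\<tau>. B (F (S \<tau> x))) t \<in> \<D>" by (intro input_dom S_L2 x t)
  have "graph_norm T (S t x) \<le> graph_norm T (T t x) + graph_norm T (conv (\<lambda>\<tau>. B (F (S \<tau> x))) t)"
    unfolding S_eq[OF x t(1)] by (intro graph_norm_triangle dom_T x t d)
  also have "graph_norm T (T t x) \<le> M * graph_norm T x"
    by (intro graph_norm_T x t T_bound) (use pos in auto)
  also have "graph_norm T (conv (\<lambda>\<tau>. B (F (S \<tau> x))) t) \<le> \<beta> * sqrt ((2 * \<alpha> * norm x)\<^sup>2)"
    by (rule order_trans[OF input_bound[OF t S_L2[OF x t(1)]]])
      (intro mult_left_mono real_sqrt_le_mono integral_output_S x t, use pos in auto)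
  also have "\<beta> * sqrt ((2 * \<alpha> * norm x)\<^sup>2) = 2 * \<alpha> * \<beta> * norm x" using pos by simp
  also have "2 * \<alpha> * \<beta> * norm x \<le> 2 * \<alpha> * \<beta> * graph_norm T x"
    by (intro mult_left_mono norm_le_graph_norm) (use pos in auto)
  finally show ?thesis by (simp add: algebra_simps)
qed

lemma norm_F_S:
  assumes x: "x \<in> \<D>" and t: "0 \<le> t" "t \<le> a"
  shows "norm (F (S t x)) \<le> C1 * graph_norm T x"
  unfolding mult.assoc[of K]
  by (rule order_trans[OF F_bound[OF S_dom[OF x t(1)]] mult_left_mono[OF graph_norm_S[OF x t]]])
    (use pos in simp)

text \<open>For \<open>x\<close> in the domain, \<open>T\<close> acts continuously on both
  \<open>x\<close> and \<open>gen x\<close>. The input part is of order \<open>sqrt t\<close>,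
  because \<open>F (S \<tau> x)\<close> is bounded on the interval.\<close>

lemma graph_norm_S_minus_id_tendsto:
  assumes x: "x \<in> \<D>"
  shows "((\<lambda>t. graph_norm T (S t x - x)) \<longlongrightarrow> 0) (at_right 0)"
proof (rule Lim_null_comparison)
  let ?g = "\<lambda>t. sqrt ((norm (T t x - x))\<^sup>2 + (norm (T t (gen x) - gen x))\<^sup>2)
      + \<beta> * sqrt (t * (C1 * graph_norm T x)\<^sup>2)"
  have "norm (graph_norm T (S t x - x)) \<le> ?g t" if t: "0 < t" "t < a" for t
  proof -
    have d: "conv (\<lambda>\<tau>. B (F (S \<tau> x))) t \<in> \<D>" using t by (intro input_dom S_L2 x) auto
    have Td: "T t x \<in> \<D>" "gen (T t x) = T t (gen x)" using dom_T[OF x] t by auto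
    have "S t x - x = (T t x - x) + conv (\<lambda>\<tau>. B (F (S \<tau> x))) t" using S_eq[OF x] t by simp
    then have "graph_norm T (S t x - x) \<le> graph_norm T (T t x - x) + graph_norm T (conv (\<lambda>\<tau>. B (F (S \<tau> x))) t)"
      using graph_norm_triangle[OF dom_diff(1)[OF Td(1) x] d] by (simp add: diff_add_eq)
    also have "graph_norm T (T t x - x) = sqrt ((norm (T t x - x))\<^sup>2 + (norm (T t (gen x) - gen x))\<^sup>2)"
      by (simp add: graph_norm_def dom_diff Td x)
    also have "graph_norm T (conv (\<lambda>\<tau>. B (F (S \<tau> x))) t) \<le> \<beta> * sqrt (t * (C1 * graph_norm T x)\<^sup>2)"
    proof -
      have "integral {0..t} (\<lambda>\<tau>. (norm (F (S \<tau> x)))\<^sup>2) \<le> integral {0..t} (\<lambda>\<tau>. (C1 * graph_norm T x)\<^sup>2)"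
        by (intro integral_le L2_space_integrable_on S_L2 x power_mono norm_F_S) (use t in auto)
      also have "\<dots> = t * (C1 * graph_norm T x)\<^sup>2" using t by simp
      finally have "sqrt (integral {0..t} (\<lambda>\<tau>. (norm (F (S \<tau> x)))\<^sup>2)) \<le> sqrt (t * (C1 * graph_norm T x)\<^sup>2)"
        by (rule real_sqrt_le_mono)
      then have "\<beta> * sqrt (integral {0..t} (\<lambda>\<tau>. (norm (F (S \<tau> x)))\<^sup>2)) \<le> \<beta> * sqrt (t * (C1 * graph_norm T x)\<^sup>2)"
        using pos by (intro mult_left_mono) auto
      moreover have "graph_norm T (conv (\<lambda>\<tau>. B (F (S \<tau> x))) t)
          \<le> \<beta> * sqrt (integral {0..t} (\<lambda>\<tau>. (norm (F (S \<tau> x)))\<^sup>2))"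
        by (intro input_bound S_L2 x) (use t in auto)
      ultimately show ?thesis by linarith
    qed
    finally show ?thesis by (simp add: graph_norm_nonneg)
  qed
  then show "eventually (\<lambda>t. norm (graph_norm T (S t x - x)) \<le> ?g t) (at_right 0)"
    using pos by (auto simp: eventually_at_right_field intro!: exI[of _ a])
  have "(?g \<longlongrightarrow> sqrt ((norm (x - x))\<^sup>2 + (norm (gen x - gen x))\<^sup>2)
      + \<beta> * sqrt (0 * (C1 * graph_norm T x)\<^sup>2)) (at_right 0)"
    by (intro tendsto_intros right_continuous)
  then show "(?g \<longlongrightarrow> 0) (at_right 0)" by simp
qed

text \<open>Factoring out \<open>S\<close> at the earlier time leaves
  \<open>S (r - s) x - x\<close>, which is small in the graph norm. With a continuous output, all
  later integrals have continuous integrands.\<close>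

lemma continuous_on_F_S:
  assumes x: "x \<in> \<D>"
  shows "continuous_on {0..a} (\<lambda>t. F (S t x))"
  unfolding continuous_on_iff
proof (intro ballI allI impI)
  fix t e :: real assume t: "t \<in> {0..a}" and e: "e > 0"
  have "e / C1 > 0" using e C1 by simp
  from order_tendstoD(2)[OF graph_norm_S_minus_id_tendsto[OF x] this]
  obtain b where b: "b > 0" "\<And>s. 0 < s \<Longrightarrow> s < b \<Longrightarrow> graph_norm T (S s x - x) < e / C1"
    by (auto simp: eventually_at_right_field)
  have step: "dist (F (S r x)) (F (S s x)) < e" if "0 \<le> s" "s < r" "r \<le> a" "r < s + b" for r s
  proof -
    have z: "S (r - s) x - x \<in> \<D>" using that by (intro dom_diff S_dom x) auto
    have "F (S r x) - F (S s x) = F (S s (S (r - s) x - x))"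
      using S.semigroup[of s "r - s" x] that F_diff[OF S_dom[OF x] S_dom[OF x], of r s]
      by (simp add: S.T_diff)
    also have "norm \<dots> \<le> C1 * graph_norm T (S (r - s) x - x)"
      by (rule norm_F_S[OF z]) (use that in auto)
    also have "\<dots> < C1 * (e / C1)"
      by (rule mult_strict_left_mono[OF b(2)]) (use that C1 in auto)
    also have "C1 * (e / C1) = e"
      using C1(2) by (metis less_irrefl nonzero_mult_div_cancel_left times_divide_eq_right)
    finally show ?thesis by (simp add: dist_norm)
  qed
  show "\<exists>d>0. \<forall>s\<in>{0..a}. dist s t < d \<longrightarrow> dist (F (S s x)) (F (S t x)) < e"
  proof (intro exI[of _ b] conjI ballI impI)
    fix s assume s: "s \<in> {0..a}" "dist s t < b"
    show "dist (F (S s x)) (F (S t x)) < e"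
      using step[of t s] step[of s t] s t e
      by (cases s t rule: linorder_cases) (auto simp: dist_commute dist_real_def)
  qed (use b in auto)
qed

lemma averaged_feedback:
  assumes h: "0 < h" "h \<le> a"
  obtains G where "bounded_linear G"
    "\<And>x. x \<in> \<D> \<Longrightarrow> G x = integral {0..h} (\<lambda>s. F (S s x)) /\<^sub>R h"
proof -
  have cont: "continuous_on {0..h} (\<lambda>s. F (S s x))" if "x \<in> \<D>" for x
    by (rule continuous_on_subset[OF continuous_on_F_S[OF that]]) (use h in auto)
  note int = integrable_continuous_complete[OF cont]
  have "\<exists>G. bounded_linear G \<and> (\<forall>x\<in>\<D>. G x = integral {0..h} (\<lambda>s. F (S s x)) /\<^sub>R h)"
  proof (rule bounded_linear_extension)
    fix x y assume xy: "x \<in> \<D>" "y \<in> \<D>"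
    have "integral {0..h} (\<lambda>s. F (S s (x + y))) = integral {0..h} (\<lambda>s. F (S s x) + F (S s y))"
      by (rule integral_cong) (use xy in \<open>auto simp: S.T_add F_add S_dom\<close>)
    then show "integral {0..h} (\<lambda>s. F (S s (x + y))) /\<^sub>R h
        = integral {0..h} (\<lambda>s. F (S s x)) /\<^sub>R h + integral {0..h} (\<lambda>s. F (S s y)) /\<^sub>R h"
      by (simp add: integral_add int xy scaleR_add_right)
  next
    fix r :: real and x assume x: "x \<in> \<D>"
    have "integral {0..h} (\<lambda>s. F (S s (r *\<^sub>R x))) = integral {0..h} (\<lambda>s. r *\<^sub>R F (S s x))"
      by (rule integral_cong) (use x in \<open>auto simp: S.T_scaleR F_scaleR S_dom\<close>)
    then show "integral {0..h} (\<lambda>s. F (S s (r *\<^sub>R x))) /\<^sub>R h = r *\<^sub>R (integral {0..h} (\<lambda>s. F (S s x)) /\<^sub>R h)"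
      by simp
  next
    fix x assume x: "x \<in> \<D>"
    have "norm (integral {0..h} (\<lambda>s. F (S s x))) \<le> integral {0..h} (\<lambda>s. norm (F (S s x)))"
      by (intro integral_norm_bound_integral_complete int x integrable_continuous_real continuous_on_norm cont) simp
    also have "\<dots> \<le> sqrt h * (2 * \<alpha> * norm x)"
      by (intro integral_le_sqrt_integral_power2 continuous_on_norm cont integral_output_S x)
        (use h pos in auto)
    \<comment> \<open>The operator bound obtained here is \<open>2 * \<alpha>\<close> divided by
      \<open>sqrt h\<close>; it serves only to extend the average to all of X.\<close>
    finally have "norm (integral {0..h} (\<lambda>s. F (S s x)) /\<^sub>R h) \<le> inverse h * (sqrt h * (2 * \<alpha> * norm x))"
      using h by (simp add: divide_right_mono divide_inverse_commute)
    then show "norm (integral {0..h} (\<lambda>s. F (S s x)) /\<^sub>R h) \<le> norm x * (inverse h * (sqrt h * (2 * \<alpha>)))"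
      by (simp add: mult_ac)
  qed
  then show ?thesis using that by blast
qed

end

section \<open>Approximation by averaged feedback\<close>

text \<open>Half of \<open>{0..a}\<close> is reserved for the averaging parameter, so
  \<open>t + s\<close> stays in the interval for \<open>t\<close> up to \<open>a / 2\<close> and
  \<open>s\<close> up to \<open>h\<close>.\<close>

locale averaged_feedback = pritchard_salamon_feedback T S B F a \<alpha> \<beta> K M
  for T S :: "real \<Rightarrow> 'x::{real_inner, complete_space} \<Rightarrow> 'x"
    and B :: "'u::{real_inner, complete_space} \<Rightarrow> 'x" and F :: "'x \<Rightarrow> 'u" and a \<alpha> \<beta> K M :: real +
  fixes h :: real and G :: "'x \<Rightarrow> 'u"
  assumes h: "0 < h" "h \<le> a / 2"
    and bounded_linear_G: "bounded_linear G"
    and G_eq: "x \<in> \<D> \<Longrightarrow> G x = integral {0..h} (\<lambda>s. F (S s x)) /\<^sub>R h"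
begin

interpretation B: bounded_linear B by (rule bounded_linear_B)
interpretation G: bounded_linear G by (rule bounded_linear_G)

sublocale P: bounded_perturbation T "\<lambda>x. B (G x)"
  by (intro_locales, rule bounded_perturbation_axioms.intro)
    (rule bounded_linear_compose[OF bounded_linear_B bounded_linear_G])

text \<open>A mean of values that all satisfy the same bound; the constant is independent of
  \<open>h\<close>, and this makes the estimates for the perturbed loop uniform.\<close>

lemma norm_G_le:
  assumes x: "x \<in> \<D>"
  shows "norm (G x) \<le> C1 * graph_norm T x"
proof -
  have c: "continuous_on {0..h} (\<lambda>s. F (S s x))"
    by (rule continuous_on_subset[OF continuous_on_F_S[OF x]]) (use h in auto)
  have "norm (integral {0..h} (\<lambda>s. F (S s x))) \<le> integral {0..h} (\<lambda>s. C1 * graph_norm T x)"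
    by (intro integral_norm_bound_integral_complete integrable_continuous_complete c
        continuous_on_const norm_F_S x) (use h pos in auto)
  also have "\<dots> = h * (C1 * graph_norm T x)" using h by simp
  finally show ?thesis using h by (simp add: G_eq x field_simps)
qed

text \<open>
  Since \<open>S t x - T t x\<close> is the convolution of \<open>T\<close> with \<open>\<tau> \<mapsto> B (F (S \<tau> x))\<close>, the Volterra equation below
  says that \<open>V\<close> is the response of the perturbed system to the input \<open>\<tau> \<mapsto> F (S \<tau> x)\<close>.
\<close>

context
  fixes x V
  assumes x: "x \<in> \<D>"
    and cont_V: "continuous_on {0..} V"
    and V_eq: "\<And>t. 0 \<le> t \<Longrightarrow> V t = (S t x - T t x) + conv (\<lambda>\<tau>. B (G (V \<tau>))) t"
begin

text \<open>The total input that drives \<open>V\<close> in the unperturbed system: the external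
  signal plus the feedback of \<open>V\<close>.\<close>

definition w where "w \<tau> = F (S \<tau> x) + G (V \<tau>)"

abbreviation "N \<equiv> 2 * \<alpha> * norm x"

lemma continuous_on_V: "continuous_on {0..b} V"
  by (rule continuous_on_subset[OF cont_V]) auto

lemma continuous_on_w: "b \<le> a \<Longrightarrow> continuous_on {0..b} w"
  unfolding w_def[abs_def]
  by (intro continuous_intros G.continuous_on continuous_on_V continuous_on_subset[OF continuous_on_F_S[OF x]]) auto

lemma V_eq_conv:
  assumes t: "0 \<le> t" "t \<le> a"
  shows "V t = conv (\<lambda>\<tau>. B (w \<tau>)) t"
proof -
  have "continuous_on {0..t} (\<lambda>\<tau>. B (F (S \<tau> x)))" "continuous_on {0..t} (\<lambda>\<tau>. B (G (V \<tau>)))"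
    by (intro B.continuous_on G.continuous_on continuous_on_V continuous_on_subset[OF continuous_on_F_S[OF x]];
        use t in auto)+
  from conv_add[OF this] show ?thesis
    using V_eq[OF t(1)] S_eq[OF x t(1)] by (simp add: w_def B.add)
qed

lemma V_dom:
  assumes t: "0 \<le> t" "t \<le> a"
  shows "V t \<in> \<D>"
    and "graph_norm T (V t) \<le> \<beta> * sqrt (integral {0..t} (\<lambda>\<tau>. (norm (w \<tau>))\<^sup>2))"
  unfolding V_eq_conv[OF t]
  using input_dom[OF t L2_space_continuous] input_bound[OF t L2_space_continuous] continuous_on_w[OF t(2)]
  by auto

text \<open>Absorption again, now in the loop with \<open>G\<close>: admissibility bounds
  \<open>V\<close> in the graph norm by the L2 norm of \<open>w\<close>, and
  \<open>norm_G_le\<close> with \<open>small\<close> brings the feedback part \<open>Z\<close> down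
  to \<open>W / 4\<close>. The result is free of \<open>h\<close>.\<close>

lemma integral_w: "integral {0..a} (\<lambda>\<tau>. (norm (w \<tau>))\<^sup>2) \<le> (2 * N)\<^sup>2"
proof -
  define W where "W = integral {0..a} (\<lambda>\<tau>. (norm (w \<tau>))\<^sup>2)"
  define Z where "Z = integral {0..a} (\<lambda>\<tau>. (norm (G (V \<tau>)))\<^sup>2)"
  have iw: "(\<lambda>\<tau>. (norm (w \<tau>))\<^sup>2) integrable_on {0..s}" if "s \<le> a" for s
    by (intro integrable_continuous_real continuous_intros continuous_on_w that)
  have iz: "(\<lambda>\<tau>. (norm (G (V \<tau>)))\<^sup>2) integrable_on {0..a}"
    by (intro integrable_continuous_real continuous_intros G.continuous_on continuous_on_V)
  have iy: "(\<lambda>\<tau>. (norm (F (S \<tau> x)))\<^sup>2) integrable_on {0..a}"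
    by (intro integrable_continuous_real continuous_intros continuous_on_F_S x)
  have W0: "W \<ge> 0" unfolding W_def by (rule integral_nonneg) (use iw in auto)
  have "norm (G (V s)) \<le> C1 * \<beta> * sqrt W" if s: "0 \<le> s" "s \<le> a" for s
  proof -
    have "integral {0..s} (\<lambda>\<tau>. (norm (w \<tau>))\<^sup>2) \<le> W"
      unfolding W_def by (rule integral_subset_le) (use s iw in auto)
    then have "\<beta> * sqrt (integral {0..s} (\<lambda>\<tau>. (norm (w \<tau>))\<^sup>2)) \<le> \<beta> * sqrt W"
      using pos by (intro mult_left_mono real_sqrt_le_mono) auto
    then have "graph_norm T (V s) \<le> \<beta> * sqrt W" using V_dom(2)[OF s] by linarith
    from mult_left_mono[OF this, of C1] norm_G_le[OF V_dom(1)[OF s]] C1 show ?thesis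
      by (simp add: mult.assoc)
  qed
  then have "Z \<le> integral {0..a} (\<lambda>\<tau>. (C1 * \<beta> * sqrt W)\<^sup>2)"
    unfolding Z_def by (intro integral_le iz power_mono) auto
  also have "\<dots> = (C1 * \<beta>)\<^sup>2 * a * W" using pos W0 by (simp add: power_mult_distrib)
  also have "\<dots> \<le> W / 4" using mult_right_mono[OF small W0] by (simp add: mult.assoc)
  finally have ZW: "Z \<le> W / 4" .
  have "W \<le> integral {0..a} (\<lambda>\<tau>. 2 * (norm (F (S \<tau> x)))\<^sup>2 + 2 * (norm (G (V \<tau>)))\<^sup>2)"
    unfolding W_def
  proof (intro integral_le iw integrable_add integrable_on_mult_right iy iz)
    fix \<tau>
    have "(norm (w \<tau>))\<^sup>2 \<le> (norm (F (S \<tau> x)) + norm (G (V \<tau>)))\<^sup>2"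
      unfolding w_def by (intro power_mono norm_triangle_ineq) auto
    also have "\<dots> \<le> 2 * (norm (F (S \<tau> x)))\<^sup>2 + 2 * (norm (G (V \<tau>)))\<^sup>2"
      using sum_squares_bound[of "norm (F (S \<tau> x))" "norm (G (V \<tau>))"] by (simp add: power2_sum)
    finally show "(norm (w \<tau>))\<^sup>2 \<le> 2 * (norm (F (S \<tau> x)))\<^sup>2 + 2 * (norm (G (V \<tau>)))\<^sup>2" .
  qed simp
  also have "\<dots> = 2 * integral {0..a} (\<lambda>\<tau>. (norm (F (S \<tau> x)))\<^sup>2) + 2 * Z"
    unfolding Z_def using iy iz by (subst integral_add) auto
  also have "\<dots> \<le> 2 * N\<^sup>2 + 2 * Z"
    using integral_output_S[OF x, of a] pos by simp
  finally have "W \<le> 4 * N\<^sup>2" using ZW by linarith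
  then show ?thesis by (simp add: W_def power_mult_distrib)
qed

lemma graph_norm_V:
  assumes t: "0 \<le> t" "t \<le> a"
  shows "graph_norm T (V t) \<le> \<beta> * (2 * N)"
proof -
  have "integral {0..t} (\<lambda>\<tau>. (norm (w \<tau>))\<^sup>2) \<le> integral {0..a} (\<lambda>\<tau>. (norm (w \<tau>))\<^sup>2)"
    by (rule integral_subset_le)
      (use t in \<open>auto intro!: integrable_continuous_real continuous_intros continuous_on_w\<close>)
  then have "sqrt (integral {0..t} (\<lambda>\<tau>. (norm (w \<tau>))\<^sup>2)) \<le> sqrt ((2 * N)\<^sup>2)"
    using integral_w by (intro real_sqrt_le_mono) linarith
  also have "\<dots> = 2 * N" unfolding real_sqrt_abs using pos by simp
  finally have "\<beta> * sqrt (integral {0..t} (\<lambda>\<tau>. (norm (w \<tau>))\<^sup>2)) \<le> \<beta> * (2 * N)"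
    using pos by (intro mult_left_mono) auto
  then show ?thesis using V_dom(2)[OF t] by linarith
qed

text \<open>A bound in the norm of X only, where boundedness of \<open>B\<close> and Cauchy-Schwarz
  suffice; the gain is the factor \<open>sqrt s\<close>.\<close>

lemma norm_conv_w:
  assumes b: "b \<ge> 0" "\<And>u. norm (B u) \<le> b * norm u"
    and t: "0 \<le> t" "0 \<le> s" "t + s \<le> a"
  shows "norm (conv (\<lambda>\<tau>. B (w (t + \<tau>))) s) \<le> M * (sqrt s * (b * (2 * N)))"
proof (rule norm_conv_le_sqrt)
  have cw: "continuous_on {0..s} (\<lambda>\<tau>. w (t + \<tau>))"
    by (rule continuous_on_compose2[OF continuous_on_w[of a]])
      (use t in \<open>auto intro!: continuous_intros\<close>)
  show "continuous_on {0..s} (\<lambda>\<tau>. B (w (t + \<tau>)))" by (intro B.continuous_on cw)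
  have "integral {0..s} (\<lambda>\<tau>. (norm (B (w (t + \<tau>))))\<^sup>2) \<le> integral {0..s} (\<lambda>\<tau>. b\<^sup>2 * (norm (w (t + \<tau>)))\<^sup>2)"
  proof (intro integral_le integrable_continuous_real continuous_intros cw B.continuous_on)
    fix \<tau>
    have "(norm (B (w (t + \<tau>))))\<^sup>2 \<le> (b * norm (w (t + \<tau>)))\<^sup>2" by (intro power_mono b) auto
    then show "(norm (B (w (t + \<tau>))))\<^sup>2 \<le> b\<^sup>2 * (norm (w (t + \<tau>)))\<^sup>2" by (simp add: power_mult_distrib)
  qed
  also have "\<dots> = b\<^sup>2 * integral {t..t + s} (\<lambda>\<tau>. (norm (w \<tau>))\<^sup>2)"
    using integral_shift_real_ivl[of t t "t + s" "\<lambda>\<tau>. (norm (w \<tau>))\<^sup>2"] by (simp add: add.commute)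
  also have "integral {t..t + s} (\<lambda>\<tau>. (norm (w \<tau>))\<^sup>2) \<le> integral {0..a} (\<lambda>\<tau>. (norm (w \<tau>))\<^sup>2)"
    by (rule integral_subset_le)
      (use t in \<open>auto intro!: integrable_continuous_real continuous_intros continuous_on_subset[OF continuous_on_w[of a]]\<close>)
  also note integral_w
  finally show "integral {0..s} (\<lambda>\<tau>. (norm (B (w (t + \<tau>))))\<^sup>2) \<le> (b * (2 * N))\<^sup>2"
    by (simp add: power_mult_distrib mult_left_mono)
qed (use t pos b in \<open>auto intro!: T_bound\<close>)

text \<open>Both sides solve the Volterra equation with forcing \<open>f\<close>, the unperturbed
  response to the mismatch of the feedbacks along the orbit of \<open>S\<close>. For fixed
  \<open>s\<close>, \<open>e s\<close> is the perturbed response from state zero to the output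
  advanced by \<open>s\<close>; averaging over \<open>s\<close> turns that input into
  \<open>G (S \<tau> x)\<close>, and subtracting \<open>V\<close> leaves the mismatch.\<close>

lemma pert_minus_S:
  assumes t: "0 \<le> t" "t \<le> a / 2"
  shows "P.pert t x - S t x = integral {0..h} (\<lambda>s. V (t + s) - P.pert t (V s)) /\<^sub>R h - V t"
proof -
  define e where "e s t = V (t + s) - P.pert t (V s)" for s t
  define A where "A t = integral {0..h} (\<lambda>s. e s t)" for t
  define E where "E t = A t /\<^sub>R h - V t" for t
  define f where "f = conv (\<lambda>\<tau>. B (G (S \<tau> x)) - B (F (S \<tau> x)))"
  have cy: "continuous_on {0..t} (\<lambda>\<tau>. F (S \<tau> x))" if "t \<le> a" for t
    by (rule continuous_on_subset[OF continuous_on_F_S[OF x]]) (use that in auto)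
  have cS: "continuous_on {0..t} (\<lambda>\<tau>. S \<tau> x)" for t
    by (rule continuous_on_subset[OF S.continuous_orbit]) auto
  have ce: "continuous_on ({0..h} \<times> {0..a}) (\<lambda>p. e (fst p) (snd p))"
    unfolding e_def
    by (intro continuous_on_diff P.pert.continuous_on_apply)
      (auto intro!: continuous_intros continuous_on_compose2[OF cont_V])
  have ce1: "continuous_on {0..h} (\<lambda>s. e s t)" if "t \<in> {0..a}" for t
    by (rule continuous_on_compose2[OF ce, of _ "\<lambda>s. (s, t)", simplified])
      (use that in \<open>auto intro!: continuous_intros\<close>)
  have ce2: "continuous_on {0..b} (e s)" if "s \<in> {0..h}" "b \<le> a" for s b
    by (rule continuous_on_compose2[OF ce, of _ "\<lambda>t. (s, t)", simplified])
      (use that in \<open>auto intro!: continuous_intros\<close>)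
  have cA: "continuous_on {0..b} A" if "b \<le> a" for b
    unfolding A_def[abs_def]
    by (intro integral_continuous_on_param_complete, unfold case_prod_unfold,
        rule continuous_on_compose2[OF ce, of _ "\<lambda>p. (snd p, fst p)", simplified])
      (use that in \<open>auto intro!: continuous_intros\<close>)
  have cE: "continuous_on {0..b} E" if "b \<le> a" for b
    unfolding E_def[abs_def] by (intro continuous_intros cA continuous_on_V that)
  \<comment> \<open>\<open>V\<close> restarted at time \<open>s\<close> and the perturbed orbit of
    \<open>V s\<close> begin in the same state, so the free parts cancel.\<close>
  have e_eq: "e s t = conv (\<lambda>\<tau>. B (F (S (s + \<tau>) x)) + B (G (e s \<tau>))) t"
    if s: "s \<in> {0..h}" and t: "0 \<le> t" "t \<le> a / 2" for s t
  proof -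
    have st: "0 \<le> s" "0 \<le> t" "s + t \<le> a" using s t h by auto
    have "V (s + t) = conv (\<lambda>\<tau>. B (w \<tau>)) (s + t)" using st by (intro V_eq_conv) auto
    also have "\<dots> = T t (conv (\<lambda>\<tau>. B (w \<tau>)) s) + conv (\<lambda>\<tau>. B (w (s + \<tau>))) t"
      by (intro conv_shift B.continuous_on continuous_on_w st)
    also have "conv (\<lambda>\<tau>. B (w \<tau>)) s = V s" using st by (intro V_eq_conv[symmetric]) auto
    finally have "e s t = conv (\<lambda>\<tau>. B (w (s + \<tau>))) t - conv (\<lambda>\<tau>. B (G (P.pert \<tau> (V s)))) t"
      using P.pert_eq[of t "V s"] st by (simp add: e_def add.commute)
    also have "\<dots> = conv (\<lambda>\<tau>. B (w (s + \<tau>)) - B (G (P.pert \<tau> (V s)))) t"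
      by (intro conv_diff[symmetric] B.continuous_on G.continuous_on P.continuous_on_pert'
          continuous_on_compose2[OF continuous_on_w[of a]])
        (use st in \<open>auto intro!: continuous_intros\<close>)
    also have "\<dots> = conv (\<lambda>\<tau>. B (F (S (s + \<tau>) x)) + B (G (e s \<tau>))) t"
      by (rule conv_cong) (simp add: w_def e_def B.add B.diff G.diff add.commute)
    finally show ?thesis .
  qed
  have A_eq: "A t /\<^sub>R h = conv (\<lambda>\<tau>. B (G (S \<tau> x)) + B (G (A \<tau> /\<^sub>R h))) t"
    if t: "0 \<le> t" "t \<le> a / 2" for t
  proof -
    let ?g = "\<lambda>s \<tau>. B (F (S (s + \<tau>) x)) + B (G (e s \<tau>))"
    have cg: "continuous_on ({0..h} \<times> {0..t}) (\<lambda>p. ?g (fst p) (snd p))"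
      by (intro continuous_on_add B.continuous_on G.continuous_on
          continuous_on_compose2[OF continuous_on_F_S[OF x]] continuous_on_subset[OF ce])
        (use t h in \<open>auto intro!: continuous_intros\<close>)
    have "A t = integral {0..h} (\<lambda>s. integral {0..t} (\<lambda>\<tau>. T (t - \<tau>) (?g s \<tau>)))"
      unfolding A_def by (rule integral_cong) (use e_eq t in \<open>simp add: conv_def\<close>)
    also have "\<dots> = integral {0..t} (\<lambda>\<tau>. integral {0..h} (\<lambda>s. T (t - \<tau>) (?g s \<tau>)))"
      by (rule integral_swap_continuous_complete, unfold case_prod_unfold, rule continuous_on_apply)
        (use cg in \<open>auto intro!: continuous_intros\<close>)
    also have "\<dots> = conv (\<lambda>\<tau>. h *\<^sub>R (B (G (S \<tau> x)) + B (G (A \<tau> /\<^sub>R h)))) t"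
      unfolding conv_def
    proof (rule integral_cong)
      fix \<tau> assume \<tau>: "\<tau> \<in> {0..t}"
      have cg1: "continuous_on {0..h} (\<lambda>s. ?g s \<tau>)"
        by (rule continuous_on_compose2[OF cg, of _ "\<lambda>s. (s, \<tau>)", simplified])
          (use \<tau> in \<open>auto intro!: continuous_intros\<close>)
      have cy1: "continuous_on {0..h} (\<lambda>s. F (S (s + \<tau>) x))"
        by (rule continuous_on_compose2[OF continuous_on_F_S[OF x]])
          (use \<tau> t h in \<open>auto intro!: continuous_intros\<close>)
      have ce1': "continuous_on {0..h} (\<lambda>s. e s \<tau>)" using \<tau> t pos by (intro ce1) auto
      have "integral {0..h} (\<lambda>s. T (t - \<tau>) (?g s \<tau>)) = T (t - \<tau>) (integral {0..h} (\<lambda>s. ?g s \<tau>))"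
        using integral_linear[OF integrable_continuous_complete[OF cg1] bounded_linear, of "t - \<tau>"] \<tau>
        by (simp add: o_def)
      also have "integral {0..h} (\<lambda>s. ?g s \<tau>)
          = integral {0..h} (\<lambda>s. B (F (S (s + \<tau>) x))) + integral {0..h} (\<lambda>s. B (G (e s \<tau>)))"
        by (intro integral_add integrable_continuous_complete B.continuous_on G.continuous_on cy1 ce1')
      also have "integral {0..h} (\<lambda>s. B (F (S (s + \<tau>) x))) = B (integral {0..h} (\<lambda>s. F (S (s + \<tau>) x)))"
        using integral_linear[OF integrable_continuous_complete[OF cy1] bounded_linear_B] by (simp add: o_def)
      \<comment> \<open>This is the purpose of averaging along \<open>S\<close>: by its semigroup
        law the mean of the output from \<open>\<tau>\<close> to \<open>\<tau> + h\<close> is the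
        feedback \<open>G\<close> at the current state \<open>S \<tau> x\<close>.\<close>
      also have "integral {0..h} (\<lambda>s. F (S (s + \<tau>) x)) = h *\<^sub>R G (S \<tau> x)"
      proof -
        have "integral {0..h} (\<lambda>s. F (S (s + \<tau>) x)) = integral {0..h} (\<lambda>s. F (S s (S \<tau> x)))"
          by (rule integral_cong) (use \<tau> in \<open>simp add: S.semigroup\<close>)
        then show ?thesis using G_eq[OF S_dom[OF x], of \<tau>] \<tau> h by simp
      qed
      also have "integral {0..h} (\<lambda>s. B (G (e s \<tau>))) = B (G (A \<tau>))"
        using integral_linear[OF integrable_continuous_complete[OF ce1']
            bounded_linear_compose[OF bounded_linear_B bounded_linear_G]]
        by (simp add: o_def A_def)
      also have "B (h *\<^sub>R G (S \<tau> x)) + B (G (A \<tau>)) = h *\<^sub>R (B (G (S \<tau> x)) + B (G (A \<tau> /\<^sub>R h)))"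
        using h by (simp add: B.scaleR G.scaleR scaleR_add_right)
      finally show "integral {0..h} (\<lambda>s. T (t - \<tau>) (?g s \<tau>))
          = T (t - \<tau>) (h *\<^sub>R (B (G (S \<tau> x)) + B (G (A \<tau> /\<^sub>R h))))" .
    qed
    also have "\<dots> = h *\<^sub>R conv (\<lambda>\<tau>. B (G (S \<tau> x)) + B (G (A \<tau> /\<^sub>R h))) t"
      by (rule conv_bounded_linear)
        (use t pos in \<open>auto intro!: continuous_intros B.continuous_on G.continuous_on cS cA
          bounded_linear_scaleR_right simp: T_scaleR\<close>)
    finally show ?thesis using h by simp
  qed
  have "P.pert t x - S t x = E t"
  proof (rule P.volterra_unique[of "a / 2" "\<lambda>t. P.pert t x - S t x" E f])
    fix t assume t: "0 \<le> t" "t \<le> a / 2"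
    then have ta: "t \<le> a" using pos by simp
    note cs = B.continuous_on G.continuous_on P.continuous_on_pert' cS cy[OF ta] cA[OF ta] cE[OF ta]
      continuous_on_V continuous_on_diff continuous_on_add continuous_on_scaleR continuous_on_const
    have "P.pert t x - S t x = conv (\<lambda>\<tau>. B (G (P.pert \<tau> x))) t - conv (\<lambda>\<tau>. B (F (S \<tau> x))) t"
      using P.pert_eq[of t x] S_eq[OF x, of t] t by simp
    also have "\<dots> = conv (\<lambda>\<tau>. B (G (P.pert \<tau> x)) - B (F (S \<tau> x))) t"
      by (intro conv_diff[symmetric] cs)
    also have "\<dots> = conv (\<lambda>\<tau>. (B (G (S \<tau> x)) - B (F (S \<tau> x))) + B (G (P.pert \<tau> x - S \<tau> x))) t"
      by (simp add: G.diff B.diff)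
    also have "\<dots> = f t + conv (\<lambda>\<tau>. B (G (P.pert \<tau> x - S \<tau> x))) t"
      unfolding f_def by (intro conv_add cs)
    finally show "P.pert t x - S t x = f t + conv (\<lambda>\<tau>. B (G (P.pert \<tau> x - S \<tau> x))) t" .
    have "E t = conv (\<lambda>\<tau>. B (G (S \<tau> x)) + B (G (A \<tau> /\<^sub>R h))) t - conv (\<lambda>\<tau>. B (w \<tau>)) t"
      unfolding E_def A_eq[OF t] using V_eq_conv[OF t(1) ta] by simp
    also have "\<dots> = conv (\<lambda>\<tau>. B (G (S \<tau> x)) + B (G (A \<tau> /\<^sub>R h)) - B (w \<tau>)) t"
      by (intro conv_diff[symmetric] cs continuous_on_w ta)
    also have "\<dots> = conv (\<lambda>\<tau>. (B (G (S \<tau> x)) - B (F (S \<tau> x))) + B (G (E \<tau>))) t"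
      by (simp add: w_def E_def G.diff B.diff B.add algebra_simps)
    also have "\<dots> = f t + conv (\<lambda>\<tau>. B (G (E \<tau>))) t"
      unfolding f_def by (intro conv_add cs)
    finally show "E t = f t + conv (\<lambda>\<tau>. B (G (E \<tau>))) t" .
  qed (use t pos in \<open>auto intro!: continuous_intros P.continuous_on_pert' cS cE\<close>)
  then show ?thesis by (simp add: E_def A_def e_def)
qed

text \<open>Restarting \<open>V\<close> at time \<open>t\<close> splits the integrand into
  \<open>T s (V t) - V t\<close>, the response to the input on the last stretch of length
  \<open>s\<close>, and the correction \<open>P.pert t (V s)\<close>. The first is of order
  \<open>s\<close> by the graph norm bound on \<open>V t\<close>, the others of order
  \<open>sqrt s\<close>. The bound \<open>c\<close> of \<open>P.pert t\<close> stays a parameter,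
  since its dependence on \<open>h\<close> is not yet under control.\<close>

lemma norm_pert_minus_S_aux:
  assumes t: "0 \<le> t" "t \<le> a / 2"
    and b: "b \<ge> 0" "\<And>u. norm (B u) \<le> b * norm u"
    and c: "c \<ge> 0" "\<And>z. norm (P.pert t z) \<le> c * norm z"
  shows "norm (P.pert t x - S t x) \<le> sqrt h * (4 * \<alpha> * M * (b + \<beta>) * (1 + c)) * norm x"
proof -
  have N0: "0 \<le> 2 * N" using pos by simp
  have le: "norm (V (t + s) - P.pert t (V s) - V t) \<le> sqrt h * (M * (b + \<beta>) * (1 + c) * (2 * N))"
    if s: "s \<in> {0..h}" for s
  proof -
    have st: "0 \<le> s" "0 \<le> t" "t + s \<le> a" "s \<le> a" "t \<le> a" using s t h pos by auto
    have sq: "s \<le> sqrt h" "sqrt s \<le> sqrt h"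
    proof -
      show "sqrt s \<le> sqrt h" using s by simp
      \<comment> \<open>Here \<open>a \<le> 1\<close> enters: it weakens the order \<open>s\<close>
        of the first term to the common order \<open>sqrt h\<close>.\<close>
      have "s * s \<le> 1 * s" using st pos by (intro mult_right_mono) auto
      then have "s \<le> sqrt s" using st by (intro real_le_rsqrt) (simp add: power2_eq_square)
      with \<open>sqrt s \<le> sqrt h\<close> show "s \<le> sqrt h" by linarith
    qed
    have "V (t + s) = conv (\<lambda>\<tau>. B (w \<tau>)) (t + s)" using st by (intro V_eq_conv) auto
    also have "\<dots> = T s (conv (\<lambda>\<tau>. B (w \<tau>)) t) + conv (\<lambda>\<tau>. B (w (t + \<tau>))) s"
      by (intro conv_shift B.continuous_on continuous_on_w st)
    also have "conv (\<lambda>\<tau>. B (w \<tau>)) t = V t" using st by (intro V_eq_conv[symmetric]) auto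
    finally have eq: "V (t + s) - P.pert t (V s) - V t
        = (T s (V t) - V t) + conv (\<lambda>\<tau>. B (w (t + \<tau>))) s - P.pert t (V s)"
      by simp
    have 1: "norm (T s (V t) - V t) \<le> M * sqrt h * (\<beta> * (2 * N))"
    proof (rule order_trans)
      show "norm (T s (V t) - V t) \<le> M * s * norm (gen (V t))"
        by (rule norm_T_minus_id_le[OF V_dom(1)[OF st(2,5)] st(1)]) (use st pos in \<open>auto intro!: T_bound\<close>)
      show "M * s * norm (gen (V t)) \<le> M * sqrt h * (\<beta> * (2 * N))"
        using order_trans[OF norm_gen_le_graph_norm graph_norm_V[OF st(2,5)]] sq pos st
        by (intro mult_mono mult_left_mono) auto
    qed
    have sh: "M * (sqrt s * (b * (2 * N))) \<le> M * (sqrt h * (b * (2 * N)))"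
      using sq pos b N0 by (intro mult_left_mono mult_right_mono) auto
    have 2: "norm (conv (\<lambda>\<tau>. B (w (t + \<tau>))) s) \<le> M * (sqrt h * (b * (2 * N)))"
      by (rule order_trans[OF norm_conv_w[OF b st(2,1,3)] sh])
    have 3: "norm (P.pert t (V s)) \<le> c * (M * (sqrt h * (b * (2 * N))))"
    proof (rule order_trans[OF c(2)], rule mult_left_mono[OF _ c(1)])
      have "V s = conv (\<lambda>\<tau>. B (w (0 + \<tau>))) s" using V_eq_conv[of s] st by simp
      moreover have "norm (conv (\<lambda>\<tau>. B (w (0 + \<tau>))) s) \<le> M * (sqrt s * (b * (2 * N)))"
        by (rule norm_conv_w[OF b]) (use st in auto)
      ultimately have "norm (V s) \<le> M * (sqrt s * (b * (2 * N)))" by (simp only:)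
      then show "norm (V s) \<le> M * (sqrt h * (b * (2 * N)))" by (rule order_trans[OF _ sh])
    qed
    have "norm (V (t + s) - P.pert t (V s) - V t)
        \<le> norm (T s (V t) - V t) + norm (conv (\<lambda>\<tau>. B (w (t + \<tau>))) s) + norm (P.pert t (V s))"
      unfolding eq by (rule order_trans[OF norm_triangle_ineq4 add_right_mono[OF norm_triangle_ineq]])
    then have "norm (V (t + s) - P.pert t (V s) - V t)
        \<le> M * sqrt h * (\<beta> * (2 * N)) + M * (sqrt h * (b * (2 * N))) + c * (M * (sqrt h * (b * (2 * N))))"
      using 1 2 3 by linarith
    moreover have "M * sqrt h * (\<beta> * (2 * N)) + M * (sqrt h * (b * (2 * N))) + c * (M * (sqrt h * (b * (2 * N))))
        = sqrt h * (M * (b + \<beta> + c * b) * (2 * N))" by (simp add: algebra_simps)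
    moreover have "sqrt h * (M * (b + \<beta> + c * b) * (2 * N)) \<le> sqrt h * (M * (b + \<beta>) * (1 + c) * (2 * N))"
    proof -
      have "b + \<beta> + c * b \<le> (b + \<beta>) * (1 + c)" using c pos by (simp add: algebra_simps)
      then have "M * (b + \<beta> + c * b) \<le> M * ((b + \<beta>) * (1 + c))" using pos by (intro mult_left_mono) auto
      then show ?thesis using N0 h by (intro mult_left_mono mult_right_mono) (auto simp: mult.assoc)
    qed
    ultimately show ?thesis by linarith
  qed
  have cont: "continuous_on {0..h} (\<lambda>s. V (t + s) - P.pert t (V s))"
    by (intro continuous_on_diff bounded_linear.continuous_on[OF P.bounded_linear_pert[OF t(1)]]
        continuous_on_V continuous_on_compose2[OF cont_V])
      (use t in \<open>auto intro!: continuous_intros\<close>)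
  have "integral {0..h} (\<lambda>s. V (t + s) - P.pert t (V s) - V t)
      = integral {0..h} (\<lambda>s. V (t + s) - P.pert t (V s)) - h *\<^sub>R V t"
    using h integrable_continuous_complete[OF cont] by (subst integral_diff) auto
  then have "P.pert t x - S t x = integral {0..h} (\<lambda>s. V (t + s) - P.pert t (V s) - V t) /\<^sub>R h"
    unfolding pert_minus_S[OF t] using h by (simp add: scaleR_diff_right)
  also have "norm \<dots> = norm (integral {0..h} (\<lambda>s. V (t + s) - P.pert t (V s) - V t)) / h"
    using h by (subst norm_scaleR) (simp add: field_simps)
  also have "norm (integral {0..h} (\<lambda>s. V (t + s) - P.pert t (V s) - V t))
      \<le> integral {0..h} (\<lambda>s. sqrt h * (M * (b + \<beta>) * (1 + c) * (2 * N)))"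
    by (intro integral_norm_bound_integral_complete integrable_continuous_complete
        continuous_on_diff[OF cont] continuous_on_const le)
  also have "\<dots> = h * (sqrt h * (M * (b + \<beta>) * (1 + c) * (2 * N)))" using h by simp
  also have "\<dots> / h = sqrt h * (M * (b + \<beta>) * (1 + c) * (2 * N))" using h by simp
  finally show ?thesis using h by (simp add: divide_right_mono mult_ac)
qed

end

lemma norm_pert_minus_S:
  assumes t: "0 \<le> t" "t \<le> a / 2"
    and b: "b \<ge> 0" "\<And>u. norm (B u) \<le> b * norm u"
    and c: "c \<ge> 0" "\<And>z. norm (P.pert t z) \<le> c * norm z"
  shows "norm (P.pert t x - S t x) \<le> sqrt h * (4 * \<alpha> * M * (b + \<beta>) * (1 + c)) * norm x"
proof (rule norm_le_on_dom_imp_norm_le)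
  show "bounded_linear (\<lambda>x. P.pert t x - S t x)"
    by (intro bounded_linear_sub P.bounded_linear_pert S.bounded_linear t)
  fix x assume x: "x \<in> \<D>"
  have "continuous_on {0..} (\<lambda>t. S t x - T t x)"
    by (intro continuous_intros S.continuous_orbit continuous_orbit)
  from P.volterra_exists[OF this] obtain V where V: "continuous_on {0..} V"
    "\<And>t. 0 \<le> t \<Longrightarrow> V t = (S t x - T t x) + conv (\<lambda>\<tau>. B (G (V \<tau>))) t" by blast
  show "norm (P.pert t x - S t x) \<le> sqrt h * (4 * \<alpha> * M * (b + \<beta>) * (1 + c)) * norm x"
    by (rule norm_pert_minus_S_aux[OF x V t b c])
qed

text \<open>Meant for multiplication by one scalar of the base field on X and on U: \<open>G\<close>
  arose as a real-linear extension, and this recovers linearity over that field.\<close>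

lemma G_commute:
  assumes \<sigma>: "bounded_linear \<sigma>" "bounded_linear \<rho>"
    and comm: "\<And>t x. t \<ge> 0 \<Longrightarrow> T t (\<sigma> x) = \<sigma> (T t x)" "\<And>t x. t \<ge> 0 \<Longrightarrow> S t (\<sigma> x) = \<sigma> (S t x)"
    and F: "\<And>x. x \<in> \<D> \<Longrightarrow> F (\<sigma> x) = \<rho> (F x)"
  shows "G (\<sigma> x) = \<rho> (G x)"
proof (rule eq_on_dom_imp_eq)
  fix x assume x: "x \<in> \<D>"
  have "\<sigma> x \<in> \<D>" by (rule dom_bounded_linear(1)[OF x \<sigma>(1)]) (simp add: comm)
  then have "G (\<sigma> x) = integral {0..h} (\<lambda>s. F (S s (\<sigma> x))) /\<^sub>R h" by (rule G_eq)
  also have "integral {0..h} (\<lambda>s. F (S s (\<sigma> x))) = integral {0..h} (\<rho> \<circ> (\<lambda>s. F (S s x)))"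
    by (rule integral_cong) (use x in \<open>simp add: comm F S_dom\<close>)
  also have "\<dots> = \<rho> (integral {0..h} (\<lambda>s. F (S s x)))"
    by (intro integral_linear \<sigma> integrable_continuous_complete
        continuous_on_subset[OF continuous_on_F_S[OF x]]) (use h pos in auto)
  finally show "G (\<sigma> x) = \<rho> (G x)"
    by (simp add: G_eq[OF x] linear_scale[OF bounded_linear.linear[OF \<sigma>(2)]])
qed (intro bounded_linear_compose[OF bounded_linear_G \<sigma>(1)] bounded_linear_compose[OF \<sigma>(2) bounded_linear_G])+

end

section \<open>Exponential stability\<close>

text \<open>Telescoping by P^(n+1) - Q^(n+1) = P (P^n - Q^n) + (P - Q) Q^n. Since \<open>L\<close>
  is at least 1, the power \<open>L ^ n\<close> may stand for the sharper exponent n - 1.\<close>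

lemma norm_funpow_diff_le:
  fixes P Q :: "'a::real_normed_vector \<Rightarrow> 'a"
  assumes P: "linear P" "\<And>x. norm (P x) \<le> L * norm x"
    and Q: "\<And>x. norm (Q x) \<le> L * norm x"
    and PQ: "\<And>x. norm (P x - Q x) \<le> e * norm x" and L: "L \<ge> 1" and e: "e \<ge> 0"
  shows "norm ((P ^^ n) x - (Q ^^ n) x) \<le> real n * e * L ^ n * norm x"
proof (induction n)
  case 0
  then show ?case by simp
next
  case (Suc n)
  have Qn: "norm ((Q ^^ n) x) \<le> L ^ n * norm x"
  proof (induction n)
    case (Suc n)
    then show ?case
      using order_trans[OF Q[of "(Q ^^ n) x"] mult_left_mono[OF Suc, of L]] L by (simp add: mult.assoc)
  qed simp
  have "(P ^^ Suc n) x - (Q ^^ Suc n) x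
      = P ((P ^^ n) x - (Q ^^ n) x) + (P ((Q ^^ n) x) - Q ((Q ^^ n) x))"
    using P(1) by (simp add: linear_diff)
  also have "norm \<dots> \<le> L * (real n * e * L ^ n * norm x) + e * (L ^ n * norm x)"
  proof (rule norm_triangle_mono)
    show "norm (P ((P ^^ n) x - (Q ^^ n) x)) \<le> L * (real n * e * L ^ n * norm x)"
      by (rule order_trans[OF P(2)], rule mult_left_mono[OF Suc.IH]) (use L in simp)
    show "norm (P ((Q ^^ n) x) - Q ((Q ^^ n) x)) \<le> e * (L ^ n * norm x)"
      by (rule order_trans[OF PQ], rule mult_left_mono[OF Qn e])
  qed
  also have "e * (L ^ n * norm x) \<le> e * (L ^ Suc n * norm x)"
    using L e by (intro mult_left_mono mult_right_mono power_increasing) auto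
  also have "L * (real n * e * L ^ n * norm x) + e * (L ^ Suc n * norm x)
      = real (Suc n) * e * L ^ Suc n * norm x" by (simp add: algebra_simps)
  finally show ?case by simp
qed

context strongly_continuous
begin

lemma funpow_T:
  assumes "t \<ge> 0"
  shows "(T t ^^ n) x = T (real n * t) x"
proof (induction n)
  case (Suc n)
  then show ?case using semigroup[of t "real n * t" x] assms by (simp add: algebra_simps)
qed simp

text \<open>Write t = n t0 + r with \<open>r\<close> in \<open>{0..t0}\<close>: powers of
  \<open>T t0\<close> supply the decay over n t0, \<open>M0\<close> covers the remainder, and
  \<open>exp (\<omega> * t0)\<close> makes up for the decay not gained on it.\<close>

lemma exponential_bound:
  assumes t0: "t0 > 0" and \<omega>: "\<omega> > 0"
    and le: "\<And>x. norm (T t0 x) \<le> exp (- \<omega> * t0) * norm x"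
  obtains M where "M \<ge> 1" "\<And>t. t \<ge> 0 \<Longrightarrow> onorm (T t) \<le> M * exp (- \<omega> * t)"
proof -
  obtain M0 where M0: "M0 \<ge> 1" "\<And>s x. 0 \<le> s \<Longrightarrow> s \<le> t0 \<Longrightarrow> norm (T s x) \<le> M0 * norm x"
    by (rule boundedE[of t0]) blast
  show ?thesis
  proof (rule that[of "M0 * exp (\<omega> * t0)"])
    have "1 * 1 \<le> M0 * exp (\<omega> * t0)" using M0 \<omega> t0 by (intro mult_mono) auto
    then show "1 \<le> M0 * exp (\<omega> * t0)" by simp
    fix t :: real assume t: "t \<ge> 0"
    define n where "n = nat \<lfloor>t / t0\<rfloor>"
    define r where "r = t - real n * t0"
    have fl: "real n = of_int \<lfloor>t / t0\<rfloor>" using t t0 by (simp add: n_def)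
    have "real n \<le> t / t0" "t / t0 < real n + 1" unfolding fl by linarith+
    then have r: "0 \<le> r" "r \<le> t0" using t0 by (auto simp: r_def field_simps)
    have pow: "norm ((T t0 ^^ m) x) \<le> exp (- \<omega> * t0) ^ m * norm x" for m x
    proof (induction m)
      case (Suc m)
      have "norm ((T t0 ^^ Suc m) x) \<le> exp (- \<omega> * t0) * norm ((T t0 ^^ m) x)"
        using le by simp
      also have "\<dots> \<le> exp (- \<omega> * t0) * (exp (- \<omega> * t0) ^ m * norm x)"
        by (rule mult_left_mono[OF Suc]) simp
      finally show ?case by (simp add: mult.assoc)
    qed simp
    have "norm (T t x) \<le> M0 * exp (\<omega> * t0) * exp (- \<omega> * t) * norm x" for x
    proof -
      have "T t x = T r (T (real n * t0) x)"
        using semigroup[of r "real n * t0" x] r t0 by (simp add: r_def)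
      also have "norm \<dots> \<le> M0 * norm (T (real n * t0) x)" by (rule M0(2)[OF r])
      also have "norm (T (real n * t0) x) \<le> exp (- \<omega> * t0) ^ n * norm x"
        using pow[of n x] t0 by (simp add: funpow_T)
      also have "exp (- \<omega> * t0) ^ n = exp (\<omega> * r) * exp (- \<omega> * t)"
        by (simp add: r_def algebra_simps flip: exp_of_nat_mult exp_add)
      also have "exp (\<omega> * r) \<le> exp (\<omega> * t0)" using r \<omega> by simp
      finally show ?thesis using M0 by (simp add: mult_left_mono mult_right_mono mult.assoc)
    qed
    then show "onorm (T t) \<le> M0 * exp (\<omega> * t0) * exp (- \<omega> * t)"
      by (intro onorm_bound) (use M0 in auto)
  qed
qed

end

section \<open>Choice of the averaging length and transfer of stability\<close>

context pritchard_salamon_feedback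
begin

lemma averaged_feedback_approximation:
  assumes \<epsilon>: "\<epsilon> > 0"
  obtains h G where "averaged_feedback T S B F a \<alpha> \<beta> K M h G"
    "\<And>t x. 0 \<le> t \<Longrightarrow> t \<le> a / 2 \<Longrightarrow>
      norm (bounded_perturbation.pert T (\<lambda>x. B (G x)) t x - S t x) \<le> \<epsilon> * norm x"
proof -
  obtain b where b: "b > 0" "\<And>u. norm (B u) \<le> b * norm u"
    using bounded_linear.pos_bounded[OF bounded_linear_B] by (auto simp: mult.commute)
  obtain R where R: "R \<ge> 1" "\<And>t x. 0 \<le> t \<Longrightarrow> t \<le> a \<Longrightarrow> norm (S t x) \<le> R * norm x"
    by (rule S.boundedE[of a]) blast
  define k where "k = 4 * \<alpha> * M * (b + \<beta>)"
  have k: "k > 0" using pos b by (simp add: k_def)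
  \<comment> \<open>With \<open>sqrt h\<close> at most \<open>q\<close>, the first entry allows the
    norm of the perturbed semigroup to be absorbed, and the second then brings the error below
    \<open>\<epsilon>\<close>.\<close>
  define q where "q = min (1 / (2 * k)) (\<epsilon> / (k * (2 * R + 2)))"
  have q: "q > 0" using k \<epsilon> R by (simp add: q_def)
  define h where "h = min (a / 2) (q\<^sup>2)"
  have h: "0 < h" "h \<le> a / 2" using q pos by (auto simp: h_def)
  have "sqrt h \<le> sqrt (q\<^sup>2)" by (intro real_sqrt_le_mono) (simp add: h_def)
  then have "sqrt h \<le> q" using q by simp
  then have "sqrt h \<le> 1 / (2 * k)" "sqrt h \<le> \<epsilon> / (k * (2 * R + 2))" by (auto simp: q_def)
  moreover have "k * (2 * R + 2) > 0" using k R by simp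
  ultimately have hk: "sqrt h * k \<le> 1 / 2" "sqrt h * k * (2 * R + 2) \<le> \<epsilon>"
    using k by (simp_all add: pos_le_divide_eq mult_ac)
  obtain G where G: "bounded_linear G" "\<And>x. x \<in> \<D> \<Longrightarrow> G x = integral {0..h} (\<lambda>s. F (S s x)) /\<^sub>R h"
    using averaged_feedback[of h] h pos by auto
  interpret A: averaged_feedback T S B F a \<alpha> \<beta> K M h G
    by (intro averaged_feedback.intro averaged_feedback_axioms.intro pritchard_salamon_feedback_axioms h G)
  show ?thesis
  proof (rule that[OF A.averaged_feedback_axioms])
    fix t x assume t: "0 \<le> t" "t \<le> a / 2"
    define c where "c = onorm (A.P.pert t)"
    have bl: "bounded_linear (A.P.pert t)" by (rule A.P.bounded_linear_pert[OF t(1)])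
    have c0: "c \<ge> 0" unfolding c_def by (rule onorm_pos_le[OF bl])
    have c: "norm (A.P.pert t z) \<le> c * norm z" for z
      unfolding c_def by (rule onorm[OF bl])
    have diff: "norm (A.P.pert t z - S t z) \<le> sqrt h * k * (1 + c) * norm z" for z
      using A.norm_pert_minus_S[OF t less_imp_le[OF b(1)] b(2) c0 c, of z] by (simp add: k_def mult.assoc)
    have half: "sqrt h * k * (1 + c) \<le> 1 / 2 * (1 + c)" using hk(1) c0 by (intro mult_right_mono) auto
    have "norm (A.P.pert t z) \<le> (R + 1 / 2 * (1 + c)) * norm z" for z
    proof -
      have "norm (A.P.pert t z) \<le> norm (S t z) + norm (A.P.pert t z - S t z)"
        using norm_triangle_ineq[of "S t z" "A.P.pert t z - S t z"] by simp
      also have "\<dots> \<le> R * norm z + 1 / 2 * (1 + c) * norm z"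
        using order_trans[OF diff mult_right_mono[OF half norm_ge_zero]] t pos
        by (intro add_mono R) auto
      finally show ?thesis by (simp add: distrib_right)
    qed
    \<comment> \<open>The operator norm \<open>c\<close> satisfies a bound in terms of itself with
      factor 1/2, which leaves \<open>1 + c\<close> at most \<open>2 * R + 2\<close>, independently
      of \<open>h\<close>.\<close>
    then have "c \<le> R + 1 / 2 * (1 + c)" unfolding c_def
      by (intro onorm_bound) (use R c0 in \<open>auto simp: c_def\<close>)
    then have "1 + c \<le> 2 * R + 2" by (simp add: field_simps)
    then have "sqrt h * k * (1 + c) \<le> sqrt h * k * (2 * R + 2)"
      using k h by (intro mult_left_mono) auto
    then have "sqrt h * k * (1 + c) \<le> \<epsilon>" using hk by linarith
    from order_trans[OF diff mult_right_mono[OF this norm_ge_zero]]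
    show "norm (A.P.pert t x - S t x) \<le> \<epsilon> * norm x" .
  qed
qed

text \<open>Comparison with \<open>S\<close> is available only up to \<open>a / 2\<close>, so a
  large time is reached in \<open>n\<close> steps of length \<open>d\<close>. The number
  \<open>n\<close> depends on \<open>R\<close>, \<open>d\<close> and no averaging parameter;
  \<open>\<epsilon>\<close> is then adapted to \<open>n\<close>, and \<open>h\<close> to
  \<open>\<epsilon>\<close>.\<close>

lemma stabilizing_averaged_feedback:
  assumes \<omega>: "\<omega> > 0" and stable: "\<And>t x. t \<ge> 0 \<Longrightarrow> norm (S t x) \<le> R * exp (- (\<omega> + 1) * t) * norm x"
  obtains h G M' where "averaged_feedback T S B F a \<alpha> \<beta> K M h G" "M' \<ge> 1"
    "\<And>t. t \<ge> 0 \<Longrightarrow> onorm (bounded_perturbation.pert T (\<lambda>x. B (G x)) t) \<le> M' * exp (- \<omega> * t)"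
proof -
  define d where "d = a / 2"
  have d: "d > 0" using pos by (simp add: d_def)
  obtain R1 where R1: "R1 \<ge> 1" "\<And>t x. 0 \<le> t \<Longrightarrow> t \<le> d \<Longrightarrow> norm (S t x) \<le> R1 * norm x"
    by (rule S.boundedE[of d]) blast
  define L where "L = R1 + 1"
  \<comment> \<open>This makes \<open>exp t0\<close> at least twice
    \<open>\<bar>R\<bar> + 1\<close>, so the surplus decay \<open>exp (- t0)\<close> reduces
    \<open>R\<close> to at most 1/2; the maximum with 1 keeps \<open>n\<close> positive.\<close>
  obtain n :: nat where n: "ln (2 * (\<bar>R\<bar> + 1)) / d \<le> real n" "n > 0"
    using real_arch_simple[of "max 1 (ln (2 * (\<bar>R\<bar> + 1)) / d)"] by auto
  define t0 where "t0 = real n * d"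
  have t0: "t0 > 0" using n d by (simp add: t0_def)
  have "ln (2 * (\<bar>R\<bar> + 1)) \<le> t0" using n(1) d by (simp add: t0_def field_simps)
  then have "exp (ln (2 * (\<bar>R\<bar> + 1))) \<le> exp t0" by (simp only: exp_le_cancel_iff)
  then have "2 * (\<bar>R\<bar> + 1) \<le> exp t0" by (subst (asm) exp_ln) auto
  then have "R \<le> exp t0 / 2" by simp
  then have "R * exp (- t0) \<le> exp t0 / 2 * exp (- t0)" by (intro mult_right_mono) auto
  then have half: "R * exp (- t0) \<le> 1 / 2" by (simp add: exp_minus)
  have S_t0: "norm (S t0 x) \<le> exp (- \<omega> * t0) / 2 * norm x" for x
  proof -
    have "R * exp (- (\<omega> + 1) * t0) = R * exp (- t0) * exp (- \<omega> * t0)"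
      by (simp add: algebra_simps flip: exp_add)
    also have "\<dots> \<le> 1 / 2 * exp (- \<omega> * t0)" using half by (intro mult_right_mono) auto
    finally have "R * exp (- (\<omega> + 1) * t0) * norm x \<le> 1 / 2 * exp (- \<omega> * t0) * norm x"
      by (intro mult_right_mono) auto
    then show ?thesis using stable[of t0 x] t0 by simp
  qed
  \<comment> \<open>The entry 1 makes \<open>L = R1 + 1\<close> a bound for the perturbed semigroup
    at \<open>d\<close>; the other limits the error accumulated over \<open>n\<close> steps to half
    of the target.\<close>
  define \<epsilon> where "\<epsilon> = min 1 (exp (- \<omega> * t0) / (2 * real n * L ^ n))"
  have \<epsilon>: "\<epsilon> > 0" using n R1 by (simp add: \<epsilon>_def L_def)
  have "\<epsilon> \<le> exp (- \<omega> * t0) / (2 * real n * L ^ n)" by (simp add: \<epsilon>_def)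
  then have \<epsilon>_le: "real n * \<epsilon> * L ^ n \<le> exp (- \<omega> * t0) / 2"
    using n R1 by (simp add: field_simps L_def)
  obtain h G where A: "averaged_feedback T S B F a \<alpha> \<beta> K M h G"
    and close: "\<And>t x. 0 \<le> t \<Longrightarrow> t \<le> d \<Longrightarrow>
      norm (bounded_perturbation.pert T (\<lambda>x. B (G x)) t x - S t x) \<le> \<epsilon> * norm x"
    using averaged_feedback_approximation[OF \<epsilon>] unfolding d_def by blast
  interpret A: averaged_feedback T S B F a \<alpha> \<beta> K M h G by (rule A)
  have pert_d: "norm (A.P.pert d x) \<le> L * norm x" for x
  proof -
    have "norm (A.P.pert d x) \<le> norm (S d x) + norm (A.P.pert d x - S d x)"
      using norm_triangle_ineq[of "S d x" "A.P.pert d x - S d x"] by simp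
    also have "\<dots> \<le> R1 * norm x + \<epsilon> * norm x"
      using d by (intro add_mono R1 close) auto
    also have "\<epsilon> * norm x \<le> 1 * norm x" by (intro mult_right_mono) (auto simp: \<epsilon>_def)
    finally show ?thesis by (simp add: L_def algebra_simps)
  qed
  have "norm (A.P.pert t0 x) \<le> exp (- \<omega> * t0) * norm x" for x
  proof -
    have "norm ((A.P.pert d ^^ n) x - (S d ^^ n) x) \<le> real n * \<epsilon> * L ^ n * norm x"
    proof (rule norm_funpow_diff_le)
      show "linear (A.P.pert d)" using d by (intro A.P.pert.T_linear) auto
      show "norm (S d x) \<le> L * norm x" for x
        using R1(2)[of d x] mult_right_mono[of R1 L "norm x"] d by (simp add: L_def)
    qed (use pert_d close[of d] d \<epsilon> R1 in \<open>auto simp: L_def\<close>)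
    also have "\<dots> \<le> exp (- \<omega> * t0) / 2 * norm x" by (intro mult_right_mono \<epsilon>_le) simp
    finally have "norm (A.P.pert t0 x - S t0 x) \<le> exp (- \<omega> * t0) / 2 * norm x"
      using d by (simp add: A.P.pert.funpow_T S.funpow_T t0_def)
    then show ?thesis
      using S_t0[of x] norm_triangle_ineq[of "S t0 x" "A.P.pert t0 x - S t0 x"] by simp
  qed
  from A.P.pert.exponential_bound[OF t0 \<omega> this] obtain M' where "M' \<ge> 1"
    "\<And>t. t \<ge> 0 \<Longrightarrow> onorm (A.P.pert t) \<le> M' * exp (- \<omega> * t)" by blast
  with A show ?thesis by (rule that)
qed

end

context strongly_continuous
begin

text \<open>Undoes the time reversal in the definition of admissibility, by a reflection and a
  shift, and passes to all shorter intervals, so that one \<open>a\<close> can later serve input,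
  output and growth bounds.\<close>

lemma admissible_output_on_interval:
  fixes F :: "'x \<Rightarrow> 'u::{real_inner, complete_space}"
  assumes X: "hilbert_space_over scX" and U: "hilbert_space_over scU"
    and F: "admissible_output scX scU T F"
  obtains t1 \<alpha> K where "t1 > 0" "\<alpha> > 0" "K > 0"
    "\<And>x y. x \<in> \<D> \<Longrightarrow> y \<in> \<D> \<Longrightarrow> F (x + y) = F x + F y"
    "\<And>r x. x \<in> \<D> \<Longrightarrow> F (r *\<^sub>R x) = r *\<^sub>R F x"
    "\<And>c x. x \<in> \<D> \<Longrightarrow> F (scX c x) = scU c (F x)"
    "\<And>x. x \<in> \<D> \<Longrightarrow> norm (F x) \<le> K * graph_norm T x"
    "\<And>a x. 0 \<le> a \<Longrightarrow> a \<le> t1 \<Longrightarrow> x \<in> \<D> \<Longrightarrow>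
      integral {0..a} (\<lambda>\<tau>. (norm (F (T \<tau> x)))\<^sup>2) \<le> (\<alpha> * norm x)\<^sup>2"
proof -
  have add: "F (x + y) = F x + F y" if "x \<in> \<D>" "y \<in> \<D>" for x y
    using F that by (auto simp: admissible_output_def bounded_on_X1_def)
  have sc: "F (scX c x) = scU c (F x)" if "x \<in> \<D>" for c x
    using F that by (auto simp: admissible_output_def bounded_on_X1_def)
  have scR: "F (r *\<^sub>R x) = r *\<^sub>R F x" if "x \<in> \<D>" for r x
    using sc[OF that, of "of_real r"] X U by (simp add: hilbert_space_over_def)
  obtain K0 where K0: "\<And>x. x \<in> \<D> \<Longrightarrow> norm (F x) \<le> K0 * graph_norm T x"
    using F unfolding admissible_output_def bounded_on_X1_def by blast
  have K: "norm (F x) \<le> (\<bar>K0\<bar> + 1) * graph_norm T x" if "x \<in> \<D>" for x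
    by (rule order_trans[OF K0[OF that] mult_right_mono]) (auto simp: graph_norm_nonneg)
  obtain t1 \<alpha> where t1: "t1 > 0" "\<alpha> > 0"
    and L2: "\<And>x. x \<in> \<D> \<Longrightarrow> (\<lambda>\<tau>. F (T (t1 - \<tau>) x)) \<in> L2_space t1"
      "\<And>x. x \<in> \<D> \<Longrightarrow> L2_norm t1 (\<lambda>\<tau>. F (T (t1 - \<tau>) x)) \<le> \<alpha> * norm x"
    using F unfolding admissible_output_def by blast
  have int: "integral {0..a} (\<lambda>\<tau>. (norm (F (T \<tau> x)))\<^sup>2) \<le> (\<alpha> * norm x)\<^sup>2"
    if a: "0 \<le> a" "a \<le> t1" and x: "x \<in> \<D>" for a x
  proof -
    let ?g = "\<lambda>\<tau>. (norm (F (T \<tau> x)))\<^sup>2"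
    have F_diff: "F (x - y) = F x - F y" if "x \<in> \<D>" "y \<in> \<D>" for x y
      using add[of x "(-1) *\<^sub>R y"] scR[of y "-1"] dom_scaleR(1)[of y "-1"] that by simp
    have "continuous_on {0..} (\<lambda>t. F (T t x))"
    proof (rule continuous_on_bounded_on_X1[where F = F, OF F_diff K])
      show "continuous_on {0..} (\<lambda>t. gen (T t x))"
        using continuous_orbit[of "gen x"] by (rule continuous_on_eq) (simp add: dom_T x)
    qed (auto intro: dom_T x continuous_orbit)
    then have g: "?g integrable_on {0..s}" for s
      by (intro integrable_continuous_real continuous_intros) (auto elim: continuous_on_subset)
    have "integral {0..a} ?g \<le> integral {0..t1} ?g"
      by (rule integral_subset_le) (use a g in auto)
    also have "integral {0..t1} ?g = integral {-t1..0} (\<lambda>\<tau>. ?g (- \<tau>))"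
      using Henstock_Kurzweil_Integration.integral_reflect_real[of t1 0 ?g] by simp
    also have "\<dots> = integral {0..t1} (\<lambda>\<tau>. ?g (t1 - \<tau>))"
      using integral_shift_real_ivl[of "-t1" "-t1" 0 "\<lambda>\<tau>. ?g (- \<tau>)"] by simp
    also have "\<dots> \<le> (\<alpha> * norm x)\<^sup>2"
      using L2(2)[OF x] unfolding L2_norm_eq[OF L2(1)[OF x]] by (rule sqrt_le_D)
    finally show ?thesis .
  qed
  show ?thesis by (rule that[OF t1 _ add scR sc K int]) auto
qed

end

theorem theorem2p7:
  fixes scX :: "'k::real_normed_field \<Rightarrow> 'x::{real_inner, complete_space} \<Rightarrow> 'x"
    and scU :: "'k \<Rightarrow> 'u::{real_inner, complete_space} \<Rightarrow> 'u"
    and T :: "real \<Rightarrow> 'x \<Rightarrow> 'x"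
    and B :: "'u \<Rightarrow> 'x"
  assumes "hilbert_space_over scX"
    and "hilbert_space_over scU"
    and "C0_semigroup scX T"
    and "admissible_input scU scX T B"
    and "\<forall>\<omega>>0. \<exists>F M. admissible_output scX scU T F \<and> M \<ge> 1 \<and>
           (\<exists>S. perturbed_semigroup scX T B F S \<and>
                (\<forall>t\<ge>0. onorm (S t) \<le> M * exp (- \<omega> * t)))"
  shows "\<forall>\<omega>>0. \<exists>F M. bounded_operator scX scU F \<and> M \<ge> 1 \<and>
           (\<exists>S. perturbed_semigroup scX T B F S \<and>
                (\<forall>t\<ge>0. onorm (S t) \<le> M * exp (- \<omega> * t)))"
proof (intro allI impI)
  fix \<omega> :: real assume \<omega>: "\<omega> > 0"
  note X = assms(1) and U = assms(2)
  obtain F R S where F: "admissible_output scX scU T F"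
    and S: "perturbed_semigroup scX T B F S"
    and stable: "\<And>t. t \<ge> 0 \<Longrightarrow> onorm (S t) \<le> R * exp (- (\<omega> + 1) * t)"
    using assms(5)[rule_format, of "\<omega> + 1"] \<omega> by auto
  interpret T: strongly_continuous T by (rule C0_semigroup_imp_strongly_continuous[OF X assms(3)])
  have C0S: "C0_semigroup scX S" using S by (simp add: perturbed_semigroup_def)
  interpret S: strongly_continuous S by (rule C0_semigroup_imp_strongly_continuous[OF X C0S])
  have bopB: "bounded_operator scU scX B" using assms(4) by (simp add: admissible_input_def)
  have B: "bounded_linear B" by (rule bounded_linear_of_bounded_operator[OF U X bopB])
  have B0: "B 0 = 0" by (rule linear_0[OF bounded_linear.linear[OF B]])
  obtain a1 \<beta> where a1: "a1 > 0" "\<beta> > 0"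
    and input: "\<And>t u. 0 \<le> t \<Longrightarrow> t \<le> a1 \<Longrightarrow> u \<in> L2_space t \<Longrightarrow> T.conv (\<lambda>\<tau>. B (u \<tau>)) t \<in> generator_domain T"
    "\<And>t u. 0 \<le> t \<Longrightarrow> t \<le> a1 \<Longrightarrow> u \<in> L2_space t \<Longrightarrow>
      graph_norm T (T.conv (\<lambda>\<tau>. B (u \<tau>)) t) \<le> \<beta> * sqrt (integral {0..t} (\<lambda>\<tau>. (norm (u \<tau>))\<^sup>2))"
    by (rule T.admissible_input_on_intervals[OF B0 assms(4)]) blast
  obtain t1 \<alpha> K where t1: "t1 > 0" "\<alpha> > 0" "K > 0"
    and F_add: "\<And>x y. x \<in> generator_domain T \<Longrightarrow> y \<in> generator_domain T \<Longrightarrow> F (x + y) = F x + F y"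
    and F_scaleR: "\<And>r x. x \<in> generator_domain T \<Longrightarrow> F (r *\<^sub>R x) = r *\<^sub>R F x"
    and F_sc: "\<And>c x. x \<in> generator_domain T \<Longrightarrow> F (scX c x) = scU c (F x)"
    and F_K: "\<And>x. x \<in> generator_domain T \<Longrightarrow> norm (F x) \<le> K * graph_norm T x"
    and out: "\<And>a x. 0 \<le> a \<Longrightarrow> a \<le> t1 \<Longrightarrow> x \<in> generator_domain T \<Longrightarrow>
      integral {0..a} (\<lambda>\<tau>. (norm (F (T \<tau> x)))\<^sup>2) \<le> (\<alpha> * norm x)\<^sup>2"
    by (rule T.admissible_output_on_interval[OF X U F]) blast
  \<comment> \<open>The growth bound is taken on \<open>{0..1}\<close>, so \<open>M\<close>, and
    with it \<open>q\<close>, is fixed before \<open>a\<close>.\<close>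
  obtain M where M: "M \<ge> 1" "\<And>t x. 0 \<le> t \<Longrightarrow> t \<le> 1 \<Longrightarrow> norm (T t x) \<le> M * norm x"
    by (rule T.boundedE[of 1]) blast
  define q where "q = 4 * (K * (M + 2 * \<alpha> * \<beta>) * \<beta>)\<^sup>2"
  have "M + 2 * \<alpha> * \<beta> > 0" using t1 a1 M by (simp add: add_pos_pos)
  then have q: "q > 0" using t1 a1 by (simp add: q_def)
  define a where "a = min (min a1 t1) (min 1 (1 / q))"
  have a: "a > 0" "a \<le> a1" "a \<le> t1" "a \<le> 1" "a \<le> 1 / q"
    using a1 t1 q by (auto simp: a_def)
  then have qa: "q * a \<le> 1" using q by (simp add: pos_le_divide_eq mult.commute)
  interpret pritchard_salamon_feedback T S B F a \<alpha> \<beta> K M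
  proof (intro pritchard_salamon_feedback.intro pritchard_salamon_feedback_axioms.intro)
    show "S t x \<in> generator_domain T" "(\<lambda>\<tau>. F (S \<tau> x)) \<in> L2_space t"
      "S t x = T t x + T.conv (\<lambda>\<tau>. B (F (S \<tau> x))) t"
      if "x \<in> generator_domain T" "0 \<le> t" for x t
      using S that unfolding perturbed_semigroup_def T.conv_def by blast+
  qed (use a qa a1 t1 M in \<open>auto intro: T.strongly_continuous_axioms S.strongly_continuous_axioms B F_add F_scaleR F_K
      input out simp: q_def\<close>)
  have "norm (S t x) \<le> R * exp (- (\<omega> + 1) * t) * norm x" if t: "t \<ge> 0" for t x
    using onorm[OF S.bounded_linear[OF t], of x] mult_right_mono[OF stable[OF t], of "norm x"] by simp
  from stabilizing_averaged_feedback[OF \<omega> this] obtain h G M' where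
    A: "averaged_feedback T S B F a \<alpha> \<beta> K M h G" and M': "M' \<ge> 1"
    "\<And>t. t \<ge> 0 \<Longrightarrow> onorm (bounded_perturbation.pert T (\<lambda>x. B (G x)) t) \<le> M' * exp (- \<omega> * t)"
    by blast
  interpret A: averaged_feedback T S B F a \<alpha> \<beta> K M h G by (rule A)
  note T_sc = C0_semigroup_commute_scalar[OF assms(3)]
  have G_sc: "G (scX c x) = scU c (G x)" for c x
    by (intro A.G_commute bounded_linear_scalar X U T_sc C0_semigroup_commute_scalar[OF C0S] F_sc)
  have B_sc: "B (scU c u) = scX c (B u)" for c u
    using bopB by (simp add: bounded_operator_def Vector_Spaces.linear_iff)
  have "bounded_operator scX scU G"
    by (intro bounded_operatorI X U A.bounded_linear_G G_sc)
  \<comment> \<open>For the bounded feedback, the equation that defines \<open>pert\<close> is the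
    required integral equation. Its orbits stay in the domain because the perturbed generator has
    the same domain, and the outputs are square integrable because they are continuous.\<close>
  moreover have "perturbed_semigroup scX T B G A.P.pert"
    unfolding perturbed_semigroup_def
  proof (intro conjI ballI allI impI)
    show "C0_semigroup scX A.P.pert"
      by (intro A.P.pert.C0_semigroupI X A.P.pert_commute bounded_linear_scalar T_sc)
        (simp_all add: G_sc B_sc)
    fix x t assume x: "x \<in> generator_domain T" and t: "0 \<le> (t::real)"
    show "A.P.pert t x \<in> generator_domain T" by (rule A.P.pert_in_dom[OF x t])
    show "(\<lambda>\<tau>. G (A.P.pert \<tau> x)) \<in> L2_space t"
      by (intro L2_space_continuous bounded_linear.continuous_on[OF A.bounded_linear_G]
          A.P.continuous_on_pert')
    show "A.P.pert t x = T t x + integral {0..t} (\<lambda>\<tau>. T (t - \<tau>) (B (G (A.P.pert \<tau> x))))"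
      using A.P.pert_eq[OF t] by (simp add: T.conv_def)
  qed
  ultimately show "\<exists>F M. bounded_operator scX scU F \<and> M \<ge> 1 \<and>
           (\<exists>S. perturbed_semigroup scX T B F S \<and>
                (\<forall>t\<ge>0. onorm (S t) \<le> M * exp (- \<omega> * t)))"
    using M' by blast
qed

end
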